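(* Let $H = H(q)$ be a function of the prime $q$, with $1 \le H(q) \le q$, satisfying $\frac{\log(q/H)}{\log q} \rightarrow 0$ and $H = o(q)$ as the prime $q \rightarrow \infty$. Then there exist, for the primes $q$, sets $\mathcal{G}_{q,H}$ of Dirichlet characters modulo $q$, satisfying $$ \#\mathcal{G}_{q,H} \geq q\left(1 - O\left(e^{-\log^{3/4}(q/H)}\right)\right), $$ such that for any choice of $\chi = \chi_q \in \mathcal{G}_{q,H}$ (for each prime $q$), with $X$ uniformly distributed on $\{0,1,\dots,q-1\}$, we have the convergence in distribution $$ \frac{S_{\chi,H}(X)}{\sqrt{H}} \stackrel{d}{\rightarrow} Z_1 + iZ_2 \quad \text{as } q \rightarrow \infty, $$ where $Z_1, Z_2$ are independent $N(0,1/2)$ random variables.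
   Context: For a Dirichlet character $\chi$ modulo a prime $q$, a real number $H$ with $1 \le H \le q$, and $x \in \{0,1,\dots,q-1\}$, define $S_{\chi,H}(x) := \sum_{x < n \leq x+H} \chi(n)$ (sum over integers $n$). Here $\log^{3/4}(y) = (\log y)^{3/4}$, the implied constant in $O(\cdot)$ does not depend on $q$, and $N(0,1/2)$ is the real Gaussian distribution with mean $0$ and variance $1/2$. *)

theory Defs
  imports "HOL-Probability.Probability" "HOL-Number_Theory.Number_Theory"
    "HOL-Library.Landau_Symbols"
begin

definition dirichlet_character :: "nat \<Rightarrow> (int \<Rightarrow> complex) \<Rightarrow> bool" where
  "dirichlet_character q chi \<longleftrightarrow>
     (\<forall>m n. chi (m * n) = chi m * chi n) \<and>
     (\<forall>n. chi (n + int q) = chi n) \<and>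
     (\<forall>n. chi n \<noteq> 0 \<longleftrightarrow> coprime n (int q))"

definition char_sum :: "(int \<Rightarrow> complex) \<Rightarrow> real \<Rightarrow> int \<Rightarrow> complex" where
  "char_sum chi H x = (\<Sum>n | x < n \<and> real_of_int n \<le> real_of_int x + H. chi n)"

definition primes_at_top :: "nat filter" where
  "primes_at_top = inf at_top (principal {q. prime q})"

text \<open>
  Weak convergence of Borel probability measures along a filter. The library notion
  \<^const>\<open>weak_conv_m\<close> only covers sequences of measures on the real line.
\<close>

definition weak_conv_along ::
  "('i \<Rightarrow> 'a::topological_space measure) \<Rightarrow> 'a measure \<Rightarrow> 'i filter \<Rightarrow> bool" where
  "weak_conv_along \<mu> \<nu> F \<longleftrightarrow>
     (\<forall>f :: 'a \<Rightarrow> real. continuous_on UNIV f \<longrightarrow> bounded (range f) \<longrightarrow>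
        ((\<lambda>i. \<integral>x. f x \<partial>\<mu> i) \<longlongrightarrow> (\<integral>x. f x \<partial>\<nu>)) F)"

end

theory Submission
  imports Defs "HOL-Real_Asymp.Real_Asymp"
begin

text \<open>
  Put \<open>N = q / H\<close>. Polya's expansion writes \<open>S(x) / sqrt H\<close> as a unimodular constant times
  \<open>\<Sum> cnj (chi k) * \<alpha>(k) * e(- k x / q)\<close> over \<open>\<bar>k\<bar> < q / 2\<close>, where the squares \<open>\<bar>\<alpha>(k)\<bar>\<^sup>2\<close> are at most
  \<open>1 / N\<close>, add up to nearly 1, and are negligible in sum beyond \<open>\<bar>k\<bar> = r N\<close> once \<open>r\<close> is large.
  Since \<open>N\<close> is smaller than every power of \<open>q\<close>, the mixed moments over \<open>x\<close> of the truncated sum \<open>Q\<close> and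
  their second moments over \<open>chi\<close> are given exactly by integer equations.

  Gaussian moments are characterised by integration by parts:
  \<open>E Q^a cnj(Q)^b = a * E Q^(a-1) cnj(Q)^(b-1)\<close>. The difference of the two sides is a sum over tuples with
  \<open>k_1 + ... + k_a = l_1 + ... + l_b\<close> in which \<open>l_1\<close> does not equal exactly one of the \<open>k_i\<close>. Its variance
  over \<open>chi\<close> saves a power of \<open>N\<close>: a large common factor \<open>g\<close> of \<open>l_1\<close> and another variable cancels
  from the multiplicative equation and is determined by the linear one, while the divisor bound
  controls the remaining variables. So all but \<open>O(q N^(-c))\<close> characters satisfy the recursion
  approximately. A diagonal choice of \<open>r\<close>, which also bounds the moments under consideration, then gives
  convergence of all moments, and hence of characteristic functions.
\<close>

section \<open>Dirichlet characters modulo a prime\<close>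

text \<open>Every fixed power of \<open>N = q / H\<close> is eventually below \<open>q\<close>, by
  the hypothesis on \<open>log (q / H) / log q\<close>; this is what turns congruences modulo
  \<open>q\<close> into equations. The multiplicative equation alone, in \<open>2 J\<close>
  variables of size about \<open>N\<close>, has \<open>N^(J + o(1))\<close> solutions by the divisor
  bound, which merely cancels the factor \<open>N^(-J)\<close> coming from the coefficients. A power
  saving must therefore come from the linear equation. It gives none when the \<open>k_i\<close> are
  a rearrangement of the \<open>l_i\<close>, since it then holds identically. Integration by parts
  removes such coincidences one variable at a time, which avoids the combinatorics of complete
  matchings.

  The saved exponent \<open>1 / (4 J)\<close> shrinks as the order \<open>J = a + b\<close> of the
  moment grows, and the order must tend to infinity with \<open>q\<close>. Hence no fixed power of
  \<open>N\<close> survives in the count of exceptions, but \<open>exp (- (log N)^(3/4))\<close>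
  decays more slowly than each \<open>N^(-c)\<close>; every exponent below 1 has this
  property.\<close>

definition ee :: "nat \<Rightarrow> int \<Rightarrow> complex" where
  "ee q k = cis (2 * pi * of_int k / of_nat q)"

lemma ee_add: "ee q (k + l) = ee q k * ee q l"
  by (simp add: ee_def cis_mult ring_distribs add_divide_distrib)

lemma ee_0 [simp]: "ee q 0 = 1"
  by (simp add: ee_def)

lemma norm_ee [simp]: "norm (ee q k) = 1"
  by (simp add: ee_def)

lemma ee_minus: "ee q (- k) = cnj (ee q k)"
  by (simp add: ee_def cis_cnj)

lemma ee_diff: "ee q (k - l) = ee q k * cnj (ee q l)"
  using ee_add[of q k "- l"] by (simp add: ee_minus)

lemma ee_power: "ee q (k * int n) = ee q k ^ n"
proof -
  have "2 * pi * of_int (k * int n) / of_nat q = real n * (2 * pi * of_int k / of_nat q)" by simp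
  then show ?thesis by (simp only: ee_def Complex.DeMoivre)
qed

lemma ee_eq_1_iff:
  assumes "q > 0"
  shows "ee q k = 1 \<longleftrightarrow> int q dvd k"
proof -
  have "ee q k = 1 \<longleftrightarrow> (\<exists>n::int. 2 * pi * of_int k / of_nat q = of_int (2 * n) * pi)"
    by (simp add: ee_def cis_conv_exp exp_eq_1)
  also have "\<dots> \<longleftrightarrow> (\<exists>n::int. real_of_int k = real_of_int (int q * n))"
    using assms by (intro arg_cong[where f = Ex] ext) (simp add: field_simps)
  also have "\<dots> \<longleftrightarrow> int q dvd k" by (simp only: of_int_eq_iff dvd_def)
  finally show ?thesis .
qed

lemma ee_cong:
  assumes "q > 0" "[k = l] (mod int q)"
  shows "ee q k = ee q l"
proof -
  have "ee q (k - l) = 1" using assms by (simp add: ee_eq_1_iff cong_iff_dvd_diff)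
  then show ?thesis using ee_add[of q "k - l" l] by simp
qed

lemma sum_ee:
  assumes "q > 0"
  shows "(\<Sum>j<q. ee q (k * int j)) = (if int q dvd k then of_nat q else 0)"
proof (cases "int q dvd k")
  case True
  then have "ee q k = 1" using assms by (simp add: ee_eq_1_iff)
  then show ?thesis using True by (simp add: ee_power)
next
  case False
  then have "ee q k \<noteq> 1" using assms by (simp add: ee_eq_1_iff)
  moreover have "ee q k ^ q = 1" using assms by (simp add: ee_eq_1_iff flip: ee_power)
  ultimately show ?thesis using False by (simp add: ee_power sum_gp_strict)
qed

section \<open>Primitive root, discrete logarithm and the characters they define\<close>

definition proot :: "nat \<Rightarrow> nat" where
  "proot q = (SOME g. residue_primroot q g)"

text \<open>The choice fixes an exponent only up to multiples of \<open>q - 1\<close>, so the facts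
  below are congruences modulo \<open>q - 1\<close>. The predicate sees \<open>n\<close> only
  through its residue class, so \<open>dlog\<close> itself is exactly periodic in
  \<open>n\<close>.\<close>

definition dlog :: "nat \<Rightarrow> int \<Rightarrow> nat" where
  "dlog q n = (SOME i. [n = int (proot q ^ i)] (mod int q))"

text \<open>The character sending the primitive root to \<open>ee (q - 1) j\<close>;
  \<open>j = 0\<close> is the principal one.\<close>

definition dchar :: "nat \<Rightarrow> nat \<Rightarrow> int \<Rightarrow> complex" where
  "dchar q j n = (if coprime n (int q) then ee (q - 1) (int j * int (dlog q n)) else 0)"

context
  fixes q :: nat
  assumes q: "prime q"
begin

lemma proot: "coprime q (proot q)" "ord q (proot q) = q - 1" "residue_primroot q (proot q)"
proof -
  have "residue_primroot q (proot q)"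
    unfolding proot_def using prime_primitive_root_exists[of q] q prime_gt_1_nat
    by (intro someI_ex[of "residue_primroot q"]) blast
  then show "coprime q (proot q)" "ord q (proot q) = q - 1" "residue_primroot q (proot q)"
    using q by (simp_all add: residue_primroot_def totient_prime)
qed

lemma dlog:
  assumes "coprime n (int q)"
  shows "[n = int (proot q ^ dlog q n)] (mod int q)"
proof -
  have q1: "q > 1" using q prime_gt_1_nat by blast
  define m where "m = nat (n mod int q)"
  have m: "int m = n mod int q" using q1 by (simp add: m_def)
  have "coprime (int m) (int q)" using assms q1 coprime_mod_left_iff[of "int q" n] by (simp add: m)
  moreover have "m \<noteq> 0" using calculation q1 by (intro notI) simp
  moreover have "m < q" using m q1 by (simp add: m_def nat_less_iff)
  ultimately have "m \<in> totatives q" by (auto simp: totatives_def)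
  then obtain i where "m = proot q ^ i mod q"
    using residue_primroot_is_generator[OF q1 proot(3)] by (auto simp: bij_betw_def)
  then have "[n = int (proot q ^ i)] (mod int q)"
    using m by (simp add: cong_def zmod_int)
  then show ?thesis unfolding dlog_def by (rule someI)
qed

lemma cong_pow_proot_iff:
  "[int (proot q ^ i) = int (proot q ^ j)] (mod int q) \<longleftrightarrow> [int i = int j] (mod int (q - 1))"
  using order_divides_expdiff[OF proot(1), of i j] by (simp only: proot(2) cong_int_iff)

lemma dlog_cong_iff:
  assumes "coprime m (int q)" "coprime n (int q)"
  shows "[int (dlog q m) = int (dlog q n)] (mod int (q - 1)) \<longleftrightarrow> [m = n] (mod int q)"
  using dlog[OF assms(1)] dlog[OF assms(2)] cong_pow_proot_iff[of "dlog q m" "dlog q n"]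
  by (meson cong_sym cong_trans)

lemma dlog_mult:
  assumes "coprime m (int q)" "coprime n (int q)"
  shows "[int (dlog q (m * n)) = int (dlog q m) + int (dlog q n)] (mod int (q - 1))"
proof -
  have "[m * n = int (proot q ^ dlog q m) * int (proot q ^ dlog q n)] (mod int q)"
    by (intro cong_mult dlog assms)
  moreover have "[m * n = int (proot q ^ dlog q (m * n))] (mod int q)"
    using assms by (intro dlog) simp
  ultimately have "[int (proot q ^ dlog q (m * n)) = int (proot q ^ (dlog q m + dlog q n))] (mod int q)"
    by (simp add: power_add) (meson cong_sym cong_trans)
  then show ?thesis unfolding cong_pow_proot_iff by simp
qed

lemma q_minus_1_pos: "q - 1 > 0"
  using prime_gt_1_nat[OF q] by simp

lemma norm_dchar: "coprime n (int q) \<Longrightarrow> norm (dchar q j n) = 1"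
  by (simp add: dchar_def)

lemma dirichlet_character_dchar: "dirichlet_character q (dchar q j)"
  unfolding dirichlet_character_def
proof (intro conjI allI)
  fix m n :: int
  show "dchar q j (m * n) = dchar q j m * dchar q j n"
  proof (cases "coprime m (int q) \<and> coprime n (int q)")
    case True
    then have "[int j * int (dlog q (m * n)) = int j * (int (dlog q m) + int (dlog q n))] (mod int (q - 1))"
      by (intro cong_mult dlog_mult) auto
    then have "ee (q - 1) (int j * int (dlog q (m * n))) = ee (q - 1) (int j * (int (dlog q m) + int (dlog q n)))"
      by (rule ee_cong[OF q_minus_1_pos])
    then show ?thesis using True by (simp add: dchar_def ee_add ring_distribs)
  next
    case False
    then show ?thesis by (auto simp: dchar_def)
  qed
next
  fix n :: int
  have "[n + int q = n] (mod int q)" by (simp add: cong_def)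
  then have "(\<lambda>i. [n + int q = int (proot q ^ i)] (mod int q)) = (\<lambda>i. [n = int (proot q ^ i)] (mod int q))"
    by (simp add: cong_def)
  then have "dlog q (n + int q) = dlog q n" by (simp only: dlog_def)
  moreover have "coprime (n + int q) (int q) \<longleftrightarrow> coprime n (int q)" by (simp add: coprime_iff_gcd_eq_1)
  ultimately show "dchar q j (n + int q) = dchar q j n" by (simp add: dchar_def)
next
  fix n :: int
  have "ee (q - 1) k \<noteq> 0" for k by (metis norm_ee norm_zero zero_neq_one)
  then show "(dchar q j n \<noteq> 0) = coprime n (int q)" by (simp add: dchar_def)
qed

lemma dchar_orthogonal:
  assumes "coprime m (int q)" "coprime n (int q)"
  shows "(\<Sum>j<q - 1. dchar q j m * cnj (dchar q j n)) = (if [m = n] (mod int q) then of_nat (q - 1) else 0)"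
proof -
  have "(\<Sum>j<q - 1. dchar q j m * cnj (dchar q j n)) =
      (\<Sum>j<q - 1. ee (q - 1) ((int (dlog q m) - int (dlog q n)) * int j))"
    using assms by (intro sum.cong) (simp_all add: dchar_def left_diff_distrib ee_diff mult.commute[of "int (dlog q _)"])
  also have "\<dots> = (if int (q - 1) dvd int (dlog q m) - int (dlog q n) then of_nat (q - 1) else 0)"
    by (rule sum_ee[OF q_minus_1_pos])
  also have "int (q - 1) dvd int (dlog q m) - int (dlog q n) \<longleftrightarrow> [m = n] (mod int q)"
    using dlog_cong_iff[OF assms] by (simp only: cong_iff_dvd_diff)
  finally show ?thesis .
qed

lemma coprime_proot: "coprime (int (proot q)) (int q)"
  using proot(1) by (simp add: coprime_commute)

lemma dchar_proot: "dchar q j (int (proot q)) = ee (q - 1) (int j)"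
proof -
  have "[int (proot q ^ dlog q (int (proot q))) = int (proot q ^ 1)] (mod int q)"
    using dlog[OF coprime_proot] by (simp add: cong_sym)
  then have "[int (dlog q (int (proot q))) = int 1] (mod int (q - 1))"
    by (simp only: cong_pow_proot_iff)
  then have "[int j * int (dlog q (int (proot q))) = int j * 1] (mod int (q - 1))"
    by (intro cong_mult) auto
  then show ?thesis
    using ee_cong[OF q_minus_1_pos] coprime_proot by (simp add: dchar_def)
qed

text \<open>The value at the primitive root recovers \<open>j\<close> modulo \<open>q - 1\<close>.
  Counting characters thus becomes counting indices.\<close>

lemma inj_on_dchar: "inj_on (dchar q) {..<q - 1}"
proof (rule inj_onI)
  fix i j assume ij: "i \<in> {..<q - 1}" "j \<in> {..<q - 1}" "dchar q i = dchar q j"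
  then have "ee (q - 1) (int i) = ee (q - 1) (int j)" using dchar_proot by metis
  then have "ee (q - 1) (int i - int j) = 1" unfolding ee_diff
    by (simp add: complex_norm_square[symmetric])
  then have "[int i = int j] (mod int (q - 1))"
    by (simp only: ee_eq_1_iff[OF q_minus_1_pos] cong_iff_dvd_diff)
  then have "[i = j] (mod (q - 1))" by (simp only: cong_int_iff)
  then show "i = j" using ij by (simp add: cong_def)
qed

lemma dchar_proot_neq_1:
  assumes "0 < j" "j < q - 1"
  shows "dchar q j (int (proot q)) \<noteq> 1"
proof
  assume "dchar q j (int (proot q)) = 1"
  then have "int (q - 1) dvd int j" by (simp only: dchar_proot ee_eq_1_iff[OF q_minus_1_pos])
  then have "q - 1 dvd j" by (simp only: int_dvd_int_iff)
  then show False using assms dvd_imp_le[of "q - 1" j] by simp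
qed

end

section \<open>Counting solutions of a multiplicative and a linear equation\<close>

lemma card_divisors_mult_le:
  fixes a b :: nat
  assumes "a > 0" "b > 0"
  shows "card {d. d dvd a * b} \<le> card {d. d dvd a} * card {d. d dvd b}"
proof -
  have "{d. d dvd a * b} \<subseteq> (\<lambda>(x, y). x * y) ` ({d. d dvd a} \<times> {d. d dvd b})"
    using division_decomp[of _ a b] by force
  then have "card {d. d dvd a * b} \<le> card ({d. d dvd a} \<times> {d. d dvd b})"
    using assms by (intro surj_card_le) auto
  then show ?thesis by (simp add: card_cartesian_product)
qed

lemma card_divisors_prime_power_le:
  fixes p :: nat
  assumes "prime p"
  shows "card {d. d dvd p ^ e} \<le> e + 1"
proof -
  have "{d. d dvd p ^ e} \<subseteq> (\<lambda>i. p ^ i) ` {..e}"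
    using divides_primepow_nat[OF assms] by auto
  then have "card {d. d dvd p ^ e} \<le> card {..e}"
    by (intro surj_card_le) auto
  then show ?thesis by simp
qed

text \<open>The classical argument, one prime power at a time. If \<open>p\<close> is so large that
  \<open>p powr \<epsilon> \<ge> 2\<close>, then \<open>e + 1 \<le> 2 ^ e\<close> is at most
  \<open>p powr (\<epsilon> * e)\<close>. Each of the boundedly many smaller primes costs a constant
  factor \<open>c\<close>.\<close>

lemma card_divisors_nat_le:
  fixes \<epsilon> :: real
  assumes \<epsilon>: "\<epsilon> > 0"
  shows "\<exists>C>0. \<forall>n::nat. n > 0 \<longrightarrow> real (card {d. d dvd n}) \<le> C * real n powr \<epsilon>"
proof -
  \<comment> \<open>This \<open>c\<close> satisfies
    \<open>e + 1 \<le> c * (1 + \<epsilon> * e * ln 2)\<close>, and the bracket is at most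
    \<open>2 powr (\<epsilon> * e)\<close>.\<close>
  define c where "c = 1 + 1 / (\<epsilon> * ln 2)"
  define B where "B = nat \<lceil>2 powr (1 / \<epsilon>)\<rceil>"
  define G where "G n = {r. prime r \<and> r dvd n \<and> r < B}" for n :: nat
  have c1: "c \<ge> 1" using \<epsilon> by (simp add: c_def)
  have small: "real (e + 1) \<le> c * real p powr (\<epsilon> * real e)" if "prime p" for p e
  proof -
    have "real (e + 1) \<le> c * (1 + \<epsilon> * real e * ln 2)"
      using \<epsilon> by (simp add: c_def field_simps)
    also have "1 + \<epsilon> * real e * ln 2 \<le> 2 powr (\<epsilon> * real e)"
      using exp_ge_add_one_self[of "\<epsilon> * real e * ln 2"] by (simp add: powr_def)
    also have "2 powr (\<epsilon> * real e) \<le> real p powr (\<epsilon> * real e)"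
      using \<epsilon> prime_ge_2_nat[OF that] by (intro powr_mono2) auto
    finally show ?thesis using c1 by simp
  qed
  have large: "real (e + 1) \<le> real p powr (\<epsilon> * real e)" if "prime p" "p \<ge> B" for p e
  proof -
    have "2 powr (1 / \<epsilon>) \<le> real p" using that(2) by (simp add: B_def nat_le_iff ceiling_le_iff)
    then have "(2 powr (1 / \<epsilon>)) powr \<epsilon> \<le> real p powr \<epsilon>" using \<epsilon> by (intro powr_mono2) auto
    then have "2 \<le> real p powr \<epsilon>" using \<epsilon> by (simp add: powr_powr)
    then have "2 ^ e \<le> (real p powr \<epsilon>) ^ e" by (intro power_mono) auto
    moreover have "real (e + 1) \<le> 2 ^ e"
      using of_nat_mono[OF Suc_leI[OF less_exp[of e]], where 'a = real] by simp
    moreover have "(real p powr \<epsilon>) ^ e = real p powr (\<epsilon> * real e)"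
      using prime_gt_0_nat[OF that(1)] by (simp add: powr_power mult.commute)
    ultimately show ?thesis by linarith
  qed
  have "real (card {d. d dvd n}) \<le> c ^ card (G n) * real n powr \<epsilon>" if "n > 0" for n
    using that
  proof (induction n rule: less_induct)
    case (less n)
    show ?case
    proof (cases "n = 1")
      case True
      have "G n = {}" using True by (auto simp: G_def)
      then show ?thesis using True by simp
    next
      case False
      then obtain p where p: "prime p" "p dvd n" using prime_factor_nat by blast
      obtain m where m: "n = p ^ multiplicity p n * m" "\<not> p dvd m"
        using multiplicity_decompose'[of n p] less.prems p(1)
        by (metis not_prime_unit neq0_conv)
      define e where "e = multiplicity p n"
      have ne: "n = p ^ e * m" using m(1) by (simp add: e_def)
      have e: "e > 0" using p less.prems by (simp add: e_def prime_multiplicity_gt_zero_iff)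
      have m0: "m > 0" using m(2) by (intro Nat.gr0I) auto
      have p2: "p \<ge> 2" using p(1) prime_ge_2_nat by blast
      have "m < n"
      proof -
        have "1 < p ^ e" using p2 e by (intro one_less_power) auto
        then have "1 * m < p ^ e * m" using m0 by (intro mult_strict_right_mono) auto
        then show ?thesis by (simp only: ne[symmetric] mult_1)
      qed
      then have IH: "real (card {d. d dvd m}) \<le> c ^ card (G m) * real m powr \<epsilon>"
        using less.IH m0 by blast
      have fin: "finite (G n)" unfolding G_def by (rule finite_subset[of _ "{..<B}"]) auto
      have sub: "G m \<subseteq> G n - {p}" using ne m(2) by (auto simp: G_def)
      have pe: "real (p ^ e) powr \<epsilon> = real p powr (\<epsilon> * real e)"
        using p2 powr_powr[of "real p" "real e" \<epsilon>] by (simp add: powr_realpow mult.commute)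
      \<comment> \<open>A small prime \<open>p\<close> lies in \<open>G n\<close> but not in
        \<open>G m\<close>, which frees exactly the factor \<open>c\<close> that it costs.\<close>
      have step: "c ^ card (G m) * real (e + 1) \<le> c ^ card (G n) * real (p ^ e) powr \<epsilon>"
      proof (cases "p < B")
        case True
        then have "p \<in> G n" using p by (auto simp: G_def)
        then have "card (G n - {p}) = card (G n) - 1" "card (G n) > 0"
          using fin by (auto simp: card_gt_0_iff)
        then have "card (G m) + 1 \<le> card (G n)"
          using card_mono[OF _ sub] fin by auto
        then have "c ^ card (G m) * c \<le> c ^ card (G n)"
          using c1 power_increasing[of "card (G m) + 1" "card (G n)" c] by (simp add: mult.commute)
        then have "c ^ card (G m) * c * real p powr (\<epsilon> * real e) \<le> c ^ card (G n) * real p powr (\<epsilon> * real e)"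
          by (intro mult_right_mono) auto
        moreover have "c ^ card (G m) * real (e + 1) \<le> c ^ card (G m) * (c * real p powr (\<epsilon> * real e))"
          using small[OF p(1), of e] c1 by (intro mult_left_mono) auto
        ultimately show ?thesis unfolding pe by (simp only: mult.assoc)
      next
        case False
        have "card (G m) \<le> card (G n)" using sub fin by (intro card_mono) auto
        then have "c ^ card (G m) \<le> c ^ card (G n)" using c1 by (intro power_increasing)
        then show ?thesis unfolding pe
          using large[OF p(1), of e] False c1 by (intro mult_mono) auto
      qed
      have "card {d. d dvd n} \<le> (e + 1) * card {d. d dvd m}"
      proof -
        have "card {d. d dvd p ^ e * m} \<le> card {d. d dvd p ^ e} * card {d. d dvd m}"
          using m0 p2 by (intro card_divisors_mult_le) auto
        also have "\<dots> \<le> (e + 1) * card {d. d dvd m}"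
          by (intro mult_le_mono1 card_divisors_prime_power_le p(1))
        finally show ?thesis by (simp only: ne[symmetric])
      qed
      then have "real (card {d. d dvd n}) \<le> real (e + 1) * real (card {d. d dvd m})"
        by (metis of_nat_le_iff of_nat_mult)
      also have "\<dots> \<le> real (e + 1) * (c ^ card (G m) * real m powr \<epsilon>)"
        using IH by (intro mult_left_mono) auto
      also have "\<dots> = (c ^ card (G m) * real (e + 1)) * real m powr \<epsilon>" by (simp only: mult_ac)
      also have "\<dots> \<le> (c ^ card (G n) * real (p ^ e) powr \<epsilon>) * real m powr \<epsilon>"
        using step by (intro mult_right_mono) auto
      also have "\<dots> = c ^ card (G n) * real n powr \<epsilon>"
      proof -
        have "real n = real (p ^ e) * real m" by (metis ne of_nat_mult)
        then show ?thesis by (simp only: powr_mult of_nat_0_le_iff mult_ac)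
      qed
      finally show ?thesis .
    qed
  qed
  moreover have "c ^ card (G n) * real n powr \<epsilon> \<le> c ^ B * real n powr \<epsilon>" for n
  proof -
    have "card (G n) \<le> card {..<B}" by (intro card_mono) (auto simp: G_def)
    then show ?thesis using c1 by (intro mult_right_mono power_increasing) auto
  qed
  ultimately show ?thesis
    using c1 by (intro exI[of _ "c ^ B"]) (auto intro: order_trans)
qed

lemma card_divisors_int_le:
  fixes \<epsilon> :: real
  assumes \<epsilon>: "\<epsilon> > 0"
  shows "\<exists>C>0. \<forall>n::int. n \<noteq> 0 \<longrightarrow> real (card {d. d dvd n}) \<le> C * of_int \<bar>n\<bar> powr \<epsilon>"
proof -
  obtain C where C: "C > 0" "\<And>n::nat. n > 0 \<Longrightarrow> real (card {d. d dvd n}) \<le> C * real n powr \<epsilon>"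
    using card_divisors_nat_le[OF \<epsilon>] by blast
  have "real (card {d. d dvd n}) \<le> 2 * C * of_int \<bar>n\<bar> powr \<epsilon>" if n: "n \<noteq> 0" for n :: int
  proof -
    define D where "D = {d. d dvd nat \<bar>n\<bar>}"
    have D: "finite D" unfolding D_def by (rule finite_divisors_nat) (use n in simp)
    have "{d. d dvd n} \<subseteq> int ` D \<union> (\<lambda>d. - int d) ` D"
    proof
      fix d assume "d \<in> {d. d dvd n}"
      then have "nat \<bar>d\<bar> \<in> D" by (simp add: D_def nat_abs_dvd_iff)
      moreover have "d = int (nat \<bar>d\<bar>) \<or> d = - int (nat \<bar>d\<bar>)" by auto
      ultimately show "d \<in> int ` D \<union> (\<lambda>d. - int d) ` D" by blast
    qed
    then have "card {d. d dvd n} \<le> card (int ` D \<union> (\<lambda>d. - int d) ` D)"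
      using D by (intro card_mono) auto
    also have "\<dots> \<le> card D + card D"
      using D by (intro order_trans[OF card_Un_le] add_mono card_image_le)
    finally have "real (card {d. d dvd n}) \<le> 2 * real (card D)" by simp
    also have "\<dots> \<le> 2 * (C * real (nat \<bar>n\<bar>) powr \<epsilon>)"
      using C(2)[of "nat \<bar>n\<bar>"] n by (simp add: D_def)
    finally show ?thesis by simp
  qed
  then show ?thesis using C(1) by (intro exI[of _ "2 * C"]) auto
qed

text \<open>Leaving out 0 keeps products nonzero, so that the divisor bound applies, and keeps the
  character values unimodular. The frequency 0 is charged to the truncation error in
  \<open>tail_coef_le\<close>.\<close>

definition nzbox :: "nat \<Rightarrow> int set" where
  "nzbox K = {k. k \<noteq> 0 \<and> \<bar>k\<bar> \<le> int K}"

definition vecs :: "nat \<Rightarrow> nat \<Rightarrow> int list set" where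
  "vecs J K = {xs. set xs \<subseteq> nzbox K \<and> length xs = J}"

lemma finite_nzbox: "finite (nzbox K)"
  by (rule finite_subset[of _ "{- int K..int K}"]) (auto simp: nzbox_def)

lemma card_abs_le:
  assumes "Y \<ge> (0::real)"
  shows "real (card {k::int. k \<noteq> 0 \<and> of_int \<bar>k\<bar> \<le> Y}) \<le> 2 * Y"
proof -
  define y where "y = \<lfloor>Y\<rfloor>"
  have y: "y \<ge> 0" "of_int y \<le> Y" using assms by (auto simp: y_def)
  have "{k::int. k \<noteq> 0 \<and> of_int \<bar>k\<bar> \<le> Y} = {-y..-1} \<union> {1..y}"
    unfolding y_def by (auto simp: le_floor_iff floor_le_iff minus_le_iff abs_le_iff)
  also have "card \<dots> = nat y + nat y"
    by (subst card_Un_disjoint) auto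
  finally show ?thesis using y by simp
qed

lemma card_nzbox: "card (nzbox K) \<le> 2 * K"
proof -
  have "nzbox K = {k. k \<noteq> 0 \<and> of_int \<bar>k\<bar> \<le> real K}"
    unfolding nzbox_def by (metis of_int_le_iff of_int_of_nat_eq)
  then have "real (card (nzbox K)) \<le> real (2 * K)"
    using card_abs_le[of "real K"] by (simp del: of_int_abs)
  then show ?thesis by (simp only: of_nat_le_iff)
qed

lemma finite_vecs: "finite (vecs J K)"
  unfolding vecs_def by (rule finite_lists_length_eq[OF finite_nzbox])

lemma card_vecs: "card (vecs J K) \<le> (2 * K) ^ J"
  unfolding vecs_def card_lists_length_eq[OF finite_nzbox] by (rule power_mono[OF card_nzbox]) simp

lemma vecs_nonzero: "xs \<in> vecs J K \<Longrightarrow> prod_list xs \<noteq> 0"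
  by (auto simp: vecs_def nzbox_def prod_list_zero_iff)

lemma abs_prod_list_le:
  assumes "set xs \<subseteq> nzbox K"
  shows "\<bar>prod_list xs\<bar> \<le> int K ^ length xs"
  using assms by (induction xs) (auto simp: abs_mult nzbox_def intro!: mult_mono)

lemma card_vecs_hd_le:
  assumes Y: "Y \<ge> 0" and J: "J > 0"
  shows "real (card {m \<in> vecs J K. of_int \<bar>hd m\<bar> \<le> Y}) \<le> 2 * Y * (2 * real K) ^ (J - 1)"
proof -
  define A where "A = {k::int. k \<noteq> 0 \<and> of_int \<bar>k\<bar> \<le> Y}"
  have A: "finite A"
    by (rule finite_subset[of _ "{-\<lfloor>Y\<rfloor>..\<lfloor>Y\<rfloor>}"]) (auto simp: A_def le_floor_iff minus_le_iff abs_le_iff)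
  have "{m \<in> vecs J K. of_int \<bar>hd m\<bar> \<le> Y} \<subseteq> (\<lambda>(x, xs). x # xs) ` (A \<times> vecs (J - 1) K)"
  proof
    fix m assume m: "m \<in> {m \<in> vecs J K. of_int \<bar>hd m\<bar> \<le> Y}"
    then obtain x xs where "m = x # xs" using J by (cases m) (auto simp: vecs_def)
    then show "m \<in> (\<lambda>(x, xs). x # xs) ` (A \<times> vecs (J - 1) K)"
      using m by (auto simp: vecs_def A_def nzbox_def image_iff)
  qed
  then have "card {m \<in> vecs J K. of_int \<bar>hd m\<bar> \<le> Y} \<le> card A * card (vecs (J - 1) K)"
    using A finite_vecs
    using surj_card_le[of "A \<times> vecs (J - 1) K" _ "\<lambda>(x, xs). x # xs"]
    by (simp add: card_cartesian_product)
  then have "real (card {m \<in> vecs J K. of_int \<bar>hd m\<bar> \<le> Y}) \<le> real (card A) * real (card (vecs (J - 1) K))"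
    by (metis of_nat_le_iff of_nat_mult)
  also have "\<dots> \<le> (2 * Y) * (2 * real K) ^ (J - 1)"
  proof (intro mult_mono)
    show "real (card A) \<le> 2 * Y" unfolding A_def by (rule card_abs_le[OF Y])
    show "real (card (vecs (J - 1) K)) \<le> (2 * real K) ^ (J - 1)"
      using of_nat_mono[OF card_vecs[of "J - 1" K], where 'a = real] by simp
  qed (use Y in auto)
  finally show ?thesis .
qed

text \<open>If positions \<open>i < i'\<close> carry the same entry, the later one can be deleted
  and restored from \<open>i\<close>, \<open>i'\<close> and the shorter vector. Deleting the later
  one does not move the earlier.\<close>

lemma card_vecs_not_distinct:
  "card {n \<in> vecs J K. \<not> distinct n} \<le> J * J * (2 * K) ^ (J - 1)"
proof -
  define f where "f = (\<lambda>(i, i', xs). take i' xs @ xs ! i # drop i' (xs :: int list))"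
  have "{n \<in> vecs J K. \<not> distinct n} \<subseteq> f ` ({..<J} \<times> {..<J} \<times> vecs (J - 1) K)"
  proof
    fix n assume "n \<in> {n \<in> vecs J K. \<not> distinct n}"
    then have n: "set n \<subseteq> nzbox K" "length n = J" "\<not> distinct n" by (auto simp: vecs_def)
    then obtain i i' where i: "i < i'" "i' < J" "n ! i = n ! i'"
      by (metis distinct_conv_nth nat_neq_iff)
    define xs where "xs = take i' n @ drop (Suc i') n"
    have "set xs \<subseteq> set n" by (auto simp: xs_def dest: in_set_takeD in_set_dropD)
    then have "xs \<in> vecs (J - 1) K" using n i by (auto simp: vecs_def xs_def)
    moreover have "xs ! i = n ! i'" using n i by (simp add: xs_def nth_append)
    then have "f (i, i', xs) = n"
      using n i id_take_nth_drop[of i' n] by (simp add: f_def xs_def)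
    ultimately show "n \<in> f ` ({..<J} \<times> {..<J} \<times> vecs (J - 1) K)"
      using i by (intro image_eqI[of _ _ "(i, i', xs)"]) auto
  qed
  then have "card {n \<in> vecs J K. \<not> distinct n} \<le> card ({..<J} \<times> {..<J} \<times> vecs (J - 1) K)"
    by (intro surj_card_le finite_cartesian_product finite_vecs) auto
  also have "\<dots> = J * J * card (vecs (J - 1) K)" by (simp add: card_cartesian_product)
  finally show ?thesis using card_vecs[of "J - 1" K] by (meson mult_le_mono2 order_trans)
qed

lemma card_prod_list_eq_le:
  fixes R :: int
  assumes "R \<noteq> 0"
  shows "finite {n. length n = J \<and> prod_list n = R}"
    and "card {n. length n = J \<and> prod_list n = R} \<le> card {d. d dvd R} ^ J"
proof -
  have fin: "finite {d. d dvd R}" using assms by simp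
  have "{n. length n = J \<and> prod_list n = R} \<subseteq> {n. set n \<subseteq> {d. d dvd R} \<and> length n = J}"
    by (auto intro: prod_list_dvd)
  moreover have "finite {n. set n \<subseteq> {d. d dvd R} \<and> length n = J}"
    by (rule finite_lists_length_eq[OF fin])
  ultimately show "finite {n. length n = J \<and> prod_list n = R}"
    and "card {n. length n = J \<and> prod_list n = R} \<le> card {d. d dvd R} ^ J"
    unfolding card_lists_length_eq[OF fin, symmetric] by (blast intro: finite_subset card_mono)+
qed

text \<open>The entries of \<open>n\<close> need no box: they divide \<open>prod_list m\<close>,
  which is nonzero and at most \<open>K ^ J\<close> in modulus, so there are at most
  \<open>D\<close> choices for each.\<close>

lemma card_equal_products_le:
  fixes D :: real
  assumes A: "A \<subseteq> vecs J K"
    and D: "\<And>R. R \<noteq> 0 \<Longrightarrow> \<bar>R\<bar> \<le> int K ^ J \<Longrightarrow> real (card {d. d dvd R}) \<le> D"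
  shows "finite {(m, n). m \<in> A \<and> length n = J \<and> prod_list n = prod_list m}"
    and "real (card {(m, n). m \<in> A \<and> length n = J \<and> prod_list n = prod_list m}) \<le> real (card A) * D ^ J"
proof -
  have fA: "finite A" using A finite_vecs finite_subset by blast
  have eq: "{(m, n). m \<in> A \<and> length n = J \<and> prod_list n = prod_list m} =
      (SIGMA m:A. {n. length n = J \<and> prod_list n = prod_list m})" by auto
  have fin: "finite {n. length n = J \<and> prod_list n = prod_list m}" if "m \<in> A" for m
    using that A vecs_nonzero by (intro card_prod_list_eq_le) auto
  have le: "real (card {n. length n = J \<and> prod_list n = prod_list m}) \<le> D ^ J" if "m \<in> A" for m
  proof -
    have m: "m \<in> vecs J K" using that A by auto
    have "card {n. length n = J \<and> prod_list n = prod_list m} \<le> card {d. d dvd prod_list m} ^ J"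
      using vecs_nonzero[OF m] by (rule card_prod_list_eq_le)
    then have "real (card {n. length n = J \<and> prod_list n = prod_list m}) \<le> real (card {d. d dvd prod_list m}) ^ J"
      by (metis of_nat_le_iff of_nat_power)
    also have "\<dots> \<le> D ^ J"
      using vecs_nonzero[OF m] abs_prod_list_le[of m K] m by (intro power_mono D) (auto simp: vecs_def)
    finally show ?thesis .
  qed
  show "finite {(m, n). m \<in> A \<and> length n = J \<and> prod_list n = prod_list m}"
    unfolding eq using fA fin by (rule finite_SigmaI)
  show "real (card {(m, n). m \<in> A \<and> length n = J \<and> prod_list n = prod_list m}) \<le> real (card A) * D ^ J"
    unfolding eq using fA fin le by (simp add: card_SigmaI sum_bounded_above)
qed

section \<open>Large common factors and their cancellation\<close>

lemma gcd_prod_list_dvd: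
  fixes x :: int
  shows "gcd x (prod_list ns) dvd prod_list (map (gcd x) ns)"
proof (induction ns)
  case (Cons y ns)
  have "gcd x (y * prod_list ns) dvd y * prod_list ns" by simp
  then obtain d1 d2 where d: "gcd x (y * prod_list ns) = d1 * d2" "d1 dvd y" "d2 dvd prod_list ns"
    by (rule dvd_productE)
  have "d1 * d2 dvd x" using d(1) by (metis gcd_dvd1)
  then have "d1 dvd gcd x y" "d2 dvd gcd x (prod_list ns)"
    using d by (auto intro: dvd_mult_left dvd_mult_right)
  then have "d1 * d2 dvd gcd x y * prod_list (map (gcd x) ns)"
    using Cons.IH by (meson dvd_trans mult_dvd_mono)
  then show ?case using d(1) by simp
qed simp

text \<open>A pigeonhole for divisors: \<open>x\<close> divides the product of its gcds with the
  entries, and if all of these were below \<open>T\<close> that product would be at most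
  \<open>T ^ length ns\<close>.\<close>

lemma ex_large_gcd:
  fixes x :: int and T :: real
  assumes dvd: "x dvd prod_list ns" and ns: "0 \<notin> set ns" and T: "T \<ge> 0"
    and large: "of_int \<bar>x\<bar> > T ^ length ns"
  shows "\<exists>i<length ns. of_int (gcd x (ns ! i)) \<ge> T"
proof (rule ccontr)
  assume "\<not> ?thesis"
  then have lt: "of_int (gcd x y) < T" if "y \<in> set ns" for y
    using that by (auto simp: in_set_conv_nth not_le)
  have le: "of_int (prod_list (map (gcd x) ns)) \<le> T ^ length ns"
    using lt
  proof (induction ns)
    case (Cons y ns)
    have "0 \<le> prod_list (map (gcd x) ns)" by (induction ns) auto
    then show ?case using Cons T by (auto intro!: mult_mono simp: less_imp_le)
  qed simp
  have "x dvd prod_list (map (gcd x) ns)"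
    using gcd_prod_list_dvd[of x ns] gcd_proj1_if_dvd[OF dvd] by auto
  moreover have "prod_list (map (gcd x) ns) > 0"
    using ns by (induction ns) auto
  ultimately have "\<bar>x\<bar> \<le> prod_list (map (gcd x) ns)"
    by (simp add: zdvd_imp_le)
  then show False using le large by linarith
qed

lemma prod_list_update_mult:
  fixes n :: "int list"
  assumes "i < length n" "n ! i = g * t"
  shows "prod_list n = g * prod_list (n[i := t])"
proof -
  have "prod_list n = prod_list (take i n) * (n ! i * prod_list (drop (Suc i) n))"
    using id_take_nth_drop[OF assms(1)] by (metis prod_list.append prod_list.Cons)
  then show ?thesis using assms by (simp add: upd_conv_take_nth_drop)
qed

lemma sum_list_take_update:
  fixes n :: "int list"
  assumes "i < length n"
  shows "sum_list (take a (n[i := y])) = sum_list (take a n) + (if i < a then y - n ! i else 0)"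
proof (cases "i < a")
  case True
  define l where "l = take a n"
  have l: "i < length l" "l ! i = n ! i" using True assms by (auto simp: l_def)
  have "sum_list l = sum_list (take i l) + (l ! i + sum_list (drop (Suc i) l))"
    using id_take_nth_drop[OF l(1)] by (metis sum_list.append sum_list.Cons)
  then have "sum_list (l[i := y]) = sum_list l + (y - n ! i)"
    using l by (simp add: upd_conv_take_nth_drop)
  then show ?thesis using True by (simp add: take_update_swap l_def)
qed simp

text \<open>If a large \<open>g\<close> divides both \<open>hd m\<close> and \<open>n ! i\<close>, cancelling it from the multiplicative relation
  leaves few possibilities, and the additive relation, being linear in \<open>g\<close> with nonzero
  coefficient, recovers \<open>g\<close>.\<close>

lemma card_large_gcd_le:
  fixes T Y D :: real
  assumes b: "b > 0" and i: "i < J" and TY: "real K \<le> T * Y" and T: "T > 0" and Y: "Y \<ge> 0" and D0: "D \<ge> 0"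
    and D: "\<And>R. R \<noteq> 0 \<Longrightarrow> \<bar>R\<bar> \<le> int K ^ J \<Longrightarrow> real (card {d. d dvd R}) \<le> D"
  shows "real (card {(m, n) \<in> vecs J K \<times> vecs J K. prod_list m = prod_list n \<and>
      sum_list (take b m) = sum_list (take a n) \<and> count_list (take a n) (hd m) = 0 \<and>
      of_int (gcd (hd m) (n ! i)) \<ge> T}) \<le> 2 * Y * (2 * real K) ^ (J - 1) * D ^ J"
    (is "real (card ?P) \<le> _")
proof -
  define A where "A = {m \<in> vecs J K. of_int \<bar>hd m\<bar> \<le> Y}"
  define E where "E = {(m, n). m \<in> A \<and> length n = J \<and> prod_list n = prod_list m}"
  \<comment> \<open>Cancelling the gcd keeps the products equal and shrinks the head of
    \<open>m\<close> to at most \<open>K / T\<close>, hence at most \<open>Y\<close>.\<close>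
  define \<phi> :: "int list \<times> int list \<Rightarrow> int list \<times> int list"
    where "\<phi> = (\<lambda>(m, n). let g = gcd (hd m) (n ! i) in ((hd m div g) # tl m, n[i := n ! i div g]))"
  have nz: "x \<noteq> 0" "\<bar>x\<bar> \<le> int K" if "x \<in> set m" "m \<in> vecs J K" for x m
    using that by (auto simp: vecs_def nzbox_def)
  have key: "\<exists>g x t m0. g > 0 \<and> x \<noteq> 0 \<and> t \<noteq> 0 \<and> m = (g * x) # m0 \<and> n ! i = g * t \<and> real_of_int g \<ge> T \<and>
      \<phi> (m, n) = (x # m0, n[i := t])" if mn: "(m, n) \<in> ?P" for m n
  proof -
    obtain h m0 where m: "m = h # m0" using mn i by (cases m) (auto simp: vecs_def)
    have h: "h \<noteq> 0" using nz(1)[of h m] mn m by auto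
    have ni: "n ! i \<noteq> 0" using nz(1)[of "n ! i" n] mn i by (auto simp: vecs_def)
    define g where "g = gcd h (n ! i)"
    have "g > 0" using h by (simp add: g_def)
    moreover have "h = g * (h div g)" "n ! i = g * (n ! i div g)" by (simp_all add: g_def)
    moreover have "\<phi> (m, n) = ((h div g) # m0, n[i := n ! i div g])" by (simp add: \<phi>_def m g_def Let_def)
    moreover have "real_of_int g \<ge> T" using mn by (simp add: g_def m)
    ultimately show ?thesis using m h ni by (metis mult_zero_right)
  qed
  have "\<phi> p \<in> E" if p: "p \<in> ?P" for p
  proof -
    obtain m n where mn: "p = (m, n)" "(m, n) \<in> ?P" using p by (cases p) auto
    obtain g x t m0 where g: "g > 0" "x \<noteq> 0" "t \<noteq> 0" "m = (g * x) # m0" "n ! i = g * t" "real_of_int g \<ge> T"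
        "\<phi> (m, n) = (x # m0, n[i := t])" using key[OF mn(2)] by blast
    have m: "m \<in> vecs J K" "n \<in> vecs J K" "prod_list m = prod_list n" using mn(2) by auto
    have "\<bar>g * x\<bar> \<le> int K" using nz(2)[of "g * x" m] m g(4) by auto
    then have gx: "g * \<bar>x\<bar> \<le> int K" using g(1) by (simp add: abs_mult)
    have "1 * \<bar>x\<bar> \<le> g * \<bar>x\<bar>" using g(1) by (intro mult_right_mono) auto
    then have xK: "\<bar>x\<bar> \<le> int K" using gx by simp
    have "T * real_of_int \<bar>x\<bar> \<le> real_of_int (g * \<bar>x\<bar>)" using g(6) by (simp add: mult_right_mono)
    also have "\<dots> \<le> real K" using gx by (metis of_int_le_iff of_int_of_nat_eq)
    finally have "T * real_of_int \<bar>x\<bar> \<le> T * Y" using TY by linarith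
    then have "real_of_int \<bar>x\<bar> \<le> Y" using T by simp
    then have "x # m0 \<in> A" using m g xK by (auto simp: A_def vecs_def nzbox_def)
    moreover have "g * (x * prod_list m0) = g * prod_list (n[i := t])"
      using prod_list_update_mult[of i n g t] m g i by (simp add: vecs_def mult.assoc)
    then have "x * prod_list m0 = prod_list (n[i := t])" using g(1) by simp
    ultimately show ?thesis using m by (simp add: mn(1) g(7) E_def vecs_def)
  qed
  then have sub: "\<phi> ` ?P \<subseteq> E" by blast
  have inj: "inj_on \<phi> ?P"
  proof (rule inj_onI)
    fix p p' assume p: "p \<in> ?P" "p' \<in> ?P" "\<phi> p = \<phi> p'"
    obtain m n where mn: "p = (m, n)" "(m, n) \<in> ?P" using p(1) by (cases p) auto
    obtain m' n' where mn': "p' = (m', n')" "(m', n') \<in> ?P" using p(2) by (cases p') auto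
    obtain g x t m0 where g: "g > 0" "x \<noteq> 0" "t \<noteq> 0" "m = (g * x) # m0" "n ! i = g * t" "real_of_int g \<ge> T"
        "\<phi> (m, n) = (x # m0, n[i := t])" using key[OF mn(2)] by blast
    obtain g' x' t' m0' where g': "g' > 0" "x' \<noteq> 0" "t' \<noteq> 0" "m' = (g' * x') # m0'" "n' ! i = g' * t'" "real_of_int g' \<ge> T"
        "\<phi> (m', n') = (x' # m0', n'[i := t'])" using key[OF mn'(2)] by blast
    have eq: "x' = x" "m0' = m0" "n'[i := t'] = n[i := t]"
      using p(3) g(7) g'(7) mn(1) mn'(1) by auto
    have len: "length n = J" "length n' = J" "length m0 = J - 1" using mn(2) mn'(2) g(4) by (auto simp: vecs_def)
    have t: "t' = t" using arg_cong[OF eq(3), of "\<lambda>l. l ! i"] len i by simp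
    define s where "s = sum_list (take a (n[i := t]))"
    have sum: "sum_list (take a n) = s + (if i < a then g * t - t else 0)"
        "sum_list (take a n') = s + (if i < a then g' * t - t else 0)"
      using sum_list_take_update[of i n a t] sum_list_take_update[of i n' a t] len i g(5) g'(5) eq(3) t
      by (auto simp: s_def)
    obtain b' where b': "b = Suc b'" using b by (cases b) auto
    have "g * x + sum_list (take b' m0) = s + (if i < a then g * t - t else 0)"
         "g' * x + sum_list (take b' m0) = s + (if i < a then g' * t - t else 0)"
      using mn(2) mn'(2) sum g(4) g'(4) eq b' by auto
    \<comment> \<open>The two preimages share \<open>x\<close>, \<open>t\<close>, \<open>m0\<close>
      and all other entries of \<open>n\<close>. Subtracting their additive equations leaves only
      the difference of the gcds.\<close>
    then have lin: "(g - g') * (x - (if i < a then t else 0)) = 0" by (auto simp: algebra_simps)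
    \<comment> \<open>For \<open>i < a\<close>, equality \<open>x = t\<close> would make
      \<open>hd m = g * x\<close> the entry of \<open>take a n\<close> at position \<open>i\<close>,
      against the zero count.\<close>
    have "x \<noteq> (if i < a then t else 0)"
    proof (cases "i < a")
      case True
      have "count_list (take a n) (g * x) = 0" using mn(2) g(4) by simp
      then have "g * x \<notin> set (take a n)" by (simp add: count_list_0_iff)
      moreover have "take a n ! i \<in> set (take a n)" using True i len by (intro nth_mem) auto
      ultimately show ?thesis using True i len g(5) by auto
    qed (use g(2) in auto)
    then have gg: "g = g'" using lin by simp
    then have "n ! i = n' ! i" using g(5) g'(5) t by simp
    then have "n = n'" using eq(3) t
      by (metis list_update_id list_update_overwrite)
    then show "p = p'" using mn(1) mn'(1) g(4) g'(4) gg eq by simp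
  qed
  have AJ: "A \<subseteq> vecs J K" by (auto simp: A_def)
  have "card ?P \<le> card E"
    using card_inj_on_le[OF inj sub] card_equal_products_le(1)[OF AJ D] by (simp add: E_def)
  also have "real (card E) \<le> real (card A) * D ^ J"
    using card_equal_products_le(2)[OF AJ D] by (simp add: E_def)
  also have "\<dots> \<le> (2 * Y * (2 * real K) ^ (J - 1)) * D ^ J"
  proof (rule mult_right_mono)
    show "real (card A) \<le> 2 * Y * (2 * real K) ^ (J - 1)"
      unfolding A_def using i by (intro card_vecs_hd_le Y) auto
    show "D ^ J \<ge> 0" using D0 by simp
  qed
  finally show ?thesis by simp
qed

text \<open>Here \<open>m\<close> stands for \<open>ls @ ks'\<close> and \<open>n\<close> for
  \<open>ks @ ls'\<close>, where \<open>(ks, ls)\<close> and \<open>(ks', ls')\<close> index the two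
  factors in a squared modulus. Averaging over the characters equates the products. Only the
  additive equation of the first pair is retained, and \<open>hd m\<close> is its
  \<open>l_1\<close>.\<close>

definition unmatched :: "nat \<Rightarrow> nat \<Rightarrow> nat \<Rightarrow> (int list \<times> int list) set" where
  "unmatched a b K = {(m, n) \<in> vecs (a + b) K \<times> vecs (a + b) K. prod_list m = prod_list n \<and>
      sum_list (take b m) = sum_list (take a n) \<and> count_list (take a n) (hd m) \<noteq> 1}"

lemma count_list_le_1: "distinct xs \<Longrightarrow> count_list xs x \<le> 1"
  by (induction xs) (auto simp: count_list_0_iff)

text \<open>In each of three classes one variable loses a factor: \<open>hd m\<close> is at most
  \<open>Y\<close>, or \<open>n\<close> repeats an entry and so has one free coordinate fewer, or
  \<open>hd m\<close> exceeds \<open>T ^ J\<close> and shares a factor at least \<open>T\<close>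
  with some entry of \<open>n\<close>, whose cancellation brings the head down to
  \<open>Y = K / T\<close>. The other side is then found from the product at a cost of
  \<open>D ^ J\<close>.\<close>

lemma card_unmatched_le_divisors:
  fixes Y T D :: real
  assumes b: "b > 0" and K: "K \<ge> 1" and J: "J = a + b"
    and TY: "real K = T * Y" and T: "T > 0" and Y: "Y \<ge> 1" and TJ: "T ^ J \<le> Y"
    and D: "\<And>R. R \<noteq> 0 \<Longrightarrow> \<bar>R\<bar> \<le> int K ^ J \<Longrightarrow> real (card {d. d dvd R}) \<le> D"
  shows "real (card (unmatched a b K)) \<le> (2 + 2 * real J + real J * real J) * 2 ^ (J - 1) * (Y * real K ^ (J - 1)) * D ^ J"
proof -
  define P1 where "P1 = {(m, n). m \<in> {m \<in> vecs J K. of_int \<bar>hd m\<bar> \<le> Y} \<and> length n = J \<and> prod_list n = prod_list m}"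
  \<comment> \<open>The pairs are swapped: the repetition sits in \<open>n\<close>, so here
    \<open>n\<close> is enumerated and \<open>m\<close> is found from its product.\<close>
  define P2 where "P2 = {(n, m). n \<in> {n \<in> vecs J K. \<not> distinct n} \<and> length m = J \<and> prod_list m = prod_list n}"
  define P3 where "P3 i = {(m, n) \<in> vecs J K \<times> vecs J K. prod_list m = prod_list n \<and>
      sum_list (take b m) = sum_list (take a n) \<and> count_list (take a n) (hd m) = 0 \<and>
      of_int (gcd (hd m) (n ! i)) \<ge> T}" for i
  define W where "W = (2 * real K) ^ (J - 1) * D ^ J"
  have J0: "J > 0" using b J by simp
  have "int K ^ J \<ge> 1" using K by (intro one_le_power) auto
  then have "real (card {d. d dvd (1::int)}) \<le> D" by (intro D) auto
  then have D0: "D \<ge> 0" by (rule order_trans[OF of_nat_0_le_iff])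
  have f1: "finite P1" and c1: "real (card P1) \<le> 2 * (Y * W)"
  proof -
    have sub: "{m \<in> vecs J K. of_int \<bar>hd m\<bar> \<le> Y} \<subseteq> vecs J K" by auto
    show "finite P1" unfolding P1_def by (rule card_equal_products_le(1)[OF sub D])
    have "real (card P1) \<le> real (card {m \<in> vecs J K. of_int \<bar>hd m\<bar> \<le> Y}) * D ^ J"
      unfolding P1_def by (rule card_equal_products_le(2)[OF sub D])
    also have "\<dots> \<le> (2 * Y * (2 * real K) ^ (J - 1)) * D ^ J"
      using Y J0 D0 by (intro mult_right_mono card_vecs_hd_le) auto
    finally show "real (card P1) \<le> 2 * (Y * W)" by (simp add: W_def mult_ac)
  qed
  have W0: "W \<ge> 0" using D0 by (simp add: W_def)
  have f2: "finite P2" and c2: "real (card P2) \<le> real J * real J * (Y * W)"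
  proof -
    have sub: "{n \<in> vecs J K. \<not> distinct n} \<subseteq> vecs J K" by auto
    show "finite P2" unfolding P2_def by (rule card_equal_products_le(1)[OF sub D])
    have "real (card P2) \<le> real (card {n \<in> vecs J K. \<not> distinct n}) * D ^ J"
      unfolding P2_def by (rule card_equal_products_le(2)[OF sub D])
    also have "\<dots> \<le> (real J * real J * (2 * real K) ^ (J - 1)) * D ^ J"
      using of_nat_mono[OF card_vecs_not_distinct[of J K], where 'a = real] D0
      by (intro mult_right_mono) auto
    also have "\<dots> = (real J * real J) * (1 * W)" by (simp add: W_def)
    also have "\<dots> \<le> (real J * real J) * (Y * W)" using Y W0 by (intro mult_left_mono mult_right_mono) auto
    finally show "real (card P2) \<le> real J * real J * (Y * W)" .
  qed
  have c3: "real (card (P3 i)) \<le> 2 * (Y * W)" if "i < J" for i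
    using card_large_gcd_le[where K = K and Y = Y and a = a, OF b that eq_refl[OF TY] T _ D0 D] Y
    by (simp only: P3_def W_def mult_ac) simp
  have f3: "finite (P3 i)" for i
    unfolding P3_def by (rule finite_subset[of _ "vecs J K \<times> vecs J K"]) (auto intro: finite_vecs)
  have "unmatched a b K \<subseteq> P1 \<union> (\<lambda>(n, m). (m, n)) ` P2 \<union> (\<Union>i<J. P3 i)"
  proof
    fix p assume "p \<in> unmatched a b K"
    then obtain m n where p: "p = (m, n)" and mn: "m \<in> vecs J K" "n \<in> vecs J K" "prod_list m = prod_list n"
      "sum_list (take b m) = sum_list (take a n)" "count_list (take a n) (hd m) \<noteq> 1"
      by (auto simp: unmatched_def J)
    show "p \<in> P1 \<union> (\<lambda>(n, m). (m, n)) ` P2 \<union> (\<Union>i<J. P3 i)"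
    proof (cases "distinct n \<and> of_int \<bar>hd m\<bar> > Y")
      case True
      \<comment> \<open>In a distinct list the count is 0 or 1, and 1 is excluded.\<close>
      then have "count_list (take a n) (hd m) \<le> 1" by (intro count_list_le_1) auto
      then have c0: "count_list (take a n) (hd m) = 0" using mn(5) by linarith
      have "m \<noteq> []" using mn(1) J0 by (auto simp: vecs_def)
      then have "hd m dvd prod_list n" using mn(3) by (metis hd_in_set prod_list_dvd)
      moreover have "0 \<notin> set n" "length n = J" using mn(2) by (auto simp: vecs_def nzbox_def)
      moreover have "of_int \<bar>hd m\<bar> > T ^ J" using True TJ by linarith
      ultimately obtain i where "i < J" "of_int (gcd (hd m) (n ! i)) \<ge> T"
        using ex_large_gcd[of "hd m" n T] T by auto
      then have "p \<in> P3 i" using mn c0 by (simp add: P3_def p)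
      then show ?thesis using \<open>i < J\<close> by blast
    next
      case False
      then show ?thesis using mn by (force simp: P1_def P2_def p vecs_def)
    qed
  qed
  then have "card (unmatched a b K) \<le> card (P1 \<union> (\<lambda>(n, m). (m, n)) ` P2 \<union> (\<Union>i<J. P3 i))"
    using f1 f2 f3 by (intro card_mono) auto
  also have "\<dots> \<le> card P1 + card P2 + (\<Sum>i<J. card (P3 i))"
    by (intro order_trans[OF card_Un_le] add_mono card_UN_le card_image_le f2) auto
  finally have "real (card (unmatched a b K)) \<le> real (card P1) + real (card P2) + (\<Sum>i<J. real (card (P3 i)))"
    by (metis of_nat_le_iff of_nat_add of_nat_sum)
  also have "\<dots> \<le> 2 * (Y * W) + real J * real J * (Y * W) + (\<Sum>i<J. 2 * (Y * W))"
    by (intro add_mono sum_mono c1 c2 c3) auto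
  also have "\<dots> = (2 + 2 * real J + real J * real J) * (Y * W)" by (simp add: algebra_simps)
  also have "Y * W = 2 ^ (J - 1) * (Y * real K ^ (J - 1)) * D ^ J"
    by (simp add: W_def power_mult_distrib)
  finally show ?thesis by (simp only: mult.assoc)
qed

text \<open>With \<open>J = a + b\<close>, the choice \<open>T = K powr (1 / (2 * J))\<close>,
  \<open>Y = K / T\<close> satisfies \<open>T ^ J = K powr (1 / 2) \<le> Y\<close> and saves
  \<open>K powr (1 / (2 * J))\<close>. The exponent \<open>\<epsilon> = 1 / (4 * J ^ 3)\<close> is
  such that the divisor factor \<open>D ^ J\<close> gives back only half of this saving, up to a
  constant.\<close>

lemma card_unmatched_le:
  assumes b: "b > 0"
  shows "\<exists>C>0. \<forall>K\<ge>1. real (card (unmatched a b K)) \<le>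
    C * real K powr (real (a + b) - 1 / (4 * real (a + b)))"
proof -
  define J where "J = a + b"
  have J: "J > 0" using b by (simp add: J_def)
  define \<epsilon> where "\<epsilon> = 1 / (4 * real J ^ 3)"
  have "\<epsilon> > 0" using J by (simp add: \<epsilon>_def)
  then obtain C where C: "C > 0" "\<And>n::int. n \<noteq> 0 \<Longrightarrow> real (card {d. d dvd n}) \<le> C * of_int \<bar>n\<bar> powr \<epsilon>"
    using card_divisors_int_le by blast
  define C' where "C' = (2 + 2 * real J + real J * real J) * 2 ^ (J - 1) * C ^ J"
  have "real (card (unmatched a b K)) \<le> C' * real K powr (real J - 1 / (4 * real J))" if K: "K \<ge> 1" for K
  proof -
    define T where "T = real K powr (1 / (2 * real J))"
    define Y where "Y = real K powr (1 - 1 / (2 * real J))"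
    define D where "D = C * real K powr (real J * \<epsilon>)"
    have K0: "real K > 0" "real K \<ge> 1" using K by auto
    have TY: "real K = T * Y" using K0 by (simp add: T_def Y_def flip: powr_add)
    have Y1: "Y \<ge> 1" using K0 J by (auto simp: Y_def intro!: ge_one_powr_ge_zero)
    have "T ^ J = real K powr (1 / 2)" using K0 J by (simp add: T_def powr_power)
    also have "\<dots> \<le> Y" unfolding Y_def using K0 J by (intro powr_mono) (auto simp: field_simps)
    finally have TJ: "T ^ J \<le> Y" .
    have D: "real (card {d. d dvd R}) \<le> D" if R: "R \<noteq> 0" "\<bar>R\<bar> \<le> int K ^ J" for R
    proof -
      have "of_int \<bar>R\<bar> \<le> real K ^ J"
        using R(2) by (metis of_int_le_iff of_int_of_nat_eq of_int_power)
      then have "of_int \<bar>R\<bar> powr \<epsilon> \<le> (real K ^ J) powr \<epsilon>"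
        using \<open>\<epsilon> > 0\<close> by (intro powr_mono2) auto
      also have "(real K ^ J) powr \<epsilon> = real K powr (real J * \<epsilon>)"
        using K0 by (simp add: powr_powr flip: powr_realpow)
      finally show ?thesis using C(2)[OF R(1)] C(1) unfolding D_def
        by (meson mult_left_mono less_imp_le order_trans)
    qed
    have DJ: "D ^ J = C ^ J * real K powr (1 / (4 * real J))"
    proof -
      have "real J * \<epsilon> * real J = 1 / (4 * real J)" using J by (simp add: \<epsilon>_def power3_eq_cube)
      then show ?thesis using K0 by (simp add: D_def power_mult_distrib powr_power mult.commute mult.left_commute)
    qed
    have KJ: "real K ^ (J - 1) = real K powr (real J - 1)"
      using K0 J by (simp add: of_nat_diff flip: powr_realpow)
    have T0: "T > 0" using K0 by (simp add: T_def)
    have "real (card (unmatched a b K)) \<le> (2 + 2 * real J + real J * real J) * 2 ^ (J - 1) * (Y * real K ^ (J - 1)) * D ^ J"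
      by (rule card_unmatched_le_divisors[OF b K J_def TY T0 Y1 TJ D])
    also have "\<dots> = C' * (Y * real K powr (real J - 1) * real K powr (1 / (4 * real J)))"
      by (simp only: C'_def DJ KJ mult_ac)
    also have "Y * real K powr (real J - 1) * real K powr (1 / (4 * real J)) = real K powr (real J - 1 / (4 * real J))"
      using J by (simp add: Y_def field_simps flip: powr_add)
    finally show ?thesis .
  qed
  moreover have "C' > 0" using C(1) J by (simp add: C'_def add_pos_nonneg)
  ultimately show ?thesis by (auto simp: J_def)
qed

section \<open>Fourier analysis on residues\<close>

text \<open>Complete residue systems: the variable \<open>x\<close> runs over
  \<open>{0..<q}\<close>, the frequencies over a system symmetric about 0, and sums of periodic
  functions may be moved between them.\<close>

definition residues_system :: "nat \<Rightarrow> int set \<Rightarrow> bool" where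
  "residues_system q A \<longleftrightarrow> finite A \<and> card A = q \<and>
     (\<forall>x\<in>A. \<forall>y\<in>A. [x = y] (mod int q) \<longrightarrow> x = y)"

lemma residues_system_interval:
  assumes "q > 0"
  shows "residues_system q {a..<a + int q}"
  unfolding residues_system_def
proof (intro conjI ballI impI)
  fix x y assume xy: "x \<in> {a..<a + int q}" "y \<in> {a..<a + int q}" "[x = y] (mod int q)"
  then have "int q dvd x - y" "\<bar>x - y\<bar> < int q" by (auto simp: cong_iff_dvd_diff)
  then show "x = y" using dvd_imp_le_int[of "x - y" "int q"] by fastforce
qed simp_all

lemma residues_system_mod_bij:
  assumes A: "residues_system q A" and q: "q > 0"
  shows "bij_betw (\<lambda>x. x mod int q) A {0..<int q}"
proof -
  have inj: "inj_on (\<lambda>x. x mod int q) A"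
    using A by (auto simp: residues_system_def inj_on_def cong_def)
  moreover have "(\<lambda>x. x mod int q) ` A = {0..<int q}"
  proof (rule card_subset_eq)
    show "(\<lambda>x. x mod int q) ` A \<subseteq> {0..<int q}" using q by auto
    show "card ((\<lambda>x. x mod int q) ` A) = card {0..<int q}"
      using inj A by (simp add: card_image residues_system_def)
  qed simp
  ultimately show ?thesis by (simp add: bij_betw_def)
qed

lemma sum_residues_system:
  assumes A: "residues_system q A" and B: "residues_system q B" and q: "q > 0"
    and f: "\<And>x. f (x mod int q) = f x"
  shows "sum f A = sum f B"
proof -
  have "sum f C = sum f {0..<int q}" if "residues_system q C" for C
    using sum.reindex_bij_betw[OF residues_system_mod_bij[OF that q], of f] by (simp add: f)
  then show ?thesis using A B by metis
qed

lemma sum_residues_mult: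
  assumes q: "q > 0" and k: "coprime k (int q)" and f: "\<And>x. f (x mod int q) = f x"
  shows "(\<Sum>x\<in>{0..<int q}. f (k * x)) = sum f {0..<int q}"
proof -
  have cong: "x = y" if "x \<in> {0..<int q}" "y \<in> {0..<int q}" "[k * x = k * y] (mod int q)" for x y
  proof -
    have "[x = y] (mod int q)" using that(3) k by (simp add: cong_mult_lcancel)
    then show ?thesis using that by (auto simp: cong_def)
  qed
  have inj: "inj_on ((*) k) {0..<int q}" using cong by (auto intro!: inj_onI)
  then have "(\<Sum>x\<in>{0..<int q}. f (k * x)) = sum f ((*) k ` {0..<int q})"
    by (simp add: sum.reindex)
  also have "\<dots> = sum f {0..<int q}"
  proof (rule sum_residues_system[where f = f, OF _ _ q])
    show "f (x mod int q) = f x" for x by (rule f)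
    show "residues_system q ((*) k ` {0..<int q})"
      using cong inj by (auto simp: residues_system_def card_image)
    show "residues_system q {0..<int q}" using residues_system_interval[OF q, of 0] by simp
  qed
  finally show ?thesis .
qed

lemma ee_mod: "q > 0 \<Longrightarrow> ee q (x mod int q) = ee q x"
  by (rule ee_cong) (auto simp: cong_def)

lemma sum_ee_residues:
  assumes A: "residues_system q A" and q: "q > 0"
  shows "(\<Sum>x\<in>A. ee q (k * x)) = (if int q dvd k then of_nat q else 0)"
proof -
  have "(\<Sum>x\<in>A. ee q (k * x)) = (\<Sum>x\<in>{0..<int q}. ee q (k * x))"
    using residues_system_interval[OF q, of 0]
    by (intro sum_residues_system[OF A _ q] ee_cong[OF q]) (auto simp: cong_def mod_mult_right_eq)
  also have "\<dots> = (\<Sum>j<q. ee q (k * int j))"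
    by (rule sum.reindex_bij_witness[of _ int nat]) auto
  finally show ?thesis using sum_ee[OF q] by simp
qed

text \<open>Any pairwise incongruent set of frequencies is allowed, so that the same identity serves
  the kernel, the Gauss sum and every partial sum of the expansion.\<close>

lemma parseval:
  assumes A: "residues_system q A" and q: "q > 0" and B: "finite B"
    and cong: "\<And>k l. k \<in> B \<Longrightarrow> l \<in> B \<Longrightarrow> [k = l] (mod int q) \<Longrightarrow> k = l"
  shows "(\<Sum>x\<in>A. (cmod (\<Sum>k\<in>B. c k * ee q (- (k * x))))\<^sup>2) = real q * (\<Sum>k\<in>B. (cmod (c k))\<^sup>2)"
proof -
  have "complex_of_real (\<Sum>x\<in>A. (cmod (\<Sum>k\<in>B. c k * ee q (- (k * x))))\<^sup>2) =
      (\<Sum>x\<in>A. \<Sum>k\<in>B. \<Sum>l\<in>B. c k * cnj (c l) * ee q ((l - k) * x))"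
  proof -
    have "complex_of_real ((cmod (\<Sum>k\<in>B. c k * ee q (- (k * x))))\<^sup>2) =
       (\<Sum>k\<in>B. \<Sum>l\<in>B. c k * cnj (c l) * ee q ((l - k) * x))" for x
    proof -
      have "ee q ((l - k) * x) = ee q (l * x) * cnj (ee q (k * x))" for k l
        by (simp only: left_diff_distrib ee_diff)
      then show ?thesis
        unfolding complex_norm_square cnj_sum sum_product
        by (simp add: ee_minus mult_ac)
    qed
    then show ?thesis by simp
  qed
  also have "\<dots> = (\<Sum>k\<in>B. \<Sum>l\<in>B. c k * cnj (c l) * (\<Sum>x\<in>A. ee q ((l - k) * x)))"
    unfolding sum_distrib_left by (subst sum.swap, rule sum.cong[OF refl], rule sum.swap)
  also have "\<dots> = (\<Sum>k\<in>B. \<Sum>l\<in>B. if l = k then c k * cnj (c k) * of_nat q else 0)"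
    using cong by (intro sum.cong refl)
      (auto simp: sum_ee_residues[OF A q] cong_iff_dvd_diff[symmetric])
  also have "\<dots> = (\<Sum>k\<in>B. c k * cnj (c k) * of_nat q)"
    using B by simp
  also have "\<dots> = complex_of_real (real q * (\<Sum>k\<in>B. (cmod (c k))\<^sup>2))"
    by (simp add: complex_norm_square[symmetric] sum_distrib_left mult.commute)
  finally show ?thesis by (simp only: of_real_eq_iff)
qed

section \<open>Symmetric residues and the Dirichlet kernel\<close>

definition symres :: "nat \<Rightarrow> int set" where
  "symres q = {- int ((q - 1) div 2)..int ((q - 1) div 2)}"

lemma symres_system:
  assumes "odd q"
  shows "residues_system q (symres q)"
proof -
  have "symres q = {- int ((q - 1) div 2)..<- int ((q - 1) div 2) + int q}"
    using assms by (auto simp: symres_def elim!: oddE)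
  then show ?thesis using residues_system_interval[OF odd_pos[OF assms]] by (simp only:)
qed

text \<open>Sine is concave on this interval, so its graph lies above the chord joining the
  endpoints.\<close>

lemma sin_ge_jordan:
  fixes t :: real
  assumes "0 \<le> t" "t \<le> pi / 2"
  shows "2 * t / pi \<le> sin t"
proof -
  have "convex_on {0..pi/2} (\<lambda>x. - sin x)"
  proof (rule f''_ge0_imp_convex[where f' = "\<lambda>x. - cos x" and f'' = sin])
    show "((\<lambda>x. - sin x) has_real_derivative - cos x) (at x)" for x
      by (auto intro!: derivative_eq_intros)
    show "((\<lambda>x. - cos x) has_real_derivative sin x) (at x)" for x
      by (auto intro!: derivative_eq_intros)
    show "x \<in> {0..pi/2} \<Longrightarrow> sin x \<ge> 0" for x by (intro sin_ge_zero) auto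
  qed simp
  then have "- sin ((1 - 2 * t / pi) *\<^sub>R 0 + (2 * t / pi) *\<^sub>R (pi / 2)) \<le>
      (1 - 2 * t / pi) * (- sin 0) + (2 * t / pi) * (- sin (pi / 2))"
    using assms by (intro convex_onD) (auto simp: field_simps)
  then show ?thesis by simp
qed

text \<open>Taking out the half angle shows the modulus to be
  \<open>2 * sin (pi * \<bar>k\<bar> / q)\<close>. The condition
  \<open>2 * \<bar>k\<bar> \<le> q\<close> keeps the angle within \<open>pi / 2\<close>, where the
  chord bound applies; this is why the frequencies are taken from \<open>symres q\<close>.\<close>

lemma norm_ee_minus_1_ge:
  assumes "2 * \<bar>k\<bar> \<le> int q" "q > 0"
  shows "norm (ee q k - 1) \<ge> 4 * \<bar>real_of_int k\<bar> / real q"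
proof -
  define t where "t = pi * real_of_int k / real q"
  have abs_t: "\<bar>t\<bar> = pi * (\<bar>real_of_int k\<bar> / real q)" by (simp add: t_def abs_mult)
  have "real_of_int (2 * \<bar>k\<bar>) \<le> real_of_int (int q)" using assms(1) by (simp only: of_int_le_iff)
  then have "\<bar>real_of_int k\<bar> / real q \<le> 1 / 2" using assms(2) by (simp add: divide_le_eq)
  then have "pi * (\<bar>real_of_int k\<bar> / real q) \<le> pi * (1 / 2)" by (rule mult_left_mono) simp
  then have t: "\<bar>t\<bar> \<le> pi / 2" by (simp add: abs_t)
  have "2 * pi * real_of_int k / real q = t + t" by (simp add: t_def)
  then have "ee q k = cis t * cis t" by (simp only: ee_def cis_mult)
  moreover have "cis t * cis (- t) = 1" by (simp add: cis_mult)
  ultimately have "ee q k - 1 = cis t * (cis t - cis (- t))" by (simp only: right_diff_distrib)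
  moreover have "cis t - cis (- t) = 2 * \<i> * of_real (sin t)" by (simp add: complex_eq_iff)
  ultimately have "ee q k - 1 = cis t * (2 * \<i> * of_real (sin t))" by simp
  then have "norm (ee q k - 1) = 2 * \<bar>sin t\<bar>" by (simp add: norm_mult)
  also have "\<bar>sin t\<bar> = sin \<bar>t\<bar>"
  proof -
    have "sin \<bar>t\<bar> \<ge> 0" using t pi_ge_zero by (intro sin_ge_zero) linarith+
    then show ?thesis by (cases "t \<ge> 0") simp_all
  qed
  finally have eq: "norm (ee q k - 1) = 2 * sin \<bar>t\<bar>" .
  have "4 * \<bar>real_of_int k\<bar> / real q = 2 * (2 * \<bar>t\<bar> / pi)" by (simp add: abs_t)
  also have "\<dots> \<le> 2 * sin \<bar>t\<bar>" using sin_ge_jordan[of "\<bar>t\<bar>"] t by simp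
  finally show ?thesis by (simp only: eq)
qed

text \<open>The Fourier coefficient of the indicator function of \<open>{1..h}\<close>.\<close>

definition dkernel :: "nat \<Rightarrow> nat \<Rightarrow> int \<Rightarrow> complex" where
  "dkernel q h k = (\<Sum>j\<in>{1..int h}. ee q (- (j * k)))"

lemma norm_dkernel_le: "norm (dkernel q h k) \<le> real h"
proof -
  have "norm (dkernel q h k) \<le> (\<Sum>j\<in>{1..int h}. 1)"
    unfolding dkernel_def by (intro sum_norm_le) simp
  then show ?thesis by simp
qed

text \<open>A geometric series: its numerator has modulus at most 2, its denominator at least
  \<open>4 * \<bar>k\<bar> / q\<close>.\<close>

lemma norm_dkernel_le':
  assumes "2 * \<bar>k\<bar> \<le> int q" "k \<noteq> 0" "q > 0"
  shows "norm (dkernel q h k) \<le> real q / (2 * \<bar>real_of_int k\<bar>)"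
proof -
  define z where "z = ee q (- k)"
  have ge: "norm (z - 1) \<ge> 4 * \<bar>real_of_int k\<bar> / real q"
    using norm_ee_minus_1_ge[of "- k" q] assms by (simp add: z_def)
  have pos: "4 * \<bar>real_of_int k\<bar> / real q > 0" using assms by simp
  have "dkernel q h k = (\<Sum>j=1..h. z ^ j)"
    unfolding dkernel_def
    by (rule sum.reindex_bij_witness[of _ int nat]) (auto simp: z_def mult.commute simp flip: ee_power)
  also have "(z - 1) * \<dots> = z ^ Suc h - z"
    by (induction h) (simp_all add: algebra_simps)
  finally have "norm (z - 1) * norm (dkernel q h k) = norm (z ^ Suc h - z)"
    by (simp only: norm_mult[symmetric])
  also have "\<dots> \<le> norm (z ^ Suc h) + norm z" by (rule norm_triangle_ineq4)
  also have "\<dots> = 2" by (simp only: norm_power z_def norm_ee) simp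
  finally have "norm (z - 1) * norm (dkernel q h k) \<le> 2" .
  moreover have "4 * \<bar>real_of_int k\<bar> / real q * norm (dkernel q h k) \<le> norm (z - 1) * norm (dkernel q h k)"
    using ge by (rule mult_right_mono) simp
  ultimately have "4 * \<bar>real_of_int k\<bar> / real q * norm (dkernel q h k) \<le> 2" by linarith
  then show ?thesis using assms by (simp add: field_simps)
qed

text \<open>Parseval with \<open>j\<close> as the frequency and \<open>k\<close> as the variable;
  \<open>h \<le> q\<close> keeps the values of \<open>j\<close> incongruent.\<close>

lemma sum_dkernel_square:
  assumes "odd q" "h \<le> q"
  shows "(\<Sum>k\<in>symres q. (norm (dkernel q h k))\<^sup>2) = real q * real h"
proof -
  have q: "q > 0" using assms by (simp add: odd_pos)
  have "(\<Sum>k\<in>symres q. (norm (\<Sum>j\<in>{1..int h}. 1 * ee q (- (j * k))))\<^sup>2) =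
      real q * (\<Sum>j\<in>{1..int h}. (cmod 1)\<^sup>2)"
  proof (rule parseval[OF symres_system[OF assms(1)] q])
    fix k l assume "k \<in> {1..int h}" "l \<in> {1..int h}" "[k = l] (mod int q)"
    then show "k = l" using residues_system_interval[OF q, of 1] assms(2)
      by (auto simp: residues_system_def)
  qed simp
  then show ?thesis by (simp add: dkernel_def)
qed

section \<open>Gauss sums and Polya's expansion of an interval sum\<close>

locale nonprincipal_character =
  fixes q :: nat and chi :: "int \<Rightarrow> complex"
  assumes prime_q: "prime q" and char: "dirichlet_character q chi"
    and norm_1: "\<And>n. coprime n (int q) \<Longrightarrow> norm (chi n) = 1"
    and nonprincipal: "\<exists>n. coprime n (int q) \<and> chi n \<noteq> 1"
begin

lemma q_pos: "q > 0"
  using prime_q prime_gt_0_nat by blast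

lemma chi_mult: "chi (m * n) = chi m * chi n"
  using char by (simp add: dirichlet_character_def)

lemma chi_mod: "chi (n mod int q) = chi n"
proof -
  have step: "chi (n + int q) = chi n" for n using char by (simp add: dirichlet_character_def)
  have nat: "chi (n + int q * int m) = chi n" for n m
  proof (induction m)
    case (Suc m)
    have "chi (n + int q * int (Suc m)) = chi ((n + int q * int m) + int q)" by (simp add: algebra_simps)
    then show ?case by (simp only: step Suc.IH)
  qed simp
  have eq: "n = n mod int q + int q * (n div int q)" by simp
  show ?thesis
  proof (cases "n div int q \<ge> 0")
    case True
    then show ?thesis using nat[of "n mod int q" "nat (n div int q)"] eq by simp
  next
    case False
    then have "n + int q * int (nat (- (n div int q))) = n mod int q" using eq by (simp add: minus_mult_div_eq_mod)
    then show ?thesis using nat[of n "nat (- (n div int q))"] by simp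
  qed
qed

lemma chi_eq_0_iff: "chi n = 0 \<longleftrightarrow> int q dvd n"
proof -
  have "coprime n (int q) \<longleftrightarrow> \<not> int q dvd n"
    using prime_q by (metis coprime_commute dvd_refl not_coprimeI not_is_unit_0 prime_imp_coprime
        prime_int_nat_transfer prime_nat_int_transfer not_prime_unit)
  then show ?thesis using char by (auto simp: dirichlet_character_def)
qed

lemma norm_chi_nz: "\<not> int q dvd n \<Longrightarrow> norm (chi n) = 1"
  using norm_1 char chi_eq_0_iff by (auto simp: dirichlet_character_def)

lemma sum_chi: "(\<Sum>n\<in>{0..<int q}. chi n) = 0"
proof -
  obtain a where a: "coprime a (int q)" "chi a \<noteq> 1" using nonprincipal by auto
  have "(\<Sum>n\<in>{0..<int q}. chi (a * n)) = (\<Sum>n\<in>{0..<int q}. chi n)"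
    by (rule sum_residues_mult[where f = chi, OF q_pos a(1) chi_mod])
  then have "(chi a - 1) * (\<Sum>n\<in>{0..<int q}. chi n) = 0"
    by (simp add: chi_mult left_diff_distrib flip: sum_distrib_left)
  then show ?thesis using a(2) by simp
qed

definition gauss where "gauss = (\<Sum>n\<in>{0..<int q}. chi n * ee q n)"

text \<open>For \<open>k\<close> prime to \<open>q\<close>, substitute \<open>k * n\<close> for
  \<open>n\<close>. For multiples of \<open>q\<close> both sides vanish, the left one because a
  nonprincipal character sums to 0.\<close>

lemma gauss_twist: "(\<Sum>n\<in>{0..<int q}. chi n * ee q (k * n)) = cnj (chi k) * gauss"
proof (cases "int q dvd k")
  case True
  then have "ee q (k * n) = 1" for n using q_pos by (simp add: ee_eq_1_iff)
  then show ?thesis using True chi_eq_0_iff sum_chi by simp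
next
  case False
  then have k: "coprime k (int q)" using chi_eq_0_iff char by (auto simp: dirichlet_character_def)
  have "(\<Sum>n\<in>{0..<int q}. chi (k * n) * ee q (k * n)) = gauss"
    unfolding gauss_def
    using sum_residues_mult[OF q_pos k, of "\<lambda>n. chi n * ee q n"] chi_mod ee_mod[OF q_pos] by simp
  then have "chi k * (\<Sum>n\<in>{0..<int q}. chi n * ee q (k * n)) = gauss"
    by (simp add: chi_mult sum_distrib_left mult.assoc)
  moreover have "cnj (chi k) * chi k = 1"
    using norm_chi_nz[OF False] by (metis complex_norm_square mult.commute of_real_1 one_power2)
  ultimately show ?thesis by (metis mult.assoc mult_1)
qed

lemma sum_norm_chi: "(\<Sum>n\<in>{0..<int q}. (norm (chi n))\<^sup>2) = real (q - 1)"
proof -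
  have "norm (chi n) = (if n = 0 then 0 else 1)" if "n \<in> {0..<int q}" for n
    using that norm_chi_nz[of n] chi_eq_0_iff[of n] zdvd_not_zless[of n "int q"] by auto
  then have "(\<Sum>n\<in>{0..<int q}. (norm (chi n))\<^sup>2) = (\<Sum>n\<in>{0..<int q}. if n = 0 then 0 else 1)"
    by (intro sum.cong) auto
  also have "\<dots> = (\<Sum>n\<in>{0..<int q} - {0}. 1)"
    using q_pos by (subst sum.remove[of _ 0]) auto
  finally show ?thesis using q_pos by (simp add: of_nat_diff)
qed

text \<open>By \<open>gauss_twist\<close> the Fourier transform of \<open>chi\<close> has modulus
  \<open>norm (chi k) * norm gauss\<close> at \<open>k\<close>. Parseval equates
  \<open>(q - 1) * (norm gauss)\<^sup>2\<close> with \<open>q * (q - 1)\<close>.\<close>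

lemma norm_gauss: "(norm gauss)\<^sup>2 = real q"
proof -
  have rs: "residues_system q {0..<int q}" using residues_system_interval[OF q_pos, of 0] by simp
  have "(\<Sum>k\<in>{0..<int q}. (cmod (\<Sum>n\<in>{0..<int q}. chi n * ee q (- (n * k))))\<^sup>2) =
     real q * (\<Sum>n\<in>{0..<int q}. (cmod (chi n))\<^sup>2)"
    by (rule parseval[OF rs q_pos]) (use rs in \<open>auto simp: residues_system_def\<close>)
  also have "(\<Sum>k\<in>{0..<int q}. (cmod (\<Sum>n\<in>{0..<int q}. chi n * ee q (- (n * k))))\<^sup>2) =
     (\<Sum>k\<in>{0..<int q}. (norm (chi k))\<^sup>2 * (norm gauss)\<^sup>2)"
  proof (intro sum.cong refl)
    fix k
    have "norm (chi (- k)) = norm (chi k)"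
      using norm_chi_nz[of k] norm_chi_nz[of "- k"] chi_eq_0_iff[of k] chi_eq_0_iff[of "- k"]
      by (cases "int q dvd k") auto
    then show "(cmod (\<Sum>n\<in>{0..<int q}. chi n * ee q (- (n * k))))\<^sup>2 = (norm (chi k))\<^sup>2 * (norm gauss)\<^sup>2"
      using gauss_twist[of "- k"] by (simp add: mult.commute norm_mult power_mult_distrib)
  qed
  also have "\<dots> = real (q - 1) * (norm gauss)\<^sup>2"
    by (simp add: sum_norm_chi flip: sum_distrib_right)
  finally show ?thesis using sum_norm_chi prime_gt_1_nat[OF prime_q] by simp
qed

text \<open>Additive orthogonality in \<open>k\<close> detects \<open>n = x + j\<close> modulo
  \<open>q\<close>. After interchanging the sums, the one over \<open>n\<close> is a twisted Gauss
  sum and the one over \<open>j\<close> is the kernel. The frequency 0 is present in form but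
  carries \<open>chi 0 = 0\<close>.\<close>

lemma char_sum_expansion:
  assumes "odd q" "H \<ge> 0"
  shows "char_sum chi H x = gauss / of_nat q *
    (\<Sum>k\<in>symres q. cnj (chi k) * dkernel q (nat \<lfloor>H\<rfloor>) k * ee q (- (k * x)))"
proof -
  \<comment> \<open>Since \<open>x\<close> is an integer, only the floor of \<open>H\<close>
    matters.\<close>
  define h where "h = nat \<lfloor>H\<rfloor>"
  have h: "int h = \<lfloor>H\<rfloor>" using assms(2) by (simp add: h_def)
  have "{n. x < n \<and> real_of_int n \<le> real_of_int x + H} = {x + 1..x + int h}"
    unfolding h by (auto simp: le_floor_iff) linarith+
  then have "char_sum chi H x = (\<Sum>n\<in>{x + 1..x + int h}. chi n)" by (simp add: char_sum_def)
  also have "\<dots> = (\<Sum>j\<in>{1..int h}. chi (x + j))"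
    by (rule sum.reindex_bij_witness[of _ "\<lambda>j. x + j" "\<lambda>n. n - x"]) auto
  also have "of_nat q * \<dots> = (\<Sum>j\<in>{1..int h}. \<Sum>n\<in>{0..<int q}. chi n * (\<Sum>k\<in>symres q. ee q ((n - x - j) * k)))"
  proof (subst sum_distrib_left, intro sum.cong refl)
    fix j
    have "(\<Sum>n\<in>{0..<int q}. chi n * (\<Sum>k\<in>symres q. ee q ((n - x - j) * k))) =
      (\<Sum>n\<in>{0..<int q}. if n = (x + j) mod int q then chi n * of_nat q else 0)"
    proof (intro sum.cong refl)
      fix n assume n: "n \<in> {0..<int q}"
      have "int q dvd n - x - j \<longleftrightarrow> [n = x + j] (mod int q)"
        by (simp add: cong_iff_dvd_diff diff_diff_eq)
      also have "\<dots> \<longleftrightarrow> n = (x + j) mod int q" using n by (auto simp: cong_def)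
      finally show "chi n * (\<Sum>k\<in>symres q. ee q ((n - x - j) * k)) =
          (if n = (x + j) mod int q then chi n * of_nat q else 0)"
        using sum_ee_residues[OF symres_system[OF assms(1)] q_pos] by simp
    qed
    also have "\<dots> = chi ((x + j) mod int q) * of_nat q"
      using q_pos by (simp add: sum.delta)
    finally show "of_nat q * chi (x + j) =
        (\<Sum>n\<in>{0..<int q}. chi n * (\<Sum>k\<in>symres q. ee q ((n - x - j) * k)))"
      by (simp add: chi_mod)
  qed
  also have "\<dots> = (\<Sum>j\<in>{1..int h}. \<Sum>n\<in>{0..<int q}. \<Sum>k\<in>symres q. (chi n * ee q (k * n)) * (ee q (- (j * k)) * ee q (- (k * x))))"
    unfolding sum_distrib_left
    by (intro sum.cong refl) (simp add: algebra_simps flip: ee_add)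
  also have "\<dots> = (\<Sum>k\<in>symres q. (\<Sum>n\<in>{0..<int q}. chi n * ee q (k * n)) * (\<Sum>j\<in>{1..int h}. ee q (- (j * k)) * ee q (- (k * x))))"
    unfolding sum_product
    by (rule trans[OF sum.cong[OF refl sum.swap]], rule trans[OF sum.swap], rule sum.cong[OF refl sum.swap])
  also have "\<dots> = (\<Sum>k\<in>symres q. cnj (chi k) * gauss * (dkernel q h k * ee q (- (k * x))))"
    by (simp only: gauss_twist dkernel_def sum_distrib_right)
  also have "\<dots> = gauss * (\<Sum>k\<in>symres q. cnj (chi k) * dkernel q h k * ee q (- (k * x)))"
    unfolding sum_distrib_left by (intro sum.cong refl) (simp add: mult_ac)
  finally show ?thesis using q_pos by (simp add: field_simps h_def)
qed

end

section \<open>Moments and characteristic functions\<close>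

definition mean :: "'a set \<Rightarrow> ('a \<Rightarrow> 'b) \<Rightarrow> 'b::real_normed_field" where
  "mean A f = (\<Sum>x\<in>A. f x) / of_nat (card A)"

lemma mean_diff: "mean A (\<lambda>x. f x - g x) = mean A f - mean A g"
  and mean_cmult: "mean A (\<lambda>x. c * f x) = c * mean A f"
  and mean_sum: "mean A (\<lambda>x. \<Sum>k\<in>B. h k x) = (\<Sum>k\<in>B. mean A (h k))"
  by (simp_all add: mean_def sum_subtractf diff_divide_distrib
      sum_distrib_left sum_divide_distrib sum.swap[of _ _ B])

lemma mean_const: "finite A \<Longrightarrow> A \<noteq> {} \<Longrightarrow> mean A (\<lambda>x. c) = c"
  by (simp add: mean_def)

lemma norm_mean_le: "norm (mean A f) \<le> mean A (\<lambda>x. norm (f x))"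
  by (simp add: mean_def norm_divide divide_right_mono norm_sum)

lemma mean_mono: "(\<And>x. x \<in> A \<Longrightarrow> f x \<le> g x) \<Longrightarrow> mean A f \<le> (mean A g :: real)"
  by (simp add: mean_def divide_right_mono sum_mono)

lemma mean_of_real: "mean A (\<lambda>x. of_real (f x)) = of_real (mean A f)"
  by (simp add: mean_def)

lemma mean_cnj: "mean A (\<lambda>x. cnj (f x)) = cnj (mean A f)"
  by (simp add: mean_def)

lemma mean_power2_le: "(mean A f)\<^sup>2 \<le> mean A (\<lambda>x. (f x)\<^sup>2 :: real)"
proof (cases "finite A \<and> A \<noteq> {}")
  case True
  then have "card A > 0" by (simp add: card_gt_0_iff)
  moreover have "(\<Sum>x\<in>A. f x)\<^sup>2 \<le> card A * (\<Sum>x\<in>A. (f x)\<^sup>2)"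
    using Cauchy_Schwarz_ineq_sum[of "\<lambda>_. 1" f A] by simp
  ultimately show ?thesis
    by (simp add: mean_def power_divide field_simps power2_eq_square)
\<comment> \<open>On an empty or infinite \<open>A\<close> both means are 0 by convention.\<close>
qed (auto simp: mean_def)

text \<open>Expand the power of \<open>Re (cnj w * z) = (cnj w * z + w * cnj z) / 2\<close>
  binomially. Only the middle term, with \<open>n = 2 * k\<close>, has a nonzero limit. The result
  is the \<open>n\<close>-th moment of a centred normal variable of variance
  \<open>(cmod w)\<^sup>2 / 2\<close>.\<close>

lemma real_linear_moment_tendsto:
  fixes Z :: "'i \<Rightarrow> 'b \<Rightarrow> complex"
  assumes mom: "\<And>a b. ((\<lambda>i. mean (A i) (\<lambda>x. Z i x ^ a * cnj (Z i x) ^ b)) \<longlongrightarrow>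
        (if a = b then fact a else 0)) F"
  shows "((\<lambda>i. mean (A i) (\<lambda>x. Re (cnj w * Z i x) ^ n)) \<longlongrightarrow>
        (if even n then ((cmod w)\<^sup>2 / 4) ^ (n div 2) * fact n / fact (n div 2) else 0)) F"
proof -
  define c where "c k = of_nat (n choose k) * cnj w ^ k * w ^ (n - k) / 2 ^ n" for k
  have "complex_of_real (Re (cnj w * z) ^ n) = (\<Sum>k\<le>n. c k * (z ^ k * cnj z ^ (n - k)))" for z
  proof -
    have "complex_of_real (Re (cnj w * z)) = (cnj w * z + w * cnj z) / 2"
      by (simp add: complex_eq_iff)
    then have "complex_of_real (Re (cnj w * z) ^ n) = (cnj w * z + w * cnj z) ^ n / 2 ^ n"
      by (simp only: of_real_power power_divide)
    also have "\<dots> = (\<Sum>k\<le>n. c k * (z ^ k * cnj z ^ (n - k)))"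
      unfolding binomial_ring sum_divide_distrib
      by (intro sum.cong) (simp_all add: c_def power_mult_distrib mult_ac)
    finally show ?thesis .
  qed
  then have eq: "complex_of_real (mean (A i) (\<lambda>x. Re (cnj w * Z i x) ^ n)) =
      (\<Sum>k\<le>n. c k * mean (A i) (\<lambda>x. Z i x ^ k * cnj (Z i x) ^ (n - k)))" for i
    by (simp only: mean_of_real[symmetric] mean_sum mean_cmult)
  have "(\<Sum>k\<le>n. c k * (if k = n - k then fact k else 0)) =
     complex_of_real (if even n then ((cmod w)\<^sup>2 / 4) ^ (n div 2) * fact n / fact (n div 2) else 0)"
  proof (cases "even n")
    case True
    then obtain m where n: "n = 2 * m" by (elim evenE)
    have "(\<Sum>k\<le>n. c k * (if k = n - k then fact k else 0)) = (\<Sum>k\<in>{m}. c k * fact k)"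
      by (rule sum.mono_neutral_cong_right) (auto simp: n)
    also have "\<dots> = complex_of_real (((cmod w)\<^sup>2 / 4) ^ m * fact n / fact m)"
    proof -
      have "of_nat (n choose m) = (fact n / (fact m * fact m) :: complex)"
        using binomial_fact[of m n, where 'a = complex] by (simp add: n)
      moreover have "complex_of_real ((cmod w)\<^sup>2) = cnj w * w"
        by (metis complex_norm_square mult.commute)
      moreover have "(2::complex) ^ n = 4 ^ m" by (simp add: n power_mult)
      ultimately show ?thesis
        by (simp add: c_def n power_mult_distrib power_divide mult_ac)
    qed
    finally show ?thesis using n by simp
  next
    case False
    then have "k \<noteq> n - k" if "k \<le> n" for k using that by presburger
    then show ?thesis using False by simp
  qed
  moreover have "((\<lambda>i. complex_of_real (mean (A i) (\<lambda>x. Re (cnj w * Z i x) ^ n))) \<longlongrightarrow>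
      (\<Sum>k\<le>n. c k * (if k = n - k then fact k else 0))) F"
    unfolding eq by (intro tendsto_intros mom)
  ultimately show ?thesis by (simp only: tendsto_of_real_iff)
qed

text \<open>Taylor's formula for \<open>cis\<close> with an even number of terms, so that the
  remainder \<open>W ^ (2 * m) / fact (2 * m)\<close> is itself a moment. Its limit
  \<open>c ^ m / fact m\<close> is small for large \<open>m\<close>, so no bound uniform in all
  orders is needed.\<close>

lemma char_tendsto_of_moments:
  fixes Z :: "'i \<Rightarrow> 'b \<Rightarrow> complex"
  assumes mom: "\<And>a b. ((\<lambda>i. mean (A i) (\<lambda>x. Z i x ^ a * cnj (Z i x) ^ b)) \<longlongrightarrow>
        (if a = b then fact a else 0)) F"
  shows "((\<lambda>i. mean (A i) (\<lambda>x. cis (Re (cnj w * Z i x)))) \<longlongrightarrow> of_real (exp (- (cmod w)\<^sup>2 / 4))) F"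
proof (rule tendstoI)
  fix e :: real assume e: "e > 0"
  define c where "c = (cmod w)\<^sup>2 / 4"
  define L where "L n = (if even n then c ^ (n div 2) * fact n / fact (n div 2) else 0)" for n
  define W where "W i x = Re (cnj w * Z i x)" for i x
  have lim: "((\<lambda>i. mean (A i) (\<lambda>x. W i x ^ n)) \<longlongrightarrow> L n) F" for n
    unfolding W_def L_def c_def by (rule real_linear_moment_tendsto[OF mom])
  have "(\<lambda>n. (\<Sum>j<n. (- c) ^ j /\<^sub>R fact j)) \<longlonglongrightarrow> exp (- c)"
    using exp_converges[of "- c"] by (simp add: sums_def)
  then have "eventually (\<lambda>n. dist (\<Sum>j<n. (- c) ^ j /\<^sub>R fact j) (exp (- c)) < e / 4) sequentially"
    by (rule tendstoD) (use e in simp)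
  moreover have "(\<lambda>n. c ^ n /\<^sub>R fact n) \<longlonglongrightarrow> 0"
    using summable_exp_generic[of c] by (rule summable_LIMSEQ_zero)
  then have "eventually (\<lambda>n. c ^ n /\<^sub>R fact n < e / 4) sequentially"
    by (rule order_tendstoD) (use e in simp)
  ultimately have "eventually (\<lambda>n. dist (\<Sum>j<n. (- c) ^ j /\<^sub>R fact j) (exp (- c)) < e / 4 \<and>
      c ^ n /\<^sub>R fact n < e / 4 \<and> n > 0) sequentially"
    using eventually_gt_at_top[of "0::nat"] by eventually_elim auto
  \<comment> \<open>This \<open>m\<close> is fixed before passing to the limit along
    \<open>F\<close>. It controls both the series of \<open>exp (- c)\<close> and the limit of the
    Taylor remainder.\<close>
  then obtain m where m: "dist (\<Sum>j<m. (- c) ^ j /\<^sub>R fact j) (exp (- c)) < e / 4"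
      "c ^ m /\<^sub>R fact m < e / 4" "m > 0"
    using eventually_happens' sequentially_bot by blast
  define T where "T i x = (\<Sum>k<2*m. \<i> ^ k / fact k * of_real (W i x ^ k))" for i x
  \<comment> \<open>Odd moments vanish in the limit, and the factorial in \<open>L (2 * n)\<close>
    cancels, leaving the exponential series at \<open>- c\<close>.\<close>
  have L_sum: "(\<Sum>k<2*n. \<i> ^ k / fact k * of_real (L k)) = of_real (\<Sum>j<n. (- c) ^ j /\<^sub>R fact j)" for n
  proof (induction n)
    case (Suc n)
    have "(\<Sum>k<2*Suc n. \<i> ^ k / fact k * complex_of_real (L k)) =
       (\<Sum>k<2*n. \<i> ^ k / fact k * of_real (L k)) + \<i> ^ (2*n) / fact (2*n) * of_real (L (2*n))"
      by (simp add: L_def)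
    also have "\<i> ^ (2*n) = (- 1) ^ n" by (simp add: power_mult)
    also have "(- 1) ^ n / fact (2*n) * complex_of_real (L (2*n)) = of_real ((- c) ^ n /\<^sub>R fact n)"
      by (simp add: L_def power_minus[of c] field_simps)
    finally show ?case unfolding Suc.IH by (simp only: sum.lessThan_Suc of_real_add)
  qed auto
  have "((\<lambda>i. mean (A i) (T i)) \<longlongrightarrow> (\<Sum>k<2*m. \<i> ^ k / fact k * of_real (L k))) F"
    unfolding T_def mean_sum mean_cmult mean_of_real by (intro tendsto_intros lim)
  then have "\<forall>\<^sub>F i in F. dist (mean (A i) (T i)) (of_real (\<Sum>j<m. (- c) ^ j /\<^sub>R fact j)) < e / 4"
    unfolding L_sum by (rule tendstoD) (use e in simp)
  moreover have "L (2*m) / fact (2*m) < e / 4"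
    using m(2) by (simp add: L_def field_simps)
  then have "\<forall>\<^sub>F i in F. mean (A i) (\<lambda>x. W i x ^ (2*m)) / fact (2*m) < e / 4"
    using tendsto_divide[OF lim[of "2*m"] tendsto_const[of "fact (2*m)"]]
    by (intro order_tendstoD(2)) auto
  ultimately show "\<forall>\<^sub>F i in F. dist (mean (A i) (\<lambda>x. cis (Re (cnj w * Z i x))))
      (of_real (exp (- (cmod w)\<^sup>2 / 4))) < e"
  proof eventually_elim
    case (elim i)
    have "norm (cis (W i x) - T i x) \<le> W i x ^ (2*m) / fact (2*m)" for x
    proof -
      have "{..2*m-1} = {..<2*m}" using m(3) by auto
      then have "T i x = (\<Sum>k\<le>2*m-1. (\<i> * W i x) ^ k / fact k)"
        by (simp add: T_def power_mult_distrib)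
      moreover have "Suc (2*m-1) = 2*m" using m(3) by simp
      ultimately show ?thesis
        using iexp_approx1[of "W i x" "2*m-1"] by (simp add: cis_conv_exp power_even_abs)
    qed
    then have "mean (A i) (\<lambda>x. norm (cis (W i x) - T i x)) \<le> mean (A i) (\<lambda>x. W i x ^ (2*m) / fact (2*m))"
      by (intro mean_mono)
    also have "\<dots> < e / 4"
      using elim(2) mean_cmult[of "A i" "1 / fact (2*m)" "\<lambda>x. W i x ^ (2*m)"] by simp
    finally have "dist (mean (A i) (\<lambda>x. cis (W i x))) (mean (A i) (T i)) < e / 4"
      using norm_mean_le[of "A i" "\<lambda>x. cis (W i x) - T i x"] by (simp add: dist_norm mean_diff)
    moreover have "dist (complex_of_real (\<Sum>j<m. (- c) ^ j /\<^sub>R fact j)) (of_real (exp (- c))) < e / 4"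
      using m(1) by (simp only: dist_of_real)
    ultimately have "dist (mean (A i) (\<lambda>x. cis (W i x))) (of_real (exp (- c))) < e"
      using elim(1) e by metric
    then show ?case by (simp add: W_def c_def)
  qed
qed

section \<open>Characteristic function of the Gaussian limit\<close>

lemma gaussian_char:
  fixes M :: "'a measure"
  assumes "prob_space M" and s: "s > 0" and Z: "distributed M lborel Z (normal_density 0 s)"
  shows "(\<integral>\<omega>. cis (t * Z \<omega>) \<partial>M) = of_real (exp (- (s * t)\<^sup>2 / 2))"
proof -
  interpret prob_space M by fact
  have Y: "distributed M lborel (\<lambda>\<omega>. Z \<omega> / s) std_normal_density"
    using normal_standard_normal_convert[of s Z 0] s Z by simp
  have meas: "Z \<in> borel_measurable M"
    using distributed_measurable[OF Z] by simp
  have "(\<integral>\<omega>. cis (t * Z \<omega>) \<partial>M) = (\<integral>\<omega>. iexp (t * s * (Z \<omega> / s)) \<partial>M)"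
    using s by (simp add: cis_conv_exp)
  also have "\<dots> = (CLINT y | distr M lborel (\<lambda>\<omega>. Z \<omega> / s). iexp (t * s * y))"
    using meas by (subst integral_distr) auto
  also have "distr M lborel (\<lambda>\<omega>. Z \<omega> / s) = std_normal_distribution"
    using Y by (simp add: distributed_def)
  also have "(CLINT y | std_normal_distribution. iexp (t * s * y)) = char std_normal_distribution (t * s)"
    by (simp add: char_def)
  finally show ?thesis by (simp add: char_std_normal_distribution mult.commute)
qed

text \<open>Independence factors the integral, since \<open>Re (cnj w * z)\<close> is
  \<open>Re w * Z1 + Im w * Z2\<close>. The variances 1/2 produce the 4 in the exponent.\<close>

lemma complex_gaussian_char:
  fixes M :: "'a measure"
  assumes M: "prob_space M"
    and Z1: "distributed M lborel Z1 (normal_density 0 (sqrt (1 / 2)))"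
    and Z2: "distributed M lborel Z2 (normal_density 0 (sqrt (1 / 2)))"
    and indep: "prob_space.indep_var M borel Z1 borel Z2"
  shows "(\<integral>z. cis (Re (cnj w * z)) \<partial>distr M borel (\<lambda>\<omega>. complex_of_real (Z1 \<omega>) + \<i> * complex_of_real (Z2 \<omega>)))
    = of_real (exp (- (cmod w)\<^sup>2 / 4))"
proof -
  interpret prob_space M by fact
  have meas [measurable]: "Z1 \<in> borel_measurable M" "Z2 \<in> borel_measurable M"
    using distributed_measurable[OF Z1] distributed_measurable[OF Z2] by simp_all
  have cis_meas [measurable]: "(\<lambda>x. cis (t * x)) \<in> borel_measurable borel" for t
    by (intro borel_measurable_continuous_onI continuous_intros)
  have "(\<lambda>z. cis (Re (cnj w * z))) \<in> borel_measurable borel"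
    by (intro borel_measurable_continuous_onI continuous_intros)
  then have "(\<integral>z. cis (Re (cnj w * z)) \<partial>distr M borel (\<lambda>\<omega>. complex_of_real (Z1 \<omega>) + \<i> * complex_of_real (Z2 \<omega>)))
     = (\<integral>\<omega>. cis (Re w * Z1 \<omega>) * cis (Im w * Z2 \<omega>) \<partial>M)"
    by (subst integral_distr) (auto simp: cis_mult)
  also have "\<dots> = (\<integral>\<omega>. cis (Re w * Z1 \<omega>) \<partial>M) * (\<integral>\<omega>. cis (Im w * Z2 \<omega>) \<partial>M)"
  proof (rule indep_var_lebesgue_integral)
    show "integrable M (\<lambda>\<omega>. cis (Re w * Z1 \<omega>))" "integrable M (\<lambda>\<omega>. cis (Im w * Z2 \<omega>))"
      by (auto intro!: integrable_const_bound[of _ 1])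
    have "indep_var borel ((\<lambda>x. cis (Re w * x)) \<circ> Z1) borel ((\<lambda>x. cis (Im w * x)) \<circ> Z2)"
      by (rule indep_var_compose[OF indep]) auto
    then show "indep_var borel (\<lambda>\<omega>. cis (Re w * Z1 \<omega>)) borel (\<lambda>\<omega>. cis (Im w * Z2 \<omega>))"
      by (simp add: comp_def)
  qed
  also have "\<dots> = of_real (exp (- (cmod w)\<^sup>2 / 4))"
    using gaussian_char[OF M _ Z1, of "Re w"] gaussian_char[OF M _ Z2, of "Im w"]
    by (simp add: power_mult_distrib cmod_power2 field_simps flip: of_real_mult exp_add)
  finally show ?thesis .
qed

section \<open>Weak convergence on the complex plane\<close>

text \<open>The scalar is part of the wave, so sums of waves already form a linear space and the
  induction over integrals has only two cases. Products follow because frequencies add.\<close>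

inductive trig_poly :: "(complex \<Rightarrow> complex) \<Rightarrow> bool" where
  wave: "trig_poly (\<lambda>z. c * cis (Re (cnj w * z)))"
| add: "trig_poly f \<Longrightarrow> trig_poly g \<Longrightarrow> trig_poly (\<lambda>z. f z + g z)"

lemma trig_poly_const: "trig_poly (\<lambda>z. c)"
  using trig_poly.wave[of c 0] by simp

lemma trig_poly_mult:
  assumes "trig_poly f" "trig_poly g"
  shows "trig_poly (\<lambda>z. f z * g z)"
  using assms(1)
proof induction
  case f: (wave c w)
  show ?case using assms(2)
  proof induction
    case (wave d v)
    have "(\<lambda>z. c * cis (Re (cnj w * z)) * (d * cis (Re (cnj v * z)))) =
       (\<lambda>z. (c * d) * cis (Re (cnj (w + v) * z)))"
      by (auto simp: fun_eq_iff cis_mult[symmetric] algebra_simps)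
    then show ?case using trig_poly.wave by metis
  next
    case (add f g)
    then show ?case using trig_poly.add by (simp add: algebra_simps)
  qed
next
  case (add f g)
  then show ?case using trig_poly.add by (simp add: algebra_simps)
qed

lemma trig_poly_sin: "trig_poly (\<lambda>z. complex_of_real (sin (Re (cnj w * z))))"
proof -
  have sin_cis: "complex_of_real (sin t) = (- \<i> / 2) * cis t + (\<i> / 2) * cis (- t)" for t
    by (simp add: complex_eq_iff)
  have "Re (cnj (- w) * z) = - Re (cnj w * z)" for z
    by simp
  then have "(\<lambda>z. complex_of_real (sin (Re (cnj w * z)))) =
     (\<lambda>z. (- \<i> / 2) * cis (Re (cnj w * z)) + (\<i> / 2) * cis (Re (cnj (- w) * z)))"
    unfolding sin_cis by presburger
  then show ?thesis using trig_poly.add[OF trig_poly.wave trig_poly.wave] by metis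
qed

lemma trig_poly_continuous: "trig_poly f \<Longrightarrow> continuous_on UNIV f"
  by (induction rule: trig_poly.induct) (auto intro!: continuous_intros)

lemma trig_poly_bounded: "trig_poly f \<Longrightarrow> \<exists>B. \<forall>z. norm (f z) \<le> B"
proof (induction rule: trig_poly.induct)
  case (wave c w)
  then show ?case by (intro exI[of _ "norm c"]) (auto simp: norm_mult)
next
  case (add f g)
  then show ?case by (meson add_mono norm_triangle_ineq order_trans)
qed

text \<open>Composing a polynomial with the sines of the coordinates gives a trigonometric polynomial
  which inherits the sup norm of the polynomial on a square, so that the approximation stays
  bounded globally.\<close>

lemma trig_poly_approx:
  fixes f :: "complex \<Rightarrow> real"
  assumes f: "continuous_on UNIV f" and B: "\<And>z. \<bar>f z\<bar> \<le> B" and R: "R > 0" and e: "e > 0"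
  shows "\<exists>g. trig_poly (\<lambda>z. complex_of_real (g z)) \<and>
    (\<forall>z. norm z \<le> R \<longrightarrow> \<bar>f z - g z\<bar> \<le> e) \<and> (\<forall>z. \<bar>g z\<bar> \<le> B + e)"
proof -
  define S where "S = cbox (Complex (-1) (-1)) (Complex 1 1)"
  define \<theta> where "\<theta> z = Complex (sin (Re z / R)) (sin (Im z / R))" for z
  \<comment> \<open>On the square \<open>arcsin\<close> undoes the sines:
    \<open>h (\<theta> z) = f z\<close> whenever the coordinates of \<open>z\<close> are at most
    \<open>R\<close> in modulus, because \<open>1 \<le> pi / 2\<close>.\<close>
  define h where "h p = f (Complex (R * arcsin (Re p)) (R * arcsin (Im p)))" for p
  \<comment> \<open>\<open>P\<close> is the algebra handed to Stone-Weierstrass. It contains the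
    coordinates and records that composition with \<open>\<theta>\<close> gives a trigonometric
    polynomial, so polynomials need not be written out.\<close>
  define P where "P g \<longleftrightarrow> continuous_on S g \<and> trig_poly (\<lambda>z. complex_of_real (g (\<theta> z)))" for g
  have S: "p \<in> S \<longleftrightarrow> \<bar>Re p\<bar> \<le> 1 \<and> \<bar>Im p\<bar> \<le> 1" for p
    by (auto simp: S_def in_cbox_complex_iff)
  have Re': "P Re"
    unfolding P_def \<theta>_def using trig_poly_sin[of "of_real (1 / R)"]
    by (auto intro!: continuous_intros)
  have Im': "P Im"
    unfolding P_def \<theta>_def using trig_poly_sin[of "Complex 0 (1 / R)"]
    by (auto intro!: continuous_intros)
  have h: "continuous_on S h"
  proof -
    have "continuous_on S (\<lambda>p. Complex (R * arcsin (Re p)) (R * arcsin (Im p)))"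
      by (intro continuous_on_Complex continuous_intros) (auto simp: S)
    then show ?thesis unfolding h_def
      by (rule continuous_on_compose2[OF f]) auto
  qed
  have "\<exists>g. P g \<and> (\<forall>x\<in>S. \<bar>h x - g x\<bar> < e)"
  proof (rule Stone_Weierstrass_HOL[where P = P])
    show "compact S" by (simp add: S_def)
    show "P (\<lambda>x. c)" for c by (simp add: P_def trig_poly_const)
    show "P f \<Longrightarrow> continuous_on S f" for f by (simp add: P_def)
    show "P f \<and> P g \<Longrightarrow> P (\<lambda>x. f x + g x)" for f g
      by (auto simp: P_def intro!: continuous_intros trig_poly.add)
    show "P f \<and> P g \<Longrightarrow> P (\<lambda>x. f x * g x)" for f g
      by (auto simp: P_def intro!: continuous_intros trig_poly_mult)
    show "x \<in> S \<and> y \<in> S \<and> x \<noteq> y \<Longrightarrow> \<exists>f. P f \<and> f x \<noteq> f y" for x y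
      using Re' Im' by (metis complex_eqI)
  qed (use h e in auto)
  then obtain g where g: "P g" "\<And>p. p \<in> S \<Longrightarrow> \<bar>h p - g p\<bar> < e" by auto
  have \<theta>: "\<theta> z \<in> S" for z by (simp add: S \<theta>_def)
  have "\<bar>f z - g (\<theta> z)\<bar> \<le> e" if z: "norm z \<le> R" for z
  proof -
    have "\<bar>Re z / R\<bar> \<le> 1" "\<bar>Im z / R\<bar> \<le> 1"
      using z R abs_Re_le_cmod[of z] abs_Im_le_cmod[of z] by (auto simp: divide_simps)
    then have "-(pi/2) \<le> Re z / R" "Re z / R \<le> pi/2" "-(pi/2) \<le> Im z / R" "Im z / R \<le> pi/2"
      using pi_ge_two unfolding abs_le_iff by linarith+
    then have "arcsin (sin (Re z / R)) = Re z / R" "arcsin (sin (Im z / R)) = Im z / R"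
      by (simp_all only: arcsin_sin)
    then have "h (\<theta> z) = f z" using R by (simp add: h_def \<theta>_def)
    then show ?thesis using g(2)[OF \<theta>[of z]] by simp
  qed
  moreover have "\<bar>g (\<theta> z)\<bar> \<le> B + e" for z
  proof -
    have "\<bar>h (\<theta> z)\<bar> \<le> B" unfolding h_def by (rule B)
    then show ?thesis using g(2)[OF \<theta>[of z]] by linarith
  qed
  ultimately show ?thesis using g(1) unfolding P_def by (intro exI[of _ "g \<circ> \<theta>"]) auto
qed

lemma trig_poly_integral_tendsto:
  assumes "trig_poly f"
    and prob: "\<forall>\<^sub>F i in F. prob_space (\<mu> i)" "prob_space \<nu>"
    and sets: "\<And>i. sets (\<mu> i) = sets borel" "sets \<nu> = sets borel"
    and char: "\<And>w. ((\<lambda>i. \<integral>z. cis (Re (cnj w * z)) \<partial>\<mu> i) \<longlongrightarrow> (\<integral>z. cis (Re (cnj w * z)) \<partial>\<nu>)) F"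
  shows "((\<lambda>i. \<integral>z. f z \<partial>\<mu> i) \<longlongrightarrow> (\<integral>z. f z \<partial>\<nu>)) F"
  using assms(1)
proof induction
  case (wave c w)
  then show ?case using char[of w] by (auto intro!: tendsto_intros)
next
  case (add f g)
  have int: "integrable M h" if h: "trig_poly h" and M: "prob_space M" "sets M = sets borel"
    for h and M :: "complex measure"
  proof -
    interpret prob_space M by fact
    obtain B where "\<And>z. norm (h z) \<le> B" using trig_poly_bounded[OF h] by blast
    moreover have "h \<in> borel_measurable M"
      using borel_measurable_continuous_onI[OF trig_poly_continuous[OF h]] M(2)
      by (simp cong: measurable_cong_sets)
    ultimately show ?thesis by (intro integrable_const_bound[of _ B]) auto
  qed
  have "\<forall>\<^sub>F i in F. (\<integral>z. f z \<partial>\<mu> i) + (\<integral>z. g z \<partial>\<mu> i) = (\<integral>z. f z + g z \<partial>\<mu> i)"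
    using prob(1) by eventually_elim (simp add: Bochner_Integration.integral_add int sets add.hyps)
  then have "((\<lambda>i. \<integral>z. f z + g z \<partial>\<mu> i) \<longlongrightarrow> (\<integral>z. f z \<partial>\<nu>) + (\<integral>z. g z \<partial>\<nu>)) F"
    using tendsto_add[OF add.IH] by (rule Lim_transform_eventually[rotated])
  then show ?case
    using prob(2) sets add.hyps by (simp add: Bochner_Integration.integral_add int)
qed

lemma integral_diff_le_tail:
  fixes M :: "complex measure"
  assumes "prob_space M" and sets: "sets M = sets borel"
    and f: "continuous_on UNIV f" and g: "continuous_on UNIV g"
    and fB: "\<And>z. \<bar>f z\<bar> \<le> (B::real)" and gB: "\<And>z. \<bar>g z\<bar> \<le> B"
    and near: "\<And>z. norm z \<le> R \<Longrightarrow> \<bar>f z - g z\<bar> \<le> e" and e: "e \<ge> 0"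
  shows "\<bar>(\<integral>z. f z \<partial>M) - (\<integral>z. g z \<partial>M)\<bar> \<le> e + 2 * B * measure M {z. norm z > R}"
proof -
  interpret prob_space M by fact
  have meas: "h \<in> borel_measurable M" if "continuous_on UNIV h" for h :: "complex \<Rightarrow> real"
    using borel_measurable_continuous_onI[OF that] sets by (simp cong: measurable_cong_sets)
  have int: "integrable M f" "integrable M g"
    using meas f g fB gB by (auto intro!: integrable_const_bound[of _ B])
  have E: "{z. norm z > R} \<in> sets M" unfolding sets by measurable
  have "\<bar>(\<integral>z. f z \<partial>M) - (\<integral>z. g z \<partial>M)\<bar> = \<bar>\<integral>z. f z - g z \<partial>M\<bar>"
    using int by simp
  also have "\<dots> \<le> (\<integral>z. \<bar>f z - g z\<bar> \<partial>M)" by (rule integral_abs_bound)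
  also have "\<dots> \<le> (\<integral>z. e + 2 * B * indicator {z. norm z > R} z \<partial>M)"
  proof (rule integral_mono)
    show "integrable M (\<lambda>z. \<bar>f z - g z\<bar>)" using int by auto
    show "integrable M (\<lambda>z. e + 2 * B * indicator {z. norm z > R} z)"
      using E by (auto simp: emeasure_eq_measure)
    show "\<bar>f z - g z\<bar> \<le> e + 2 * B * indicator {z. norm z > R} z" for z
      using near[of z] fB[of z] gB[of z] e by (cases "norm z \<le> R") auto
  qed
  also have "\<dots> = e + 2 * B * measure M {z. norm z > R}"
    using E by (subst Bochner_Integration.integral_add) (auto simp: emeasure_eq_measure prob_space)
  finally show ?thesis .
qed

text \<open>The complements of growing discs decrease to the empty set.\<close>

lemma tail_measure_small:
  fixes \<nu> :: "complex measure"
  assumes "prob_space \<nu>" and sets: "sets \<nu> = sets borel" and e: "e > 0"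
  shows "\<exists>R>0. measure \<nu> {z. norm z > R} < e"
proof -
  interpret prob_space \<nu> by fact
  have "(\<lambda>n. measure \<nu> {z. norm z > real n}) \<longlonglongrightarrow> measure \<nu> (\<Inter>n. {z. norm z > real n})"
    by (rule finite_Lim_measure_decseq) (auto simp: sets decseq_def)
  also have "(\<Inter>n. {z::complex. norm z > real n}) = {}"
    by (auto simp: not_less) (meson not_less real_arch_simple)
  finally have "eventually (\<lambda>n. measure \<nu> {z. norm z > real n} < e) sequentially"
    using e by (auto intro: order_tendstoD)
  moreover have "eventually (\<lambda>n. real n > 0) sequentially"
    using eventually_gt_at_top[of "0::nat"] by eventually_elim auto
  ultimately have "eventually (\<lambda>n. real n > 0 \<and> measure \<nu> {z. norm z > real n} < e) sequentially"
    by eventually_elim auto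
  then show ?thesis using eventually_happens' sequentially_bot by blast
qed

text \<open>Levy's continuity theorem with tightness as a hypothesis. A disc is chosen that carries
  almost all mass of the limit and, eventually, of each \<open>\<mu> i\<close>. The test function is
  replaced there by a trigonometric polynomial which stays bounded outside, and whose integrals
  converge by linearity.\<close>

lemma weak_conv_along_of_char:
  fixes \<mu> :: "'i \<Rightarrow> complex measure"
  assumes prob: "\<forall>\<^sub>F i in F. prob_space (\<mu> i)" "prob_space \<nu>"
    and sets: "\<And>i. sets (\<mu> i) = sets borel" "sets \<nu> = sets borel"
    and tight: "\<And>e. e > 0 \<Longrightarrow> \<exists>R>0. \<forall>\<^sub>F i in F. measure (\<mu> i) {z. norm z > R} < e"
    and char: "\<And>w. ((\<lambda>i. \<integral>z. cis (Re (cnj w * z)) \<partial>\<mu> i) \<longlongrightarrow> (\<integral>z. cis (Re (cnj w * z)) \<partial>\<nu>)) F"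
  shows "weak_conv_along \<mu> \<nu> F"
  unfolding weak_conv_along_def
proof (intro allI impI tendstoI)
  fix f :: "complex \<Rightarrow> real" and e :: real
  assume f: "continuous_on UNIV f" and "bounded (range f)" and e: "e > 0"
  then obtain B where B: "\<And>z. \<bar>f z\<bar> \<le> B" by (auto simp: bounded_iff)
  have B0: "B \<ge> 0" using B[of 0] by linarith
  \<comment> \<open>The errors add up to \<open>2 d + d + 2 d\<close>, below \<open>e\<close>; the
    tail bound \<open>\<eta>\<close> makes each contribution from outside the disc at most
    \<open>d\<close>.\<close>
  define d where "d = e / 8"
  define \<eta> where "\<eta> = d / (2 * (B + d))"
  have d: "d > 0" using e by (simp add: d_def)
  then have \<eta>: "\<eta> > 0" using B0 by (simp add: \<eta>_def)
  have small: "2 * (B + d) * m \<le> d" if "m < \<eta>" for m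
    using that d B0 by (simp add: \<eta>_def field_simps)
  obtain R1 where R1: "R1 > 0" "\<forall>\<^sub>F i in F. measure (\<mu> i) {z. norm z > R1} < \<eta>"
    using tight[OF \<eta>] by auto
  obtain R2 where R2: "R2 > 0" "measure \<nu> {z. norm z > R2} < \<eta>"
    using tail_measure_small[OF prob(2) sets(2) \<eta>] by auto
  define R where "R = max R1 R2"
  have mono: "measure M {z. norm z > R} \<le> measure M {z. norm z > r}"
    if "prob_space M" "sets M = sets borel" "r \<le> R" for M :: "complex measure" and r
  proof -
    interpret prob_space M by fact
    show ?thesis using that by (intro finite_measure_mono) auto
  qed
  obtain g where g: "trig_poly (\<lambda>z. complex_of_real (g z))" 
      "\<And>z. norm z \<le> R \<Longrightarrow> \<bar>f z - g z\<bar> \<le> d" "\<And>z. \<bar>g z\<bar> \<le> B + d"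
    using trig_poly_approx[OF f B _ d, of R] R1(1) unfolding R_def by (metis less_max_iff_disj)
  have gc: "continuous_on UNIV g"
    using continuous_on_Re[OF trig_poly_continuous[OF g(1)]] by simp
  have fB': "\<bar>f z\<bar> \<le> B + d" for z
    using B[of z] d by linarith
  have close: "\<bar>(\<integral>z. f z \<partial>M) - (\<integral>z. g z \<partial>M)\<bar> \<le> d + 2 * (B + d) * measure M {z. norm z > R}"
    if "prob_space M" "sets M = sets borel" for M
    using that f gc fB' g(3) g(2) less_imp_le[OF d] by (rule integral_diff_le_tail)
  have "((\<lambda>i. \<integral>z. complex_of_real (g z) \<partial>\<mu> i) \<longlongrightarrow> (\<integral>z. complex_of_real (g z) \<partial>\<nu>)) F"
    by (rule trig_poly_integral_tendsto[OF g(1) prob sets char])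
  then have "((\<lambda>i. \<integral>z. g z \<partial>\<mu> i) \<longlongrightarrow> (\<integral>z. g z \<partial>\<nu>)) F"
    by (simp only: integral_complex_of_real tendsto_of_real_iff)
  then have ev: "\<forall>\<^sub>F i in F. dist (\<integral>z. g z \<partial>\<mu> i) (\<integral>z. g z \<partial>\<nu>) < d"
    using d by (auto simp: tendsto_iff)
  have \<nu>: "\<bar>(\<integral>z. f z \<partial>\<nu>) - (\<integral>z. g z \<partial>\<nu>)\<bar> \<le> 2 * d"
    using close[OF prob(2) sets(2)] small[of "measure \<nu> {z. norm z > R}"] R2(2)
      mono[OF prob(2) sets(2), of R2] by (simp add: R_def)
  show "\<forall>\<^sub>F i in F. dist (\<integral>z. f z \<partial>\<mu> i) (\<integral>z. f z \<partial>\<nu>) < e"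
    using ev R1(2) prob(1)
  proof eventually_elim
    case (elim i)
    have "\<bar>(\<integral>z. f z \<partial>\<mu> i) - (\<integral>z. g z \<partial>\<mu> i)\<bar> \<le> 2 * d"
      using close[OF elim(3) sets(1)] small[of "measure (\<mu> i) {z. norm z > R}"] elim(2)
        mono[OF elim(3) sets(1), of R1] by (simp add: R_def)
    then show ?case using \<nu> elim(1) d e unfolding dist_real_def d_def by linarith
  qed
qed

section \<open>Mixed moments of the truncated expansion\<close>

lemma sum_power_lists:
  fixes f :: "'a \<Rightarrow> 'b::comm_semiring_1"
  assumes S: "finite S"
  shows "(\<Sum>k\<in>S. f k) ^ n = (\<Sum>ks | set ks \<subseteq> S \<and> length ks = n. prod_list (map f ks))"
proof (induction n)
  case 0
  have "{ks. set ks \<subseteq> S \<and> length ks = 0} = {[]}" by auto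
  then show ?case by simp
next
  case (Suc n)
  have "(\<Sum>k\<in>S. f k) ^ Suc n = (\<Sum>k\<in>S. \<Sum>ks | set ks \<subseteq> S \<and> length ks = n. f k * prod_list (map f ks))"
    by (simp add: Suc.IH sum_product)
  also have "\<dots> = (\<Sum>(k, ks)\<in>S \<times> {ks. set ks \<subseteq> S \<and> length ks = n}. f k * prod_list (map f ks))"
    by (rule sum.cartesian_product)
  also have "\<dots> = (\<Sum>ks | set ks \<subseteq> S \<and> length ks = Suc n. prod_list (map f ks))"
    by (rule sum.reindex_bij_witness[of _ "\<lambda>ks. (hd ks, tl ks)" "\<lambda>(k, ks). k # ks"])
       (auto simp: length_Suc_conv)
  finally show ?case .
qed

definition tpoly :: "nat \<Rightarrow> (int \<Rightarrow> complex) \<Rightarrow> nat \<Rightarrow> (int \<Rightarrow> complex) \<Rightarrow> int \<Rightarrow> complex" where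
  "tpoly q \<alpha> K chi x = (\<Sum>k\<in>nzbox K. cnj (chi k) * \<alpha> k * ee q (- (k * x)))"

definition moment :: "nat \<Rightarrow> (int \<Rightarrow> complex) \<Rightarrow> nat \<Rightarrow> (int \<Rightarrow> complex) \<Rightarrow> nat \<Rightarrow> nat \<Rightarrow> complex" where
  "moment q \<alpha> K chi a b = mean {0..<int q} (\<lambda>x. tpoly q \<alpha> K chi x ^ a * cnj (tpoly q \<alpha> K chi x) ^ b)"

text \<open>The index tuples surviving the average over \<open>x\<close>, with equality in place of
  congruence modulo \<open>q\<close>.\<close>

definition balanced :: "nat \<Rightarrow> nat \<Rightarrow> nat \<Rightarrow> (int list \<times> int list) set" where
  "balanced K a b = {(ks, ls). ks \<in> vecs a K \<and> ls \<in> vecs b K \<and> sum_list ks = sum_list ls}"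

definition weight :: "(int \<Rightarrow> complex) \<Rightarrow> (int \<Rightarrow> complex) \<Rightarrow> int list \<times> int list \<Rightarrow> complex" where
  "weight \<alpha> chi = (\<lambda>(ks, ls). prod_list (map (\<lambda>k. cnj (chi k) * \<alpha> k) ks) *
     prod_list (map (\<lambda>l. chi l * cnj (\<alpha> l)) ls))"

lemma finite_balanced: "finite (balanced K a b)"
  by (rule finite_subset[of _ "vecs a K \<times> vecs b K"]) (auto simp: balanced_def finite_vecs)

lemma abs_sum_list_le: "ks \<in> vecs a K \<Longrightarrow> \<bar>sum_list ks\<bar> \<le> int (a * K)"
proof (induction ks arbitrary: a)
  case (Cons k ks)
  then obtain a' where a: "a = Suc a'" "ks \<in> vecs a' K" "\<bar>k\<bar> \<le> int K"
    by (auto simp: vecs_def nzbox_def)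
  then show ?case using Cons.IH[of a'] by simp
qed simp

lemma prod_list_map_ee:
  "prod_list (map (\<lambda>k. g k * ee q (- (k * x))) ks) = prod_list (map g ks) * ee q (- (sum_list ks * x))"
proof (induction ks)
  case (Cons k ks)
  have "- ((k + sum_list ks) * x) = - (k * x) + - (sum_list ks * x)" by (simp add: algebra_simps)
  then have "ee q (- (sum_list (k # ks) * x)) = ee q (- (k * x)) * ee q (- (sum_list ks * x))"
    by (simp only: sum_list.Cons ee_add)
  then show ?case using Cons.IH by (simp add: mult_ac)
qed simp

lemma cnj_prod_list: "cnj (prod_list xs) = prod_list (map cnj xs)"
  by (induction xs) auto

lemma mean_ee:
  assumes "q > 0"
  shows "mean {0..<int q} (\<lambda>x. ee q (k * x)) = (if int q dvd k then 1 else 0)"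
  using sum_ee_residues[OF residues_system_interval[OF assms, of 0] assms, of k] assms
  by (simp add: mean_def)

text \<open>Averaging over \<open>x\<close> leaves the tuples whose two sums agree modulo
  \<open>q\<close>. The sums differ by at most \<open>(a + b) * K\<close>, which is below
  \<open>q\<close>, so they are equal.\<close>

lemma moment_expand:
  assumes q: "q > 0" and K: "(a + b) * K < q"
  shows "moment q \<alpha> K chi a b = (\<Sum>t\<in>balanced K a b. weight \<alpha> chi t)"
proof -
  have pow: "tpoly q \<alpha> K chi x ^ n = (\<Sum>ks\<in>vecs n K. prod_list (map (\<lambda>k. cnj (chi k) * \<alpha> k) ks) * ee q (- (sum_list ks * x)))" for x n
    unfolding tpoly_def sum_power_lists[OF finite_nzbox] prod_list_map_ee vecs_def ..
  have "tpoly q \<alpha> K chi x ^ a * cnj (tpoly q \<alpha> K chi x) ^ b =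
     (\<Sum>ks\<in>vecs a K. \<Sum>ls\<in>vecs b K. weight \<alpha> chi (ks, ls) * ee q ((sum_list ls - sum_list ks) * x))" for x
  proof -
    have "tpoly q \<alpha> K chi x ^ a * cnj (tpoly q \<alpha> K chi x ^ b) =
     (\<Sum>ks\<in>vecs a K. \<Sum>ls\<in>vecs b K. weight \<alpha> chi (ks, ls) * ee q ((sum_list ls - sum_list ks) * x))"
      unfolding pow cnj_sum sum_product
    proof (intro sum.cong refl)
      fix ks ls
      have "ee q ((sum_list ls - sum_list ks) * x) = ee q (sum_list ls * x) * cnj (ee q (sum_list ks * x))"
        by (simp only: left_diff_distrib ee_diff)
      then show "prod_list (map (\<lambda>k. cnj (chi k) * \<alpha> k) ks) * ee q (- (sum_list ks * x)) *
          cnj (prod_list (map (\<lambda>k. cnj (chi k) * \<alpha> k) ls) * ee q (- (sum_list ls * x))) =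
          weight \<alpha> chi (ks, ls) * ee q ((sum_list ls - sum_list ks) * x)"
        by (simp add: weight_def cnj_prod_list comp_def ee_minus mult_ac)
    qed
    then show ?thesis by simp
  qed
  then have "moment q \<alpha> K chi a b = (\<Sum>ks\<in>vecs a K. \<Sum>ls\<in>vecs b K. weight \<alpha> chi (ks, ls) *
      (if int q dvd sum_list ls - sum_list ks then 1 else 0))"
    by (simp only: moment_def mean_sum mean_cmult mean_ee[OF q])
  also have "\<dots> = (\<Sum>(ks, ls)\<in>vecs a K \<times> vecs b K. weight \<alpha> chi (ks, ls) *
      (if int q dvd sum_list ls - sum_list ks then 1 else 0))"
    by (rule sum.cartesian_product)
  also have "\<dots> = (\<Sum>t\<in>balanced K a b. weight \<alpha> chi t)"
  proof (rule sum.mono_neutral_cong_right)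
    show "finite (vecs a K \<times> vecs b K)" by (simp add: finite_vecs)
    show "balanced K a b \<subseteq> vecs a K \<times> vecs b K" by (auto simp: balanced_def)
    show "\<forall>t\<in>vecs a K \<times> vecs b K - balanced K a b. (case t of (ks, ls) \<Rightarrow> weight \<alpha> chi (ks, ls) *
      (if int q dvd sum_list ls - sum_list ks then 1 else 0)) = 0"
    proof
      fix t assume "t \<in> vecs a K \<times> vecs b K - balanced K a b"
      then obtain ks ls where t: "t = (ks, ls)" "ks \<in> vecs a K" "ls \<in> vecs b K" "sum_list ks \<noteq> sum_list ls"
        by (auto simp: balanced_def)
      have "\<bar>sum_list ls - sum_list ks\<bar> \<le> int (a * K) + int (b * K)"
        using abs_sum_list_le[OF t(2)] abs_sum_list_le[OF t(3)] by linarith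
      also have "\<dots> = int ((a + b) * K)" by (simp add: distrib_right)
      also have "\<dots> < int q" using K by (simp only: of_nat_less_iff)
      finally have "\<not> int q \<le> \<bar>sum_list ls - sum_list ks\<bar>" by simp
      moreover have "\<bar>sum_list ls - sum_list ks\<bar> > 0" using t(4) by simp
      ultimately have "\<not> int q dvd sum_list ls - sum_list ks"
        by (meson dvd_abs_iff zdvd_imp_le)
      then show "(case t of (ks, ls) \<Rightarrow> weight \<alpha> chi (ks, ls) *
          (if int q dvd sum_list ls - sum_list ks then 1 else 0)) = 0" by (simp add: t(1))
    qed
  qed (auto simp: balanced_def)
  finally show ?thesis .
qed

lemma weight_Cons: "weight \<alpha> chi (ks, l # ls) = chi l * cnj (\<alpha> l) * weight \<alpha> chi (ks, ls)"
  by (simp add: weight_def mult_ac)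

lemma weight_insert: "weight \<alpha> chi (take i ks @ k # drop i ks, ls) = cnj (chi k) * \<alpha> k * weight \<alpha> chi (ks, ls)"
proof -
  have "prod_list (map f ks) = prod_list (map f (take i ks)) * prod_list (map f (drop i ks))" for f :: "int \<Rightarrow> complex"
    by (metis append_take_drop_id map_append prod_list.append)
  then show ?thesis by (simp add: weight_def mult_ac)
qed

text \<open>Deleting \<open>ks ! i\<close> and \<open>hd ls\<close>, which are equal, is a bijection
  onto a free value \<open>k\<close> and a shorter balanced pair. The deleted entries contribute
  \<open>(cmod (\<alpha> k))\<^sup>2\<close> because \<open>chi k\<close> is unimodular.\<close>

lemma sum_matched:
  assumes i: "i \<le> a" and unit: "\<And>k. k \<in> nzbox K \<Longrightarrow> norm (chi k) = 1"
  shows "(\<Sum>(ks, ls)\<in>balanced K (Suc a) (Suc b). if ks ! i = hd ls then weight \<alpha> chi (ks, ls) else 0) =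
    of_real (\<Sum>k\<in>nzbox K. (cmod (\<alpha> k))\<^sup>2) * (\<Sum>t\<in>balanced K a b. weight \<alpha> chi t)"
proof -
  have "of_real (\<Sum>k\<in>nzbox K. (cmod (\<alpha> k))\<^sup>2) * (\<Sum>t\<in>balanced K a b. weight \<alpha> chi t) =
    (\<Sum>(k, t)\<in>nzbox K \<times> balanced K a b. of_real ((cmod (\<alpha> k))\<^sup>2) * weight \<alpha> chi t)"
    by (simp only: of_real_sum sum_product sum.cartesian_product)
  also have "\<dots> = (\<Sum>(ks, ls) | (ks, ls) \<in> balanced K (Suc a) (Suc b) \<and> ks ! i = hd ls. weight \<alpha> chi (ks, ls))"
  proof (rule sum.reindex_bij_witness[of _
      "\<lambda>(ks, ls). (hd ls, (take i ks @ drop (Suc i) ks, tl ls))"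
      "\<lambda>(k, (ks, ls)). (take i ks @ k # drop i ks, k # ls)"])
    fix p assume p: "p \<in> nzbox K \<times> balanced K a b"
    then obtain k ks ls where t: "p = (k, (ks, ls))" "k \<in> nzbox K" "set ks \<subseteq> nzbox K" "length ks = a"
      "set ls \<subseteq> nzbox K" "length ls = b" "sum_list ks = sum_list ls" by (auto simp: balanced_def vecs_def)
    have sum: "sum_list (take i ks) + sum_list (drop i ks) = sum_list ks"
      by (metis append_take_drop_id sum_list.append)
    have len: "length (take i ks) = i" using t i by simp
    then have nth: "(take i ks @ k # drop i ks) ! i = k" by (metis nth_append_length)
    show "(case (case p of (k, ks, ls) \<Rightarrow> (take i ks @ k # drop i ks, k # ls)) of
        (ks, ls) \<Rightarrow> (hd ls, take i ks @ drop (Suc i) ks, tl ls)) = p"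
      using len by (simp add: t(1))
    show "(case p of (k, ks, ls) \<Rightarrow> (take i ks @ k # drop i ks, k # ls)) \<in>
        {(ks, ls). (ks, ls) \<in> balanced K (Suc a) (Suc b) \<and> ks ! i = hd ls}"
      using t sum nth i by (auto simp: balanced_def vecs_def dest: in_set_takeD in_set_dropD)
    have "cnj (chi k) * chi k = 1"
      using unit[OF t(2)] by (metis complex_norm_square mult.commute of_real_1 one_power2)
    then have "cnj (chi k) * (chi k * z) = z" for z by (metis mult.assoc mult_1)
    then show "(case (case p of (k, ks, ls) \<Rightarrow> (take i ks @ k # drop i ks, k # ls)) of
        (ks, ls) \<Rightarrow> weight \<alpha> chi (ks, ls)) = (case p of (k, t) \<Rightarrow> of_real ((cmod (\<alpha> k))\<^sup>2) * weight \<alpha> chi t)"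
      unfolding t(1) prod.case weight_insert weight_Cons complex_norm_square
      by (simp add: mult_ac)
  next
    fix p assume "p \<in> {(ks, ls). (ks, ls) \<in> balanced K (Suc a) (Suc b) \<and> ks ! i = hd ls}"
    then obtain ks k ls where t: "p = (ks, k # ls)" "ks ! i = k" "set ks \<subseteq> nzbox K" "length ks = Suc a"
      "k \<in> nzbox K" "set ls \<subseteq> nzbox K" "length ls = b" "sum_list ks = k + sum_list ls"
      by (auto simp: balanced_def vecs_def length_Suc_conv)
    have ks: "ks = take i ks @ k # drop (Suc i) ks" using id_take_nth_drop[of i ks] t i by simp
    have "sum_list ks = sum_list (take i ks) + (k + sum_list (drop (Suc i) ks))"
      using ks by (metis sum_list.append sum_list.Cons)
    then show "(case p of (ks, ls) \<Rightarrow> (hd ls, take i ks @ drop (Suc i) ks, tl ls)) \<in> nzbox K \<times> balanced K a b"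
      using t i by (auto simp: balanced_def vecs_def dest: in_set_takeD in_set_dropD)
    show "(case (case p of (ks, ls) \<Rightarrow> (hd ls, take i ks @ drop (Suc i) ks, tl ls)) of
       (k, ks, ls) \<Rightarrow> (take i ks @ k # drop i ks, k # ls)) = p"
      using ks t i by simp
  qed
  also have "\<dots> = (\<Sum>(ks, ls)\<in>balanced K (Suc a) (Suc b). if ks ! i = hd ls then weight \<alpha> chi (ks, ls) else 0)"
    by (rule sum.mono_neutral_cong_left) (auto simp: finite_balanced split: if_splits)
  finally show ?thesis by simp
qed

lemma count_list_conv_sum: "of_nat (count_list ks x) = (\<Sum>i<length ks. if ks ! i = x then 1 else (0::complex))"
proof -
  have "count_list ks x = card {i. i < length ks \<and> ks ! i = x}"
    by (simp add: count_list_eq_length_filter length_filter_conv_card eq_commute)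
  then show ?thesis by (simp add: sum.If_cases lessThan_def Int_def)
qed

text \<open>Summing \<open>sum_matched\<close> over the positions \<open>i < a\<close> counts each
  tuple as often as \<open>hd ls\<close> occurs in \<open>ks\<close>, which explains the factor
  \<open>1 - count\<close>. For \<open>a = 0\<close> the truncated index \<open>a - 1\<close> is
  harmless, as its term has the factor \<open>of_nat a = 0\<close>.\<close>

lemma moment_recursion:
  assumes q: "q > 0" and K: "(a + b) * K < q" and b: "b > 0"
    and unit: "\<And>k. k \<in> nzbox K \<Longrightarrow> norm (chi k) = 1"
  shows "moment q \<alpha> K chi a b - of_nat a * of_real (\<Sum>k\<in>nzbox K. (cmod (\<alpha> k))\<^sup>2) * moment q \<alpha> K chi (a - 1) (b - 1) =
    (\<Sum>(ks, ls)\<in>balanced K a b. (1 - of_nat (count_list ks (hd ls))) * weight \<alpha> chi (ks, ls))"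
proof -
  have "(\<Sum>(ks, ls)\<in>balanced K a b. of_nat (count_list ks (hd ls)) * weight \<alpha> chi (ks, ls)) =
    (\<Sum>(ks, ls)\<in>balanced K a b. \<Sum>i<a. if ks ! i = hd ls then weight \<alpha> chi (ks, ls) else 0)"
    by (intro sum.cong refl)
       (auto simp: count_list_conv_sum balanced_def vecs_def sum_distrib_right intro!: sum.cong)
  also have "\<dots> = (\<Sum>i<a. \<Sum>(ks, ls)\<in>balanced K a b. if ks ! i = hd ls then weight \<alpha> chi (ks, ls) else 0)"
    unfolding case_prod_beta by (rule sum.swap)
  also have "\<dots> = (\<Sum>i<a. of_real (\<Sum>k\<in>nzbox K. (cmod (\<alpha> k))\<^sup>2) * moment q \<alpha> K chi (a - 1) (b - 1))"
  proof (intro sum.cong refl)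
    fix i assume i: "i \<in> {..<a}"
    have "(a - 1 + (b - 1)) * K \<le> (a + b) * K" by (intro mult_right_mono) auto
    then have "moment q \<alpha> K chi (a - 1) (b - 1) = (\<Sum>t\<in>balanced K (a - 1) (b - 1). weight \<alpha> chi t)"
      using K by (intro moment_expand q) linarith
    then show "(\<Sum>(ks, ls)\<in>balanced K a b. if ks ! i = hd ls then weight \<alpha> chi (ks, ls) else 0) =
      of_real (\<Sum>k\<in>nzbox K. (cmod (\<alpha> k))\<^sup>2) * moment q \<alpha> K chi (a - 1) (b - 1)"
      using sum_matched[where i = i and a = "a - 1" and b = "b - 1" and K = K and chi = chi and \<alpha> = \<alpha>] unit i b
      by simp
  qed
  finally have "(\<Sum>(ks, ls)\<in>balanced K a b. of_nat (count_list ks (hd ls)) * weight \<alpha> chi (ks, ls)) =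
      of_nat a * of_real (\<Sum>k\<in>nzbox K. (cmod (\<alpha> k))\<^sup>2) * moment q \<alpha> K chi (a - 1) (b - 1)"
    by simp
  then show ?thesis
    by (simp add: moment_expand[OF q K] case_prod_beta left_diff_distrib sum_subtractf)
qed

text \<open>Concatenate crosswise to \<open>ls @ ks'\<close> and \<open>ks @ ls'\<close>; this is
  injective since the lengths are known.\<close>

lemma card_balanced_pairs_le:
  assumes b: "b > 0"
  shows "card {((ks, ls), (ks', ls')) \<in> balanced K a b \<times> balanced K a b.
      prod_list ls * prod_list ks' = prod_list ks * prod_list ls' \<and> count_list ks (hd ls) \<noteq> 1}
    \<le> card (unmatched a b K)" (is "card ?A \<le> _")
proof (rule card_inj_on_le)
  define f :: "(int list \<times> int list) \<times> (int list \<times> int list) \<Rightarrow> int list \<times> int list"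
    where "f = (\<lambda>((ks, ls), (ks', ls')). (ls @ ks', ks @ ls'))"
  show "inj_on f ?A"
  proof (rule inj_onI)
    fix p p' assume p: "p \<in> ?A" "p' \<in> ?A" "f p = f p'"
    obtain ks ls ks' ls' where t: "p = ((ks, ls), (ks', ls'))" by (metis surj_pair)
    obtain ms ns ms' ns' where t': "p' = ((ms, ns), (ms', ns'))" by (metis surj_pair)
    have "length ls = b" "length ns = b" "length ks = a" "length ms = a"
      using p(1,2) by (simp_all add: t t' balanced_def vecs_def)
    then show "p = p'" using p(3) by (simp add: t t' f_def)
  qed
  show "f ` ?A \<subseteq> unmatched a b K"
  proof
    fix p assume "p \<in> f ` ?A"
    then obtain p' where p': "p' \<in> ?A" "p = f p'" by blast
    obtain ks ls ks' ls' where "p' = ((ks, ls), (ks', ls'))" by (metis surj_pair)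
    then have t: "p = (ls @ ks', ks @ ls')" "(ks, ls) \<in> balanced K a b" "(ks', ls') \<in> balanced K a b"
      "prod_list ls * prod_list ks' = prod_list ks * prod_list ls'" "count_list ks (hd ls) \<noteq> 1"
      using p' by (simp_all add: f_def)
    have len: "length ks = a" "length ls = b" "length ks' = a" "length ls' = b"
      using t by (auto simp: balanced_def vecs_def)
    then have "ls \<noteq> []" using b by auto
    then show "p \<in> unmatched a b K"
      using t len by (auto simp: unmatched_def balanced_def vecs_def)
  qed
  show "finite (unmatched a b K)"
    by (rule finite_subset[of _ "vecs (a + b) K \<times> vecs (a + b) K"]) (auto simp: unmatched_def finite_vecs)
qed

lemma char_one:
  assumes "dirichlet_character q chi"
  shows "chi 1 = 1"
proof -
  have "chi (1 * 1) = chi 1 * chi 1"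
    using assms unfolding dirichlet_character_def by blast
  moreover have "coprime 1 (int q)" by simp
  then have "chi 1 \<noteq> 0" using assms unfolding dirichlet_character_def by blast
  ultimately show ?thesis by simp
qed

lemma char_prod_list:
  assumes "dirichlet_character q chi"
  shows "chi (prod_list ks) = prod_list (map chi ks)"
proof (induction ks)
  case Nil
  show ?case using char_one[OF assms] by simp
next
  case (Cons k ks)
  then show ?case using assms by (simp add: dirichlet_character_def)
qed

lemma weight_char:
  assumes "dirichlet_character q chi"
  shows "weight \<alpha> chi (ks, ls) = (prod_list (map \<alpha> ks) * cnj (prod_list (map \<alpha> ls))) *
    (chi (prod_list ls) * cnj (chi (prod_list ks)))"
proof -
  have prod: "prod_list (map (\<lambda>k. f k * g k) ks) = prod_list (map f ks) * prod_list (map g ks)"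
    for f g :: "int \<Rightarrow> complex" and ks
    by (induction ks) (simp_all add: mult_ac)
  show ?thesis
    by (simp add: weight_def char_prod_list[OF assms] prod cnj_prod_list comp_def mult_ac)
qed

lemma norm_prod_list_map_le:
  assumes "\<And>k. k \<in> set ks \<Longrightarrow> norm (\<alpha> k) \<le> \<beta>"
  shows "norm (prod_list (map \<alpha> ks) :: complex) \<le> \<beta> ^ length ks"
  using assms
proof (induction ks)
  case (Cons k ks)
  have k: "norm (\<alpha> k) \<le> \<beta>" using Cons.prems by simp
  then have "0 \<le> \<beta>" using norm_ge_zero[of "\<alpha> k"] by linarith
  moreover have "norm (prod_list (map \<alpha> ks)) \<le> \<beta> ^ length ks" using Cons by simp
  ultimately have "norm (\<alpha> k) * norm (prod_list (map \<alpha> ks)) \<le> \<beta> * \<beta> ^ length ks"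
    using k by (intro mult_mono) auto
  then show ?case by (simp add: norm_mult)
qed simp

lemma count_list_le_length: "count_list xs x \<le> length xs"
  by (induction xs) auto

lemma coprime_nzbox:
  assumes "prime q" "0 < \<bar>n\<bar>" "\<bar>n\<bar> < int q"
  shows "coprime n (int q)"
proof -
  have "\<not> int q dvd n" using assms zdvd_not_zless[of "\<bar>n\<bar>" "int q"] by simp
  moreover have "prime (int q)" using assms(1) by simp
  ultimately have "coprime (int q) n" by (intro prime_imp_coprime)
  then show ?thesis by (simp add: coprime_commute)
qed

text \<open>Expanding the square and summing over all \<open>q - 1\<close> characters, orthogonality
  keeps the pairs with \<open>v t * u t'\<close> congruent to \<open>u t * v t'\<close>. Both are at
  most \<open>K ^ (a + b)\<close> in modulus and \<open>2 * K ^ (a + b) < q\<close>, so they are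
  equal. What remains is counted by \<open>unmatched\<close>, each term being at most
  \<open>q\<close> times the square of the coefficient bound \<open>B\<close>.\<close>

lemma variance_bound:
  fixes \<beta> :: real
  assumes q: "prime q" and K: "K \<ge> 1" "(a + b) * K < q" "2 * K ^ (a + b) < q" and b: "b > 0"
    and \<alpha>: "\<And>k. k \<in> nzbox K \<Longrightarrow> norm (\<alpha> k) \<le> \<beta>"
  shows "(\<Sum>j<q - 1. (norm (moment q \<alpha> K (dchar q j) a b - of_nat a * of_real (\<Sum>k\<in>nzbox K. (cmod (\<alpha> k))\<^sup>2) *
      moment q \<alpha> K (dchar q j) (a - 1) (b - 1)))\<^sup>2)
    \<le> real q * (real a + 1)\<^sup>2 * \<beta> ^ (2 * (a + b)) * real (card (unmatched a b K))"
proof -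
  define T where "T = balanced K a b"
  define c where "c = (\<lambda>(ks, ls). (1 - of_nat (count_list ks (hd ls))) *
      (prod_list (map \<alpha> ks) * cnj (prod_list (map \<alpha> ls))))"
  define u where "u = (\<lambda>(ks :: int list, ls :: int list). prod_list ks)"
  define v where "v = (\<lambda>(ks :: int list, ls :: int list). prod_list ls)"
  define B where "B = (real a + 1) * \<beta> ^ (a + b)"
  have fin: "finite T" by (simp add: T_def finite_balanced)
  have \<beta>: "\<beta> \<ge> 0" using \<alpha>[of 1] K(1) by (auto simp: nzbox_def intro: order_trans[OF norm_ge_zero])
  have "K * 1 < q"
  proof -
    have "K * 1 \<le> (a + b) * K" using b by simp
    then show ?thesis using K(2) by linarith
  qed
  then have unit: "norm (dchar q j k) = 1" if "k \<in> nzbox K" for j k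
    using that coprime_nzbox[OF q, of k] by (intro norm_dchar[OF q]) (auto simp: nzbox_def)
  have small: "v t * u t' \<noteq> 0 \<and> \<bar>v t * u t'\<bar> \<le> int K ^ (a + b)" if "t \<in> T" "t' \<in> T" for t t'
  proof -
    obtain ks ls ks' ls' where t: "t = (ks, ls)" "t' = (ks', ls')" "ls @ ks' \<in> vecs (b + a) K"
      using \<open>t \<in> T\<close> \<open>t' \<in> T\<close> by (auto simp: T_def balanced_def vecs_def)
    have "prod_list (ls @ ks') \<noteq> 0" using t(3) vecs_nonzero by blast
    moreover have "\<bar>prod_list (ls @ ks')\<bar> \<le> int K ^ (a + b)"
      using abs_prod_list_le[of "ls @ ks'" K] t(3) by (simp add: vecs_def add.commute)
    ultimately show ?thesis by (simp add: t u_def v_def)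
  qed
  have KI: "2 * int K ^ (a + b) < int q"
    using K(3) by (metis of_nat_less_iff of_nat_mult of_nat_numeral of_nat_power)
  have rec: "moment q \<alpha> K (dchar q j) a b - of_nat a * of_real (\<Sum>k\<in>nzbox K. (cmod (\<alpha> k))\<^sup>2) *
      moment q \<alpha> K (dchar q j) (a - 1) (b - 1) =
      (\<Sum>t\<in>T. c t * (dchar q j (v t) * cnj (dchar q j (u t))))" for j
    by (subst moment_recursion[where chi = "dchar q j", OF prime_gt_0_nat[OF q] K(2) b unit], assumption,
        unfold T_def, intro sum.cong refl)
       (auto simp: weight_char[OF dirichlet_character_dchar[OF q]] c_def u_def v_def mult_ac)
  have orth: "(\<Sum>j<q - 1. (dchar q j (v t) * cnj (dchar q j (u t))) * cnj (dchar q j (v t') * cnj (dchar q j (u t')))) =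
      (if v t * u t' = u t * v t' then of_nat (q - 1) else 0)" if t: "t \<in> T" "t' \<in> T" for t t'
  proof -
    have mult: "dchar q j (m * n) = dchar q j m * dchar q j n" for j m n
      using dirichlet_character_dchar[OF q] by (simp add: dirichlet_character_def)
    have 1: "v t * u t' \<noteq> 0" "\<bar>v t * u t'\<bar> \<le> int K ^ (a + b)" "v t' * u t \<noteq> 0" "\<bar>v t' * u t\<bar> \<le> int K ^ (a + b)"
      using small[OF t] small[OF t(2) t(1)] by auto
    have cop: "coprime (v t * u t') (int q)" "coprime (v t' * u t) (int q)"
      using 1 KI by (intro coprime_nzbox[OF q]; linarith)+
    have "(\<Sum>j<q - 1. (dchar q j (v t) * cnj (dchar q j (u t))) * cnj (dchar q j (v t') * cnj (dchar q j (u t')))) =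
      (\<Sum>j<q - 1. dchar q j (v t * u t') * cnj (dchar q j (v t' * u t)))"
      by (intro sum.cong refl) (simp add: mult mult_ac)
    also have "\<dots> = (if [v t * u t' = v t' * u t] (mod int q) then of_nat (q - 1) else 0)"
      by (rule dchar_orthogonal[OF q cop])
    also have "[v t * u t' = v t' * u t] (mod int q) \<longleftrightarrow> v t * u t' = u t * v t'"
    proof
      assume "[v t * u t' = v t' * u t] (mod int q)"
      then have "int q dvd v t * u t' - v t' * u t" by (simp only: cong_iff_dvd_diff)
      moreover have "\<bar>v t * u t' - v t' * u t\<bar> < int q" using 1 KI by linarith
      ultimately have "v t * u t' - v t' * u t = 0"
        using dvd_imp_le_int[of "v t * u t' - v t' * u t" "int q"] by fastforce
      then show "v t * u t' = u t * v t'" by (simp add: mult.commute)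
    qed (simp add: mult.commute)
    finally show ?thesis .
  qed
  have "complex_of_real (\<Sum>j<q - 1. (norm (\<Sum>t\<in>T. c t * (dchar q j (v t) * cnj (dchar q j (u t)))))\<^sup>2) =
    (\<Sum>j<q - 1. \<Sum>t\<in>T. \<Sum>t'\<in>T. c t * cnj (c t') * ((dchar q j (v t) * cnj (dchar q j (u t))) * cnj (dchar q j (v t') * cnj (dchar q j (u t')))))"
    unfolding of_real_sum complex_norm_square cnj_sum sum_product
    by (intro sum.cong refl) (simp add: mult_ac)
  also have "\<dots> = (\<Sum>t\<in>T. \<Sum>t'\<in>T. \<Sum>j<q - 1. c t * cnj (c t') * ((dchar q j (v t) * cnj (dchar q j (u t))) * cnj (dchar q j (v t') * cnj (dchar q j (u t')))))"
    by (rule trans[OF sum.swap], rule sum.cong[OF refl sum.swap])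
  also have "\<dots> = (\<Sum>t\<in>T. \<Sum>t'\<in>T. c t * cnj (c t') * (if v t * u t' = u t * v t' then of_nat (q - 1) else 0))"
    by (intro sum.cong refl) (simp only: orth sum_distrib_left[symmetric])
  also have "\<dots> = (\<Sum>(t, t')\<in>T \<times> T. c t * cnj (c t') * (if v t * u t' = u t * v t' then of_nat (q - 1) else 0))"
    by (rule sum.cartesian_product)
  \<comment> \<open>The factor \<open>1 - count\<close> in \<open>c t\<close> removes every
    \<open>t\<close> with exactly one match. The condition is imposed on the first tuple only, as in
    \<open>unmatched\<close>.\<close>
  also have "\<dots> = (\<Sum>(t, t') | (t, t') \<in> T \<times> T \<and> v t * u t' = u t * v t' \<and> count_list (fst t) (hd (snd t)) \<noteq> 1.
      c t * cnj (c t') * of_nat (q - 1))"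
    using fin by (intro sum.mono_neutral_cong_right) (auto simp: c_def split: if_splits)
  finally have eq: "complex_of_real (\<Sum>j<q - 1. (norm (\<Sum>t\<in>T. c t * (dchar q j (v t) * cnj (dchar q j (u t)))))\<^sup>2) =
    (\<Sum>(t, t') | (t, t') \<in> T \<times> T \<and> v t * u t' = u t * v t' \<and> count_list (fst t) (hd (snd t)) \<noteq> 1.
      c t * cnj (c t') * of_nat (q - 1))" (is "_ = (\<Sum>(t, t')\<in>?S. _)") .
  have cB: "norm (c t) \<le> B" if "t \<in> T" for t
  proof -
    obtain ks ls where t: "t = (ks, ls)" "set ks \<subseteq> nzbox K" "set ls \<subseteq> nzbox K" "length ks = a" "length ls = b"
      using \<open>t \<in> T\<close> by (auto simp: T_def balanced_def vecs_def)
    have "norm (1 - of_nat (count_list ks (hd ls)) :: complex) \<le> norm (1 :: complex) + norm (of_nat (count_list ks (hd ls)) :: complex)"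
      by (rule norm_triangle_ineq4)
    also have "\<dots> \<le> real a + 1" using count_list_le_length[of ks "hd ls"] t(4) by simp
    finally have 1: "norm (1 - of_nat (count_list ks (hd ls)) :: complex) \<le> real a + 1" .
    have "norm (prod_list (map \<alpha> ks)) * norm (prod_list (map \<alpha> ls)) \<le> \<beta> ^ length ks * \<beta> ^ length ls"
      using t \<alpha> \<beta> by (intro mult_mono norm_prod_list_map_le) auto
    then show ?thesis using 1 \<beta>
      by (auto simp: t c_def B_def norm_mult power_add intro!: mult_mono)
  qed
  have B0: "B \<ge> 0" using \<beta> by (simp add: B_def)
  have "(\<Sum>j<q - 1. (norm (\<Sum>t\<in>T. c t * (dchar q j (v t) * cnj (dchar q j (u t)))))\<^sup>2) =
     norm (complex_of_real (\<Sum>j<q - 1. (norm (\<Sum>t\<in>T. c t * (dchar q j (v t) * cnj (dchar q j (u t)))))\<^sup>2))"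
    by (simp only: norm_of_real abs_of_nonneg[OF sum_nonneg] zero_le_power2)
  also have "\<dots> \<le> (\<Sum>(t, t')\<in>?S. B * B * real q)"
    unfolding eq
  proof (rule sum_norm_le)
    fix p assume "p \<in> ?S"
    then obtain t t' where p: "p = (t, t')" "t \<in> T" "t' \<in> T" by auto
    have "norm (c t) * norm (c t') * real (q - 1) \<le> B * B * real q"
      using cB[OF p(2)] cB[OF p(3)] B0 by (intro mult_mono) auto
    then show "norm (case p of (t, t') \<Rightarrow> c t * cnj (c t') * of_nat (q - 1)) \<le> (case p of (t, t') \<Rightarrow> B * B * real q)"
      by (simp add: p(1) norm_mult)
  qed
  also have "\<dots> = real (card ?S) * (B * B * real q)" by (simp add: case_prod_beta)
  also have "\<dots> \<le> real (card (unmatched a b K)) * (B * B * real q)"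
  proof (intro mult_right_mono)
    have "?S = {((ks, ls), (ks', ls')) \<in> balanced K a b \<times> balanced K a b.
      prod_list ls * prod_list ks' = prod_list ks * prod_list ls' \<and> count_list ks (hd ls) \<noteq> 1}"
      by (auto simp: T_def u_def v_def)
    then show "real (card ?S) \<le> real (card (unmatched a b K))"
      using card_balanced_pairs_le[OF b, of K a] by simp
  qed (use B0 in auto)
  finally have "(\<Sum>j<q - 1. (norm (\<Sum>t\<in>T. c t * (dchar q j (v t) * cnj (dchar q j (u t)))))\<^sup>2) \<le>
      real (card (unmatched a b K)) * (B * B * real q)" .
  moreover have "\<beta> ^ (2 * (a + b)) = \<beta> ^ (a + b) * \<beta> ^ (a + b)"
    by (metis mult_2 power_add)
  ultimately show ?thesis
    unfolding rec by (simp only: B_def power2_eq_square mult_ac)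
qed

section \<open>Truncation\<close>

text \<open>The coefficient \<open>\<alpha>\<close> of the overview. Of the factor
  \<open>gauss / q\<close> in Polya's expansion, \<open>gauss / sqrt q\<close> becomes the
  unimodular \<open>phase\<close>; the other \<open>sqrt q\<close> joins the normalisation by
  \<open>sqrt H\<close>.\<close>

definition coef :: "nat \<Rightarrow> real \<Rightarrow> int \<Rightarrow> complex" where
  "coef q H k = dkernel q (nat \<lfloor>H\<rfloor>) k / of_real (sqrt (real q * H))"

text \<open>The cap keeps the box inside \<open>symres q\<close>; when it takes effect, all nonzero
  frequencies are kept.\<close>

definition cutoff :: "nat \<Rightarrow> nat \<Rightarrow> real \<Rightarrow> nat" where
  "cutoff r q H = min (nat \<lfloor>real r * (real q / H)\<rfloor>) ((q - 1) div 2)"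

lemma norm_coef_square: "H \<ge> 0 \<Longrightarrow> (norm (coef q H k))\<^sup>2 = (norm (dkernel q (nat \<lfloor>H\<rfloor>) k))\<^sup>2 / (real q * H)"
  by (simp add: coef_def norm_divide power_divide)

lemma norm_coef_le:
  assumes "H \<ge> 0" "q > 0"
  shows "norm (coef q H k) \<le> sqrt (H / real q)"
proof (rule real_le_rsqrt)
  have "norm (dkernel q (nat \<lfloor>H\<rfloor>) k) \<le> H"
    using norm_dkernel_le[of q "nat \<lfloor>H\<rfloor>" k] of_nat_floor[OF assms(1)] by linarith
  then have "(norm (dkernel q (nat \<lfloor>H\<rfloor>) k))\<^sup>2 \<le> H\<^sup>2" by (intro power_mono) auto
  then have "(norm (coef q H k))\<^sup>2 \<le> H\<^sup>2 / (real q * H)"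
    using assms by (simp only: norm_coef_square divide_right_mono mult_nonneg_nonneg of_nat_0_le_iff)
  also have "\<dots> = H / real q" by (simp add: power2_eq_square)
  finally show "(norm (coef q H k))\<^sup>2 \<le> H / real q" .
qed

lemma norm_coef_le':
  assumes "H > 0" "q > 0" "2 * \<bar>k\<bar> \<le> int q" "k \<noteq> 0"
  shows "(norm (coef q H k))\<^sup>2 \<le> real q / (4 * H) * (1 / (real_of_int k)\<^sup>2)"
proof -
  have "(norm (dkernel q (nat \<lfloor>H\<rfloor>) k))\<^sup>2 \<le> (real q / (2 * \<bar>real_of_int k\<bar>))\<^sup>2"
    using norm_dkernel_le'[OF assms(3,4,2)] by (intro power_mono) auto
  then have "(norm (coef q H k))\<^sup>2 \<le> (real q / (2 * \<bar>real_of_int k\<bar>))\<^sup>2 / (real q * H)"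
    using assms by (simp only: norm_coef_square less_imp_le divide_right_mono mult_nonneg_nonneg of_nat_0_le_iff)
  also have "\<dots> = real q / (4 * H) * (1 / (real_of_int k)\<^sup>2)"
    using assms by (simp add: power_divide power_mult_distrib power2_eq_square field_simps)
  finally show ?thesis .
qed

lemma sum_norm_coef:
  assumes "odd q" "1 \<le> H" "H \<le> real q"
  shows "(\<Sum>k\<in>symres q. (norm (coef q H k))\<^sup>2) = real (nat \<lfloor>H\<rfloor>) / H"
proof -
  have "nat \<lfloor>H\<rfloor> \<le> q" using assms(3) by (simp add: nat_le_iff floor_le_iff) 
  then have "(\<Sum>k\<in>symres q. (norm (dkernel q (nat \<lfloor>H\<rfloor>) k))\<^sup>2) = real q * real (nat \<lfloor>H\<rfloor>)"
    by (rule sum_dkernel_square[OF assms(1)])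
  moreover have "(\<Sum>k\<in>symres q. (norm (coef q H k))\<^sup>2) =
      (\<Sum>k\<in>symres q. (norm (dkernel q (nat \<lfloor>H\<rfloor>) k))\<^sup>2) / (real q * H)"
    using assms by (simp add: norm_coef_square sum_divide_distrib)
  ultimately show ?thesis using odd_pos[OF assms(1)] by simp
qed

lemma sum_inverse_squares_le:
  assumes "m \<ge> 1"
  shows "(\<Sum>k=m..n. 1 / (real k)\<^sup>2) \<le> 2 / real m"
proof (cases "m \<le> n")
  case True
  \<comment> \<open>Subtracting \<open>1 / n\<close> makes the induction telescope.\<close>
  then have "(\<Sum>k=m..n. 1 / (real k)\<^sup>2) \<le> 2 / real m - 1 / real n"
  proof (induction n rule: dec_induct)
    case base
    have "1 / (real m)\<^sup>2 \<le> 1 / real m" using assms by (simp add: field_simps power2_eq_square)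
    then show ?case using assms by (simp add: field_simps)
  next
    case (step n)
    have n: "real n \<ge> 1" using step.hyps assms by simp
    have "1 / (real (Suc n))\<^sup>2 \<le> 1 / (real n * real (Suc n))"
      using n by (intro divide_left_mono) (auto simp: power2_eq_square intro!: mult_mono)
    also have "\<dots> = 1 / real n - 1 / real (Suc n)" using n by (simp add: field_simps)
    finally show ?case using step.IH step.hyps by simp
  qed
  also have "\<dots> \<le> 2 / real m" by simp
  finally show ?thesis .
qed simp

lemma nzbox_cutoff_subset: "nzbox (cutoff r q H) \<subseteq> symres q"
  by (auto simp: nzbox_def cutoff_def symres_def)

text \<open>The frequency 0 contributes at most \<open>H / q\<close>. Beyond the cutoff
  \<open>K\<close> the two signs together give
  \<open>2 * (N / 4) * (2 / (K + 1)) = N / (K + 1)\<close> with \<open>N = q / H\<close>, and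
  \<open>K + 1 \<ge> r * N\<close> unless the cap was reached, in which case the range is
  empty.\<close>

lemma tail_coef_le:
  assumes q: "odd q" and H: "1 \<le> H" "H \<le> real q" and r: "r \<ge> 1"
  shows "(\<Sum>k\<in>symres q - nzbox (cutoff r q H). (norm (coef q H k))\<^sup>2) \<le> H / real q + 1 / real r"
proof -
  define K where "K = cutoff r q H"
  define M where "M = (q - 1) div 2"
  define c where "c = real q / (4 * H)"
  have q0: "q > 0" using q by (rule odd_pos)
  have c0: "c \<ge> 0" using H by (simp add: c_def)
  define P where "P = int ` {K + 1..M}"
  have sub: "symres q - nzbox K \<subseteq> insert 0 (P \<union> uminus ` P)"
  proof
    fix k assume k: "k \<in> symres q - nzbox K"
    show "k \<in> insert 0 (P \<union> uminus ` P)"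
    proof (cases "k = 0")
      case False
      then have "nat \<bar>k\<bar> \<in> {K + 1..M}" using k by (auto simp: symres_def nzbox_def M_def)
      then have "\<bar>k\<bar> \<in> P" unfolding P_def by (metis abs_ge_zero imageI nat_0_le)
      then show ?thesis by (cases "k \<ge> 0") (auto simp: image_iff intro: bexI[of _ "- k"])
    qed simp
  qed
  have finP: "finite P" by (simp add: P_def)
  have bound: "(norm (coef q H k))\<^sup>2 \<le> c * (1 / (real_of_int k)\<^sup>2)" if "\<bar>k\<bar> \<in> P" for k
  proof -
    have "k \<noteq> 0" "2 * \<bar>k\<bar> \<le> int q" using that by (auto simp: P_def M_def)
    then show ?thesis unfolding c_def using H q0 by (intro norm_coef_le') auto
  qed
  have "(\<Sum>k\<in>symres q - nzbox K. (norm (coef q H k))\<^sup>2) \<le> (\<Sum>k\<in>insert 0 (P \<union> uminus ` P). (norm (coef q H k))\<^sup>2)"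
    using sub finP by (intro sum_mono2) auto
  also have "\<dots> = (norm (coef q H 0))\<^sup>2 + (\<Sum>k\<in>P \<union> uminus ` P. (norm (coef q H k))\<^sup>2)"
    using finP by (subst sum.insert) (auto simp: P_def)
  also have "(\<Sum>k\<in>P \<union> uminus ` P. (norm (coef q H k))\<^sup>2) =
      (\<Sum>k\<in>P. (norm (coef q H k))\<^sup>2) + (\<Sum>k\<in>uminus ` P. (norm (coef q H k))\<^sup>2)"
    using finP by (intro sum.union_disjoint) (auto simp: P_def)
  also have "\<dots> \<le> (\<Sum>k\<in>P. c * (1 / (real_of_int k)\<^sup>2)) + (\<Sum>k\<in>uminus ` P. c * (1 / (real_of_int k)\<^sup>2))"
    by (intro add_mono sum_mono bound) (auto simp: P_def)
  also have "(\<Sum>k\<in>uminus ` P. c * (1 / (real_of_int k)\<^sup>2)) = (\<Sum>k\<in>P. c * (1 / (real_of_int k)\<^sup>2))"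
    by (subst sum.reindex) (auto simp: inj_on_def)
  also have "(\<Sum>k\<in>P. c * (1 / (real_of_int k)\<^sup>2)) = c * (\<Sum>k=K+1..M. 1 / (real k)\<^sup>2)"
    unfolding P_def sum_distrib_left by (subst sum.reindex) (auto simp: inj_on_def)
  also have "(norm (coef q H 0))\<^sup>2 \<le> H / real q"
    using norm_coef_le[of H q 0] H q0 by (metis less_imp_le norm_ge_zero order_trans power_mono
        real_sqrt_pow2 divide_nonneg_nonneg of_nat_0_le_iff zero_less_one)
  finally have le: "(\<Sum>k\<in>symres q - nzbox K. (norm (coef q H k))\<^sup>2) \<le> H / real q + 2 * c * (\<Sum>k=K+1..M. 1 / (real k)\<^sup>2)"
    by simp
  have "2 * c * (\<Sum>k=K+1..M. 1 / (real k)\<^sup>2) \<le> 1 / real r"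
  proof (cases "K = M")
    case False
    then have "K = nat \<lfloor>real r * (real q / H)\<rfloor>" by (auto simp: K_def cutoff_def M_def)
    then have K: "real (K + 1) \<ge> real r * (real q / H)" using H by linarith
    have pos: "real r * (real q / H) > 0" using H r q0 by simp
    have "2 * c * (\<Sum>k=K+1..M. 1 / (real k)\<^sup>2) \<le> 2 * c * (2 / real (K + 1))"
      using c0 by (intro mult_left_mono sum_inverse_squares_le) auto
    also have "\<dots> = (real q / H) / real (K + 1)" by (simp add: c_def)
    also have "\<dots> \<le> (real q / H) / (real r * (real q / H))"
      using K pos H r by (intro divide_left_mono mult_pos_pos) auto
    also have "\<dots> = 1 / real r" using H q0 by simp
    finally show ?thesis .
  qed simp
  then show ?thesis using le by (simp add: K_def)
qed

section \<open>Mean square comparison of the character sum with its truncation\<close>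

context nonprincipal_character
begin

definition phase where "phase = gauss / of_real (sqrt (real q))"

lemma norm_phase: "norm phase = 1"
proof -
  have "norm gauss = sqrt (real q)" using norm_gauss real_sqrt_unique[of "norm gauss" "real q"] by simp
  then show ?thesis using q_pos by (simp add: phase_def norm_divide)
qed

lemma char_sum_normalized:
  assumes "odd q" "H > 0"
  shows "char_sum chi H x / of_real (sqrt H) =
    phase * (\<Sum>k\<in>symres q. cnj (chi k) * coef q H k * ee q (- (k * x)))"
proof -
  have "of_nat q = complex_of_real (sqrt (real q)) * of_real (sqrt (real q))"
    by (simp flip: of_real_mult)
  then show ?thesis
    unfolding char_sum_expansion[OF assms(1) less_imp_le[OF assms(2)]]
    by (simp add: phase_def coef_def real_sqrt_mult sum_divide_distrib[symmetric] sum_distrib_left mult_ac)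
qed

lemma norm_chi_le: "norm (chi n) \<le> 1"
  using norm_chi_nz[of n] chi_eq_0_iff[of n] by (cases "int q dvd n") auto

lemma mean_norm_partial_le:
  assumes "odd q" "B \<subseteq> symres q"
  shows "mean {0..<int q} (\<lambda>x. (norm (phase * (\<Sum>k\<in>B. cnj (chi k) * \<alpha> k * ee q (- (k * x)))))\<^sup>2) \<le>
    (\<Sum>k\<in>B. (norm (\<alpha> k))\<^sup>2)"
proof -
  have rs: "residues_system q {0..<int q}" using residues_system_interval[OF q_pos, of 0] by simp
  have fB: "finite B" using assms(2) by (rule finite_subset) (simp add: symres_def)
  have "(\<Sum>x\<in>{0..<int q}. (cmod (\<Sum>k\<in>B. (cnj (chi k) * \<alpha> k) * ee q (- (k * x))))\<^sup>2) =
     real q * (\<Sum>k\<in>B. (cmod (cnj (chi k) * \<alpha> k))\<^sup>2)"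
    using symres_system[OF assms(1)] assms(2)
    by (intro parseval[OF rs q_pos fB]) (auto simp: residues_system_def)
  then have "mean {0..<int q} (\<lambda>x. (norm (phase * (\<Sum>k\<in>B. cnj (chi k) * \<alpha> k * ee q (- (k * x)))))\<^sup>2) =
     (\<Sum>k\<in>B. (cmod (cnj (chi k) * \<alpha> k))\<^sup>2)"
    using q_pos by (simp add: mean_def norm_mult norm_phase)
  also have "\<dots> \<le> (\<Sum>k\<in>B. (norm (\<alpha> k))\<^sup>2)"
    using norm_chi_le by (intro sum_mono power_mono) (auto simp: norm_mult intro: mult_left_le_one_le)
  finally show ?thesis .
qed

text \<open>This second moment bound is the source of tightness.\<close>

lemma mean_char_sum_square_le:
  assumes "odd q" "1 \<le> H" "H \<le> real q"
  shows "mean {0..<int q} (\<lambda>x. (norm (char_sum chi H x / of_real (sqrt H)))\<^sup>2) \<le> 1"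
proof -
  have "mean {0..<int q} (\<lambda>x. (norm (char_sum chi H x / of_real (sqrt H)))\<^sup>2) \<le> (\<Sum>k\<in>symres q. (norm (coef q H k))\<^sup>2)"
    using mean_norm_partial_le[OF assms(1) subset_refl, of "coef q H"] char_sum_normalized[OF assms(1), of H] assms
    by simp
  also have "\<dots> \<le> 1" unfolding sum_norm_coef[OF assms] using assms by (simp add: divide_le_eq)
  finally show ?thesis .
qed

lemma mean_char_sum_tpoly_le:
  assumes "odd q" "1 \<le> H" "H \<le> real q" "r \<ge> 1"
  shows "mean {0..<int q} (\<lambda>x. (norm (char_sum chi H x / of_real (sqrt H) -
      phase * tpoly q (coef q H) (cutoff r q H) chi x))\<^sup>2) \<le> H / real q + 1 / real r"
proof -
  define B where "B = symres q - nzbox (cutoff r q H)"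
  have "finite (symres q)" by (simp add: symres_def)
  then have "(\<Sum>k\<in>symres q. cnj (chi k) * coef q H k * ee q (- (k * x))) =
     (\<Sum>k\<in>B. cnj (chi k) * coef q H k * ee q (- (k * x))) + tpoly q (coef q H) (cutoff r q H) chi x" for x
    unfolding B_def tpoly_def using nzbox_cutoff_subset by (rule sum.subset_diff[rotated])
  then have "char_sum chi H x / of_real (sqrt H) - phase * tpoly q (coef q H) (cutoff r q H) chi x =
      phase * (\<Sum>k\<in>B. cnj (chi k) * coef q H k * ee q (- (k * x)))" for x
    using char_sum_normalized[OF assms(1), of H x] assms by (simp add: ring_distribs)
  then have "mean {0..<int q} (\<lambda>x. (norm (char_sum chi H x / of_real (sqrt H) -
      phase * tpoly q (coef q H) (cutoff r q H) chi x))\<^sup>2) \<le> (\<Sum>k\<in>B. (norm (coef q H k))\<^sup>2)"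
    using mean_norm_partial_le[OF assms(1), of B "coef q H"] by (simp add: B_def)
  also have "\<dots> \<le> H / real q + 1 / real r"
    unfolding B_def by (rule tail_coef_le[OF assms])
  finally show ?thesis .
qed

end

text \<open>Take for \<open>\<rho> q\<close> the largest admissible \<open>r \<le> q\<close>. The
  restriction \<open>r \<le> q\<close> makes the set finite and is eventually met by each fixed
  \<open>r\<close>; \<open>P 0\<close> makes it nonempty for every \<open>q\<close>, not just
  eventually.\<close>

lemma diagonal_sequence:
  assumes P0: "\<And>q. P 0 q" and ev: "\<And>r. \<forall>\<^sub>F q in F. P r q" and F: "F \<le> (at_top :: nat filter)"
  shows "\<exists>\<rho> :: nat \<Rightarrow> nat. (\<forall>q. P (\<rho> q) q) \<and> filterlim \<rho> at_top F"
proof -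
  define \<rho> where "\<rho> q = Max {r. r \<le> q \<and> P r q}" for q :: nat
  have fin: "finite {r. r \<le> q \<and> P r q}" for q by simp
  have "\<rho> q \<in> {r. r \<le> q \<and> P r q}" for q
    unfolding \<rho>_def using P0[of q] by (intro Max_in fin) auto
  then have "P (\<rho> q) q" for q by simp
  moreover have "filterlim \<rho> at_top F"
    unfolding filterlim_at_top
  proof
    fix r :: nat
    have "\<forall>\<^sub>F q in F. r \<le> q" using F eventually_ge_at_top[of r] by (rule filter_leD)
    with ev[of r] show "\<forall>\<^sub>F q in F. r \<le> \<rho> q"
      by eventually_elim (auto simp: \<rho>_def intro!: Max_ge fin)
  qed
  ultimately show ?thesis by blast
qed

text \<open>The hypothesis on \<open>m\<close> is approximate Gaussian integration by parts, as in Stein's method.\<close>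

lemma moments_of_recursion:
  fixes m :: "nat \<Rightarrow> nat \<Rightarrow> 'i \<Rightarrow> complex"
  assumes rec: "\<And>a b. b > 0 \<Longrightarrow> ((\<lambda>i. m a b i - of_nat a * \<sigma> i * m (a - 1) (b - 1) i) \<longlongrightarrow> 0) F"
    and \<sigma>: "(\<sigma> \<longlongrightarrow> 1) F" and m00: "((\<lambda>i. m 0 0 i) \<longlongrightarrow> 1) F"
    and sym: "\<And>a b i. m a b i = cnj (m b a i)"
  shows "((\<lambda>i. m a b i) \<longlongrightarrow> (if a = b then fact a else 0)) F"
proof (induction b arbitrary: a)
  case 0
  show ?case
  proof (cases "a = 0")
    case False
    \<comment> \<open>Symmetry exchanges the orders, and the recursion for \<open>m 0 a\<close> has
      no second term, its factor \<open>of_nat 0\<close> being zero.\<close>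
    then have "((\<lambda>i. cnj (m 0 a i)) \<longlongrightarrow> cnj 0) F"
      using rec[of a 0] by (intro tendsto_cnj) simp
    then show ?thesis using False by (simp flip: sym)
  qed (use m00 in simp)
next
  case (Suc b)
  show ?case
  proof (cases a)
    case 0
    then show ?thesis using rec[of "Suc b" 0] by simp
  next
    case (Suc a')
    have "((\<lambda>i. (m a (Suc b) i - of_nat a * \<sigma> i * m (a - 1) (Suc b - 1) i) + of_nat a * \<sigma> i * m a' b i) \<longlongrightarrow>
        0 + of_nat a * 1 * (if a' = b then fact a' else 0)) F"
      by (intro tendsto_intros rec \<sigma> Suc.IH) simp
    then show ?thesis using Suc by (simp split: if_splits)
  qed
qed

lemma norm_cis_diff_le: "norm (cis a - cis b) \<le> \<bar>a - b\<bar>"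
proof -
  have "cis a - cis b = cis b * (cis (a - b) - 1)" by (simp add: right_diff_distrib cis_mult)
  then have "norm (cis a - cis b) = norm (iexp (a - b) - 1)" by (simp add: norm_mult cis_conv_exp)
  then show ?thesis using iexp_approx1[of "a - b" 0] by simp
qed

text \<open>\<open>cis\<close> is Lipschitz and Cauchy-Schwarz passes to the mean square, so an
  error small in mean square hardly changes the characteristic function.\<close>

lemma mean_cis_diff_le:
  "norm (mean A (\<lambda>x. cis (Re (cnj w * f x))) - mean A (\<lambda>x. cis (Re (cnj w * g x)))) \<le>
    norm w * sqrt (mean A (\<lambda>x. (norm (f x - g x))\<^sup>2))"
proof -
  have "norm (mean A (\<lambda>x. cis (Re (cnj w * f x))) - mean A (\<lambda>x. cis (Re (cnj w * g x)))) \<le>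
     mean A (\<lambda>x. norm (cis (Re (cnj w * f x)) - cis (Re (cnj w * g x))))"
    using norm_mean_le[of A "\<lambda>x. cis (Re (cnj w * f x)) - cis (Re (cnj w * g x))"] by (simp only: mean_diff)
  also have "\<dots> \<le> mean A (\<lambda>x. norm w * norm (f x - g x))"
  proof (rule mean_mono)
    fix x
    have "norm (cis (Re (cnj w * f x)) - cis (Re (cnj w * g x))) \<le> \<bar>Re (cnj w * f x) - Re (cnj w * g x)\<bar>"
      by (rule norm_cis_diff_le)
    also have "\<dots> = \<bar>Re (cnj w * (f x - g x))\<bar>" by (simp add: algebra_simps)
    also have "\<dots> \<le> norm (cnj w * (f x - g x))" by (rule abs_Re_le_cmod)
    finally show "norm (cis (Re (cnj w * f x)) - cis (Re (cnj w * g x))) \<le> norm w * norm (f x - g x)"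
      by (simp add: norm_mult)
  qed
  also have "\<dots> = norm w * mean A (\<lambda>x. norm (f x - g x))" by (rule mean_cmult)
  also have "\<dots> \<le> norm w * sqrt (mean A (\<lambda>x. (norm (f x - g x))\<^sup>2))"
    by (intro mult_left_mono real_le_rsqrt mean_power2_le) simp
  finally show ?thesis .
qed

section \<open>Exceptional characters\<close>

definition defect :: "nat \<Rightarrow> real \<Rightarrow> nat \<Rightarrow> (int \<Rightarrow> complex) \<Rightarrow> nat \<Rightarrow> nat \<Rightarrow> complex" where
  "defect q H r chi a b = moment q (coef q H) (cutoff r q H) chi a b -
     of_nat a * of_real (\<Sum>k\<in>nzbox (cutoff r q H). (cmod (coef q H k))\<^sup>2) *
     moment q (coef q H) (cutoff r q H) chi (a - 1) (b - 1)"

text \<open>One parameter \<open>r\<close> governs the cutoff, the orders of the moments under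
  control and the tolerance. For \<open>r = 0\<close> the range of \<open>b\<close> is empty, hence
  so is \<open>bad\<close>; this starts the diagonal choice.\<close>

definition bad :: "nat \<Rightarrow> nat \<Rightarrow> real \<Rightarrow> nat set" where
  "bad r q H = {j \<in> {..<q - 1}. \<exists>a\<le>r. \<exists>b\<in>{1..r}. norm (defect q H r (dchar q j) a b) > 1 / (real r + 1)}"

text \<open>Markov's inequality for the squared defect at the threshold \<open>1 / (r + 1)\<close>,
  with a union bound over the pairs \<open>(a, b)\<close>.\<close>

lemma card_bad_le:
  "real (card (bad r q H)) \<le> (\<Sum>(a, b)\<in>{..r} \<times> {1..r}.
     (real r + 1)\<^sup>2 * (\<Sum>j<q - 1. (norm (defect q H r (dchar q j) a b))\<^sup>2))"
proof -
  define E where "E = (\<lambda>(a, b). {j \<in> {..<q - 1}. norm (defect q H r (dchar q j) a b) > 1 / (real r + 1)})"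
  have "bad r q H \<subseteq> (\<Union>p\<in>{..r} \<times> {1..r}. E p)"
    by (auto simp: bad_def E_def)
  then have "card (bad r q H) \<le> card (\<Union>p\<in>{..r} \<times> {1..r}. E p)"
    by (intro card_mono) (auto simp: E_def)
  also have "\<dots> \<le> (\<Sum>p\<in>{..r} \<times> {1..r}. card (E p))" by (rule card_UN_le) simp
  finally have "real (card (bad r q H)) \<le> (\<Sum>p\<in>{..r} \<times> {1..r}. real (card (E p)))"
    by (metis of_nat_le_iff of_nat_sum)
  also have "\<dots> \<le> (\<Sum>(a, b)\<in>{..r} \<times> {1..r}.
     (real r + 1)\<^sup>2 * (\<Sum>j<q - 1. (norm (defect q H r (dchar q j) a b))\<^sup>2))"
  proof (intro sum_mono)
    fix p assume "p \<in> {..r} \<times> {1..r}"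
    obtain a b where p: "p = (a, b)" by (cases p)
    have "real (card (E p)) = (\<Sum>j\<in>E p. 1)" by simp
    also have "\<dots> \<le> (\<Sum>j\<in>E p. (real r + 1)\<^sup>2 * (norm (defect q H r (dchar q j) a b))\<^sup>2)"
    proof (rule sum_mono)
      fix j assume "j \<in> E p"
      then have "1 \<le> (real r + 1) * norm (defect q H r (dchar q j) a b)"
        by (simp add: E_def p field_simps)
      then have "1\<^sup>2 \<le> ((real r + 1) * norm (defect q H r (dchar q j) a b))\<^sup>2"
        by (rule power_mono) simp
      then show "1 \<le> (real r + 1)\<^sup>2 * (norm (defect q H r (dchar q j) a b))\<^sup>2"
        by (simp add: power_mult_distrib)
    qed
    also have "\<dots> \<le> (\<Sum>j<q - 1. (real r + 1)\<^sup>2 * (norm (defect q H r (dchar q j) a b))\<^sup>2)"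
      by (intro sum_mono2) (auto simp: E_def p)
    finally show "real (card (E p)) \<le> (case p of (a, b) \<Rightarrow>
       (real r + 1)\<^sup>2 * (\<Sum>j<q - 1. (norm (defect q H r (dchar q j) a b))\<^sup>2))"
      by (simp add: p sum_distrib_left)
  qed
  finally show ?thesis .
qed

section \<open>Growth along the primes and the number of exceptional characters\<close>

lemma eventually_prime: "\<forall>\<^sub>F q in primes_at_top. prime q"
  by (simp add: primes_at_top_def eventually_inf_principal)

lemma primes_at_top_le: "primes_at_top \<le> at_top"
  by (simp add: primes_at_top_def)

lemma eventually_primes_ge: "\<forall>\<^sub>F q in primes_at_top. q \<ge> (c :: nat)"
  by (rule filter_leD[OF primes_at_top_le eventually_ge_at_top])

lemma powr_exp_ln_tendsto_0:
  assumes "c > 0"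
  shows "((\<lambda>x::real. x powr (- c) * exp (ln x powr (3 / 4))) \<longlongrightarrow> 0) at_top"
  using assms by real_asymp

locale interval_length =
  fixes H :: "nat \<Rightarrow> real"
  assumes H_range: "\<And>q. prime q \<Longrightarrow> 1 \<le> H q \<and> H q \<le> real q"
    and H_log: "((\<lambda>q. ln (real q / H q) / ln (real q)) \<longlongrightarrow> 0) primes_at_top"
    and H_small: "H \<in> o[primes_at_top](\<lambda>q. real q)"
begin

lemma H_ratio_tendsto_0: "((\<lambda>q. H q / real q) \<longlongrightarrow> 0) primes_at_top"
  using smalloD_tendsto[OF H_small] .

lemma ratio_at_top: "filterlim (\<lambda>q. real q / H q) at_top primes_at_top"
proof -
  have "\<forall>\<^sub>F q in primes_at_top. H q / real q > 0"
    using eventually_prime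
  proof eventually_elim
    case (elim q)
    then show ?case using H_range[OF elim] prime_gt_0_nat[OF elim] by simp
  qed
  then have "filterlim (\<lambda>q. inverse (H q / real q)) at_top primes_at_top"
    by (rule filterlim_inverse_at_top[OF H_ratio_tendsto_0])
  then show ?thesis by simp
qed

text \<open>The logarithmic hypothesis gives \<open>N ^ (m + 1) < q\<close> for
  \<open>N = q / H\<close>, and the spare factor \<open>N\<close> eventually exceeds
  \<open>C\<close>.\<close>

lemma ratio_power_less: "\<forall>\<^sub>F q in primes_at_top. C * (real q / H q) ^ m < real q"
proof -
  have "\<forall>\<^sub>F q in primes_at_top. ln (real q / H q) / ln (real q) < 1 / real (m + 1)"
    by (rule order_tendstoD[OF H_log]) simp
  moreover have "\<forall>\<^sub>F q in primes_at_top. real q / H q > max C 1"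
    using ratio_at_top by (simp only: filterlim_at_top_dense)
  ultimately show ?thesis using eventually_prime
  proof eventually_elim
    case (elim q)
    define N where "N = real q / H q"
    have q: "real q > 1" using prime_gt_1_nat[OF elim(3)] by simp
    have N: "N > C" "N > 1" using elim(2) by (simp_all add: N_def)
    have "real (m + 1) * ln N < ln (real q)"
      using elim(1) q by (simp add: N_def[symmetric] field_simps)
    then have "ln (N ^ (m + 1)) \<le> ln (real q)"
      using N(2) by (subst ln_realpow) auto
    then have "N ^ (m + 1) \<le> real q" using N(2) q by (subst (asm) ln_le_cancel_iff) auto
    moreover have "C * N ^ m < N * N ^ m" using N by (intro mult_strict_right_mono) auto
    ultimately show ?case by (simp add: N_def)
  qed
qed

lemma H_at_top: "filterlim H at_top primes_at_top"
  unfolding filterlim_at_top_dense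
proof
  fix C
  show "\<forall>\<^sub>F q in primes_at_top. C < H q"
    \<comment> \<open>\<open>C * (q / H) < q\<close> is the same as \<open>C < H\<close>.\<close>
    using ratio_power_less[of C 1] eventually_prime
  proof eventually_elim
    case (elim q)
    then show ?case using H_range[OF elim(2)] prime_gt_0_nat[OF elim(2)] by (simp add: field_simps)
  qed
qed

text \<open>For fixed \<open>r\<close> and \<open>J = a + b\<close>, the coefficients contribute
  \<open>N powr (- J)\<close> and the count of unmatched pairs, with \<open>K \<le> r * N\<close>,
  at most a constant times \<open>N powr (J - c)\<close>. The resulting
  \<open>q * N powr (- c)\<close> eventually beats the required bound, whatever the constants
  depending on \<open>r\<close>.\<close>

lemma eventually_card_bad_le:
  "\<forall>\<^sub>F q in primes_at_top. real (card (bad r q (H q))) \<le> real q * exp (- (ln (real q / H q) powr (3 / 4)))"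
proof (cases "r = 0")
  case True
  then show ?thesis by (simp add: bad_def)
next
  case False
  then have r: "r \<ge> 1" by simp
  \<comment> \<open>The number of pairs \<open>(a, b)\<close>; each pair is allotted an equal share
    of the bound.\<close>
  define n where "n = real ((r + 1) * r)"
  have n: "n > 0" unfolding n_def of_nat_0_less_iff using r by simp
  have single: "\<forall>\<^sub>F q in primes_at_top. (real r + 1)\<^sup>2 * (\<Sum>j<q - 1. (norm (defect q (H q) r (dchar q j) a b))\<^sup>2)
      \<le> real q * exp (- (ln (real q / H q) powr (3 / 4))) / n" if ab: "a \<le> r" "b \<in> {1..r}" for a b
  proof -
    have b: "b > 0" using ab by simp
    define J where "J = a + b"
    define c where "c = 1 / (4 * real J)"
    have J: "J \<ge> 1" "J \<le> 2 * r" using ab by (auto simp: J_def)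
    have c: "c > 0" "real J - c \<ge> 0"
    proof -
      show "c > 0" using J by (simp add: c_def)
      have "c \<le> 1" using J by (simp add: c_def)
      then show "real J - c \<ge> 0" using J by linarith
    qed
    obtain C where C: "C > 0" "\<And>K. K \<ge> 1 \<Longrightarrow> real (card (unmatched a b K)) \<le> C * real K powr (real J - c)"
      using card_unmatched_le[OF b, of a] unfolding J_def c_def by blast
    define D where "D = (real r + 1)\<^sup>2 * (real a + 1)\<^sup>2 * C * real r powr (real J - c)"
    have D: "D > 0" using C(1) r by (simp add: D_def)
    have "((\<lambda>q. D * n * ((real q / H q) powr (- c) * exp (ln (real q / H q) powr (3 / 4)))) \<longlongrightarrow> D * n * 0) primes_at_top"
      by (intro tendsto_intros filterlim_compose[OF powr_exp_ln_tendsto_0[OF c(1)] ratio_at_top])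
    then have "\<forall>\<^sub>F q in primes_at_top. D * n * ((real q / H q) powr (- c) * exp (ln (real q / H q) powr (3 / 4))) < 1"
      by (rule order_tendstoD) simp
    moreover have "\<forall>\<^sub>F q in primes_at_top. real q / H q > 1"
      using ratio_at_top by (simp only: filterlim_at_top_dense)
    \<comment> \<open>With \<open>K \<le> r * N\<close> this yields
      \<open>2 * r * K ^ (2 * r) < q\<close>, which covers both size conditions of
      \<open>variance_bound\<close> because \<open>a + b \<le> 2 * r\<close>.\<close>
    moreover have "\<forall>\<^sub>F q in primes_at_top. (2 * real r * real r ^ (2 * r)) * (real q / H q) ^ (2 * r) < real q"
      by (rule ratio_power_less)
    ultimately show ?thesis using eventually_prime eventually_primes_ge[of 3]
    proof eventually_elim
      case (elim q)
      define N where "N = real q / H q"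
      define K where "K = cutoff r q (H q)"
      have Hq: "1 \<le> H q" "H q \<le> real q" using H_range[OF elim(4)] by auto
      have N: "N > 1" using elim(2) by (simp add: N_def)
      have K1: "K \<ge> 1"
      proof -
        have "1 * 1 \<le> real r * N" using r N by (intro mult_mono) auto
        then have "1 \<le> \<lfloor>real r * N\<rfloor>" by simp
        \<comment> \<open>\<open>q \<ge> 3\<close> makes the cap \<open>(q - 1) div 2\<close> at
          least 1.\<close>
        then show ?thesis using elim(5) by (simp add: K_def cutoff_def N_def[symmetric] nat_le_eq_zle) linarith
      qed
      have KN: "real K \<le> real r * N"
      proof -
        have "K \<le> nat \<lfloor>real r * N\<rfloor>" by (simp add: K_def cutoff_def N_def)
        then have "real K \<le> real (nat \<lfloor>real r * N\<rfloor>)" by simp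
        also have "\<dots> \<le> real r * N" using N by (intro of_nat_floor) simp
        finally show ?thesis .
      qed
      have "2 * r * K ^ (2 * r) < q"
      proof -
        have "real K ^ (2 * r) \<le> (real r * N) ^ (2 * r)" using KN by (intro power_mono) auto
        then have "2 * real r * real K ^ (2 * r) \<le> 2 * real r * (real r * N) ^ (2 * r)" by (intro mult_left_mono) auto
        also have "\<dots> < real q" using elim(3) by (simp only: N_def[symmetric] power_mult_distrib mult_ac)
        finally have "real (2 * r * K ^ (2 * r)) < real q" by simp
        then show ?thesis by (simp only: of_nat_less_iff)
      qed
      moreover have "2 * K ^ (a + b) \<le> 2 * r * K ^ (2 * r)"
        using r J K1 by (intro mult_mono power_increasing) (auto simp: J_def)
      moreover have "(a + b) * K \<le> 2 * r * K ^ (2 * r)"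
        using r J K1 self_le_power[of K "2 * r"] by (intro mult_mono) (auto simp: J_def)
      ultimately have cond: "(a + b) * K < q" "2 * K ^ (a + b) < q" by linarith+
      have "(\<Sum>j<q - 1. (norm (defect q (H q) r (dchar q j) a b))\<^sup>2) \<le>
          real q * (real a + 1)\<^sup>2 * sqrt (H q / real q) ^ (2 * (a + b)) * real (card (unmatched a b K))"
        unfolding defect_def K_def[symmetric]
        using Hq prime_gt_0_nat[OF elim(4)]
        by (intro variance_bound[OF elim(4) K1 cond b] norm_coef_le) auto
      also have "sqrt (H q / real q) ^ (2 * (a + b)) = N powr (- real J)"
      proof -
        have "sqrt (H q / real q) ^ (2 * J) = ((sqrt (H q / real q))\<^sup>2) ^ J" by (rule power_mult)
        also have "(sqrt (H q / real q))\<^sup>2 = inverse N" using Hq by (simp add: N_def)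
        also have "inverse N ^ J = N powr (- real J)" using N by (simp add: powr_minus powr_realpow power_inverse)
        finally show ?thesis by (simp only: J_def)
      qed
      also have "real q * (real a + 1)\<^sup>2 * N powr (- real J) * real (card (unmatched a b K)) \<le>
          real q * (real a + 1)\<^sup>2 * N powr (- real J) * (C * (real r powr (real J - c) * N powr (real J - c)))"
      proof (intro mult_left_mono)
        have "real (card (unmatched a b K)) \<le> C * real K powr (real J - c)" using C(2) K1 by blast
        also have "\<dots> \<le> C * (real r * N) powr (real J - c)"
          using C(1) KN c(2) by (intro mult_left_mono powr_mono2) auto
        finally show "real (card (unmatched a b K)) \<le> C * (real r powr (real J - c) * N powr (real J - c))"
          using N by (simp add: powr_mult)
      qed auto
      also have "\<dots> = real q * ((real a + 1)\<^sup>2 * C * real r powr (real J - c)) * (N powr (- real J) * N powr (real J - c))"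
        by (simp only: mult_ac)
      also have "N powr (- real J) * N powr (real J - c) = N powr (- c)"
        by (simp flip: powr_add)
      finally have "(real r + 1)\<^sup>2 * (\<Sum>j<q - 1. (norm (defect q (H q) r (dchar q j) a b))\<^sup>2) \<le>
         (real r + 1)\<^sup>2 * (real q * ((real a + 1)\<^sup>2 * C * real r powr (real J - c)) * N powr (- c))"
        by (intro mult_left_mono) auto
      also have "\<dots> = real q * (D * N powr (- c))" by (simp only: D_def mult_ac)
      also have "\<dots> \<le> real q * (exp (- (ln N powr (3 / 4))) / n)"
      proof (intro mult_left_mono)
        have "(D * N powr (- c)) * (n * exp (ln N powr (3 / 4))) \<le> 1"
          using elim(1) by (simp add: N_def mult_ac)
        then show "D * N powr (- c) \<le> exp (- (ln N powr (3 / 4))) / n"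
          using n by (simp add: exp_minus field_simps)
      qed simp
      finally show ?case by (simp add: N_def)
    qed
  qed
  have "\<forall>\<^sub>F q in primes_at_top. \<forall>p\<in>{..r} \<times> {1..r}. (case p of (a, b) \<Rightarrow> (real r + 1)\<^sup>2 *
      (\<Sum>j<q - 1. (norm (defect q (H q) r (dchar q j) a b))\<^sup>2)) \<le> real q * exp (- (ln (real q / H q) powr (3 / 4))) / n"
    using single by (intro eventually_ball_finite) auto
  then show ?thesis
  proof eventually_elim
    case (elim q)
    have "real (card (bad r q (H q))) \<le> (\<Sum>(a, b)\<in>{..r} \<times> {1..r}.
       (real r + 1)\<^sup>2 * (\<Sum>j<q - 1. (norm (defect q (H q) r (dchar q j) a b))\<^sup>2))"
      by (rule card_bad_le)
    also have "\<dots> \<le> of_nat (card ({..r} \<times> {1..r})) * (real q * exp (- (ln (real q / H q) powr (3 / 4))) / n)"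
      using elim by (intro sum_bounded_above) auto
    also have "of_nat (card ({..r} \<times> {1..r})) = n" by (simp add: n_def card_cartesian_product algebra_simps)
    finally show ?case using n by simp
  qed
qed

end

section \<open>The limit theorem\<close>

lemma nonprincipal_character_dchar:
  assumes "prime q" "0 < j" "j < q - 1"
  shows "nonprincipal_character q (dchar q j)"
proof
  show "\<exists>n. coprime n (int q) \<and> dchar q j n \<noteq> 1"
    using coprime_proot[OF assms(1)] dchar_proot_neq_1[OF assms] by blast
qed (use assms norm_dchar dirichlet_character_dchar in auto)

text \<open>The total over \<open>symres q\<close> is \<open>floor H / H\<close>, which tends to 1
  since \<open>H\<close> tends to infinity, and the part cut off vanishes as \<open>\<rho>\<close>
  grows.\<close>

lemma (in interval_length) sum_coef_cutoff_tendsto: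
  assumes \<rho>: "filterlim \<rho> at_top primes_at_top"
  shows "((\<lambda>q. \<Sum>k\<in>nzbox (cutoff (\<rho> q) q (H q)). (cmod (coef q (H q) k))\<^sup>2) \<longlongrightarrow> 1) primes_at_top"
proof (rule tendsto_sandwich)
  have inv: "((\<lambda>q. 1 / real (\<rho> q)) \<longlongrightarrow> 0) primes_at_top"
    by (intro tendsto_divide_0[OF tendsto_const] filterlim_at_top_imp_at_infinity
        filterlim_compose[OF filterlim_real_sequentially \<rho>])
  have invH: "((\<lambda>q. 1 / H q) \<longlongrightarrow> 0) primes_at_top"
    by (intro tendsto_divide_0[OF tendsto_const] filterlim_at_top_imp_at_infinity H_at_top)
  have "((\<lambda>q. (1 - 1 / H q) - (H q / real q + 1 / real (\<rho> q))) \<longlongrightarrow> (1 - 0) - (0 + 0)) primes_at_top"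
    by (intro tendsto_intros inv invH H_ratio_tendsto_0)
  then show "((\<lambda>q. (1 - 1 / H q) - (H q / real q + 1 / real (\<rho> q))) \<longlongrightarrow> 1) primes_at_top" by simp
  have ev: "\<forall>\<^sub>F q in primes_at_top. \<rho> q \<ge> 1" using \<rho> by (simp only: filterlim_at_top)
  show "\<forall>\<^sub>F q in primes_at_top. (1 - 1 / H q) - (H q / real q + 1 / real (\<rho> q)) \<le>
      (\<Sum>k\<in>nzbox (cutoff (\<rho> q) q (H q)). (cmod (coef q (H q) k))\<^sup>2)"
    using ev eventually_prime eventually_primes_ge[of 3]
  proof eventually_elim
    case (elim q)
    have q: "odd q" using elim(2,3) prime_odd_nat[of q] by simp
    note Hq = H_range[OF elim(2)]
    have "(\<Sum>k\<in>symres q. (cmod (coef q (H q) k))\<^sup>2) =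
      (\<Sum>k\<in>symres q - nzbox (cutoff (\<rho> q) q (H q)). (cmod (coef q (H q) k))\<^sup>2) +
      (\<Sum>k\<in>nzbox (cutoff (\<rho> q) q (H q)). (cmod (coef q (H q) k))\<^sup>2)"
      by (rule sum.subset_diff[OF nzbox_cutoff_subset]) (simp add: symres_def)
    moreover have "(\<Sum>k\<in>symres q - nzbox (cutoff (\<rho> q) q (H q)). (cmod (coef q (H q) k))\<^sup>2) \<le> H q / real q + 1 / real (\<rho> q)"
      using q Hq elim(1) by (intro tail_coef_le) auto
    moreover have "1 - 1 / H q \<le> real (nat \<lfloor>H q\<rfloor>) / H q"
    proof -
      have "(H q - 1) / H q \<le> real (nat \<lfloor>H q\<rfloor>) / H q"
        using Hq by (intro divide_right_mono) linarith+
      then show ?thesis using Hq by (simp add: diff_divide_distrib)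
    qed
    ultimately show ?case using sum_norm_coef[OF q, of "H q"] Hq by simp
  qed
  show "\<forall>\<^sub>F q in primes_at_top. (\<Sum>k\<in>nzbox (cutoff (\<rho> q) q (H q)). (cmod (coef q (H q) k))\<^sup>2) \<le> 1"
    using eventually_prime eventually_primes_ge[of 3]
  proof eventually_elim
    case (elim q)
    have q: "odd q" using elim prime_odd_nat[of q] by simp
    note Hq = H_range[OF elim(1)]
    have "(\<Sum>k\<in>nzbox (cutoff (\<rho> q) q (H q)). (cmod (coef q (H q) k))\<^sup>2) \<le> (\<Sum>k\<in>symres q. (cmod (coef q (H q) k))\<^sup>2)"
      by (intro sum_mono2 nzbox_cutoff_subset) (auto simp: symres_def)
    also have "\<dots> \<le> 1" using sum_norm_coef[OF q, of "H q"] Hq by (simp add: divide_le_eq)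
    finally show ?case .
  qed
qed (rule tendsto_const)

lemma (in interval_length) char_sum_char_tendsto:
  fixes chi :: "nat \<Rightarrow> int \<Rightarrow> complex"
  assumes \<rho>: "filterlim \<rho> at_top primes_at_top"
    and chi: "\<forall>\<^sub>F q in primes_at_top. chi q \<in> dchar q ` ({1..<q - 1} - bad (\<rho> q) q (H q))"
  shows "((\<lambda>q. mean {0..<int q} (\<lambda>x. cis (Re (cnj w * (char_sum (chi q) (H q) x / of_real (sqrt (H q))))))) \<longlongrightarrow>
    of_real (exp (- (cmod w)\<^sup>2 / 4))) primes_at_top"
proof -
  define T where "T q = tpoly q (coef q (H q)) (cutoff (\<rho> q) q (H q)) (chi q)" for q
  define u where "u q = nonprincipal_character.phase q (chi q)" for q
  define m where "m a b q = moment q (coef q (H q)) (cutoff (\<rho> q) q (H q)) (chi q) a b" for a b q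
  define S where "S q x = char_sum (chi q) (H q) x / complex_of_real (sqrt (H q))" for q x
  have \<rho>1: "\<forall>\<^sub>F q in primes_at_top. \<rho> q \<ge> c" for c using \<rho> by (simp only: filterlim_at_top)
  have inv: "((\<lambda>q. 1 / real (\<rho> q)) \<longlongrightarrow> 0) primes_at_top"
    by (intro tendsto_divide_0[OF tendsto_const] filterlim_at_top_imp_at_infinity
        filterlim_compose[OF filterlim_real_sequentially \<rho>])
  have np: "\<forall>\<^sub>F q in primes_at_top. nonprincipal_character q (chi q)"
    using chi eventually_prime
  proof eventually_elim
    case (elim q)
    then obtain j where "chi q = dchar q j" "0 < j" "j < q - 1" by auto
    then show ?case using nonprincipal_character_dchar[OF elim(2)] by simp
  qed
  have rec: "((\<lambda>q. m a b q - of_nat a * of_real (\<Sum>k\<in>nzbox (cutoff (\<rho> q) q (H q)). (cmod (coef q (H q) k))\<^sup>2) *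
      m (a - 1) (b - 1) q) \<longlongrightarrow> 0) primes_at_top" if b: "b > 0" for a b
  proof (rule Lim_null_comparison[OF _ inv])
    show "\<forall>\<^sub>F q in primes_at_top. norm (m a b q - of_nat a *
        of_real (\<Sum>k\<in>nzbox (cutoff (\<rho> q) q (H q)). (cmod (coef q (H q) k))\<^sup>2) * m (a - 1) (b - 1) q) \<le> 1 / real (\<rho> q)"
      \<comment> \<open>Once \<open>\<rho> q \<ge> a + b\<close>, the pair \<open>(a, b)\<close> is
        among those controlled by \<open>bad\<close>.\<close>
      using chi \<rho>1[of "a + b"]
    proof eventually_elim
      case (elim q)
      then obtain j where j: "chi q = dchar q j" "j \<in> {1..<q - 1}" "j \<notin> bad (\<rho> q) q (H q)" by auto
      then have "norm (defect q (H q) (\<rho> q) (dchar q j) a b) \<le> 1 / (real (\<rho> q) + 1)"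
        using elim(2) b by (auto simp: bad_def not_less)
      also have "\<dots> \<le> 1 / real (\<rho> q)" using elim(2) b by (intro divide_left_mono) auto
      finally show ?case by (simp add: m_def defect_def j(1))
    qed
  qed
  have m00: "((\<lambda>q. m 0 0 q) \<longlongrightarrow> 1) primes_at_top"
  proof (rule tendsto_eventually)
    show "\<forall>\<^sub>F q in primes_at_top. m 0 0 q = 1"
      using eventually_primes_ge[of 1] by eventually_elim (simp add: m_def moment_def mean_const)
  qed
  have sym: "m a b q = cnj (m b a q)" for a b q
    unfolding m_def moment_def by (simp add: mult.commute flip: mean_cnj)
  have "((\<lambda>q. complex_of_real (\<Sum>k\<in>nzbox (cutoff (\<rho> q) q (H q)). (cmod (coef q (H q) k))\<^sup>2)) \<longlongrightarrow> of_real 1) primes_at_top"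
    by (intro tendsto_of_real sum_coef_cutoff_tendsto \<rho>)
  then have \<sigma>: "((\<lambda>q. complex_of_real (\<Sum>k\<in>nzbox (cutoff (\<rho> q) q (H q)). (cmod (coef q (H q) k))\<^sup>2)) \<longlongrightarrow> 1) primes_at_top"
    by simp
  have mom: "((\<lambda>q. m a b q) \<longlongrightarrow> (if a = b then fact a else 0)) primes_at_top" for a b
    by (rule moments_of_recursion[OF rec \<sigma> m00 sym])
  \<comment> \<open>The phase may vary arbitrarily with \<open>q\<close>: it cancels when
    \<open>a = b\<close>, and otherwise multiplies a moment tending to 0 by a number of modulus
    1.\<close>
  have mom_u: "((\<lambda>q. mean {0..<int q} (\<lambda>x. (u q * T q x) ^ a * cnj (u q * T q x) ^ b)) \<longlongrightarrow>
      (if a = b then fact a else 0)) primes_at_top" for a b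
  proof -
    have eq: "mean {0..<int q} (\<lambda>x. (u q * T q x) ^ a * cnj (u q * T q x) ^ b) = u q ^ a * cnj (u q) ^ b * m a b q" for q
      unfolding m_def moment_def T_def mean_cmult[symmetric] by (simp add: power_mult_distrib mult_ac)
    have nu: "\<forall>\<^sub>F q in primes_at_top. norm (u q) = 1"
      using np by eventually_elim (simp add: u_def nonprincipal_character.norm_phase)
    show ?thesis
    proof (cases "a = b")
      case True
      have "\<forall>\<^sub>F q in primes_at_top. m a b q = u q ^ a * cnj (u q) ^ b * m a b q"
        using nu
      proof eventually_elim
        case (elim q)
        then have "u q * cnj (u q) = 1" by (metis complex_norm_square of_real_1 one_power2)
        then have "u q ^ a * cnj (u q) ^ b = 1" using True by (simp flip: power_mult_distrib)
        then show ?case by simp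
      qed
      then show ?thesis unfolding eq by (rule Lim_transform_eventually[OF mom])
    next
      case False
      have "((\<lambda>q. norm (m a b q)) \<longlongrightarrow> 0) primes_at_top"
        using tendsto_norm[OF mom[of a b]] False by simp
      moreover have "\<forall>\<^sub>F q in primes_at_top. norm (u q ^ a * cnj (u q) ^ b * m a b q) \<le> norm (m a b q)"
        using nu by eventually_elim (simp add: norm_mult norm_power)
      ultimately have "((\<lambda>q. u q ^ a * cnj (u q) ^ b * m a b q) \<longlongrightarrow> 0) primes_at_top"
        by (rule Lim_null_comparison[rotated])
      then show ?thesis unfolding eq using False by simp
    qed
  qed
  have lim: "((\<lambda>q. mean {0..<int q} (\<lambda>x. cis (Re (cnj w * (u q * T q x))))) \<longlongrightarrow>
      of_real (exp (- (cmod w)\<^sup>2 / 4))) primes_at_top"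
    by (rule char_tendsto_of_moments[OF mom_u])
  have "((\<lambda>q. mean {0..<int q} (\<lambda>x. cis (Re (cnj w * S q x))) -
      mean {0..<int q} (\<lambda>x. cis (Re (cnj w * (u q * T q x))))) \<longlongrightarrow> 0) primes_at_top"
  proof (rule Lim_null_comparison)
    have "((\<lambda>q. norm w * sqrt (H q / real q + 1 / real (\<rho> q))) \<longlongrightarrow> norm w * sqrt (0 + 0)) primes_at_top"
      by (intro tendsto_intros inv H_ratio_tendsto_0)
    then show "((\<lambda>q. norm w * sqrt (H q / real q + 1 / real (\<rho> q))) \<longlongrightarrow> 0) primes_at_top" by simp
    show "\<forall>\<^sub>F q in primes_at_top. norm (mean {0..<int q} (\<lambda>x. cis (Re (cnj w * S q x))) -
      mean {0..<int q} (\<lambda>x. cis (Re (cnj w * (u q * T q x))))) \<le> norm w * sqrt (H q / real q + 1 / real (\<rho> q))"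
      using np eventually_prime eventually_primes_ge[of 3] \<rho>1[of 1]
    proof eventually_elim
      case (elim q)
      interpret nonprincipal_character q "chi q" by (rule elim(1))
      have q: "odd q" using elim prime_odd_nat[of q] by simp
      note Hq = H_range[OF elim(2)]
      have "norm (mean {0..<int q} (\<lambda>x. cis (Re (cnj w * S q x))) -
        mean {0..<int q} (\<lambda>x. cis (Re (cnj w * (u q * T q x))))) \<le>
        norm w * sqrt (mean {0..<int q} (\<lambda>x. (norm (S q x - u q * T q x))\<^sup>2))"
        by (rule mean_cis_diff_le)
      also have "\<dots> \<le> norm w * sqrt (H q / real q + 1 / real (\<rho> q))"
        unfolding S_def u_def T_def
        using mean_char_sum_tpoly_le[OF q, of "H q" "\<rho> q"] Hq elim(4)
        by (intro mult_left_mono real_sqrt_le_mono) auto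
      finally show ?case .
    qed
  qed
  from tendsto_add[OF this lim] show ?thesis by (simp add: S_def)
qed

lemma integral_distr_uniform:
  fixes f :: "complex \<Rightarrow> 'b::{real_normed_field, banach, second_countable_topology}"
  assumes "finite A" "f \<in> borel_measurable borel"
  shows "(\<integral>z. f z \<partial>distr (uniform_count_measure A) borel Z) = mean A (\<lambda>x. f (Z x))"
proof -
  have "Z \<in> measurable (uniform_count_measure A) borel" by simp
  then have "(\<integral>z. f z \<partial>distr (uniform_count_measure A) borel Z) = (\<integral>x. f (Z x) \<partial>uniform_count_measure A)"
    using assms(2) by (rule integral_distr)
  also have "\<dots> = (\<Sum>x\<in>A. f (Z x) /\<^sub>R real (card A))"
    using assms(1) by (simp add: uniform_count_measure_def lebesgue_integral_point_measure_finite inverse_eq_divide)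
  finally show ?thesis
    by (simp add: mean_def scaleR_conv_of_real divide_inverse sum_distrib_left mult.commute)
qed

text \<open>Chebyshev's inequality for the uniform law.\<close>

lemma measure_distr_uniform_tail_le:
  assumes A: "finite A" "A \<noteq> {}" and Z: "mean A (\<lambda>x. (norm (Z x :: complex))\<^sup>2) \<le> 1" and R: "R > 0"
  shows "measure (distr (uniform_count_measure A) borel Z) {z. norm z > R} \<le> 1 / R\<^sup>2"
proof -
  define B where "B = {x \<in> A. norm (Z x) > R}"
  have card: "real (card A) > 0" using A by (simp add: card_gt_0_iff)
  have open_tail: "{z :: complex. norm z > R} \<in> sets borel" by measurable
  have "measure (distr (uniform_count_measure A) borel Z) {z. norm z > R} = measure (uniform_count_measure A) B"
  proof -
    have "Z \<in> measurable (uniform_count_measure A) borel" by simp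
    then have "measure (distr (uniform_count_measure A) borel Z) {z. norm z > R} =
        measure (uniform_count_measure A) (Z -` {z. norm z > R} \<inter> space (uniform_count_measure A))"
      using open_tail by (rule measure_distr)
    also have "Z -` {z. norm z > R} \<inter> space (uniform_count_measure A) = B"
      by (auto simp: B_def space_uniform_count_measure)
    finally show ?thesis .
  qed
  also have "\<dots> = real (card B) / real (card A)"
    using A by (intro measure_uniform_count_measure) (auto simp: B_def)
  also have "\<dots> \<le> 1 / R\<^sup>2"
  proof -
    have "real (card B) * R\<^sup>2 = (\<Sum>x\<in>B. R\<^sup>2)" by simp
    also have "\<dots> \<le> (\<Sum>x\<in>B. (norm (Z x))\<^sup>2)"
      using R by (intro sum_mono power_mono) (auto simp: B_def)
    also have "\<dots> \<le> (\<Sum>x\<in>A. (norm (Z x))\<^sup>2)"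
      using A by (intro sum_mono2) (auto simp: B_def)
    also have "\<dots> \<le> real (card A)" using Z card by (simp add: mean_def)
    finally show ?thesis using card R by (simp add: field_simps)
  qed
  finally show ?thesis .
qed

lemma one_le_q_exp:
  fixes N q :: real
  assumes "1 \<le> N" "N \<le> q"
  shows "1 \<le> exp 1 * q * exp (- (ln N powr (3 / 4)))"
proof -
  define t where "t = ln N"
  have t: "0 \<le> t" "t \<le> ln q" using assms by (simp_all add: t_def)
  have "t powr (3 / 4) \<le> 1 + t"
  proof (cases "t \<le> 1")
    case True
    then have "t powr (3 / 4) \<le> 1 powr (3 / 4)" using t by (intro powr_mono2) auto
    then show ?thesis using t by simp
  next
    case False
    then have "t powr (3 / 4) \<le> t powr 1" by (intro powr_mono) auto
    then show ?thesis using False by simp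
  qed
  then have "0 \<le> 1 + ln q + - (t powr (3 / 4))" using t by linarith
  then have "1 \<le> exp (1 + ln q + - (t powr (3 / 4)))" by (simp only: one_le_exp_iff)
  also have "\<dots> = exp 1 * q * exp (- (t powr (3 / 4)))"
  proof -
    have "q > 0" using assms by linarith
    then show ?thesis by (simp only: exp_add exp_ln)
  qed
  finally show ?thesis by (simp only: t_def)
qed

theorem theorem4:
  fixes H :: "nat \<Rightarrow> real"
    and M :: "'a measure" and Z1 Z2 :: "'a \<Rightarrow> real"
  assumes H_range: "\<And>q. prime q \<Longrightarrow> 1 \<le> H q \<and> H q \<le> real q"
    and H_log: "((\<lambda>q. ln (real q / H q) / ln (real q)) \<longlongrightarrow> 0) primes_at_top"
    and H_small: "H \<in> o[primes_at_top](\<lambda>q. real q)"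
    and M: "prob_space M"
    and Z1: "distributed M lborel Z1 (normal_density 0 (sqrt (1 / 2)))"
    and Z2: "distributed M lborel Z2 (normal_density 0 (sqrt (1 / 2)))"
    and indep: "prob_space.indep_var M borel Z1 borel Z2"
  shows "\<exists>\<G> :: nat \<Rightarrow> (int \<Rightarrow> complex) set.
    (\<forall>q. prime q \<longrightarrow> \<G> q \<subseteq> {chi. dirichlet_character q chi}) \<and>
    (\<exists>C :: real. \<forall>q. prime q \<longrightarrow>
        real (card (\<G> q)) \<ge> real q * (1 - C * exp (- (ln (real q / H q) powr (3 / 4))))) \<and>
    (\<forall>chi :: nat \<Rightarrow> int \<Rightarrow> complex. (\<forall>\<^sub>F q in primes_at_top. chi q \<in> \<G> q) \<longrightarrow>
        weak_conv_along
          (\<lambda>q. distr (uniform_count_measure {0..<int q}) borel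
                  (\<lambda>x. char_sum (chi q) (H q) x / complex_of_real (sqrt (H q))))
          (distr M borel (\<lambda>\<omega>. complex_of_real (Z1 \<omega>) + \<i> * complex_of_real (Z2 \<omega>)))
          primes_at_top)"
proof -
  interpret interval_length H using H_range H_log H_small by unfold_locales
  \<comment> \<open>The diagonal choice is made on the count of exceptions, so that the bound holds
    for all \<open>q\<close> with one constant.\<close>
  have "\<exists>\<rho> :: nat \<Rightarrow> nat. (\<forall>q. real (card (bad (\<rho> q) q (H q))) \<le> real q * exp (- (ln (real q / H q) powr (3 / 4)))) \<and>
      filterlim \<rho> at_top primes_at_top"
    by (rule diagonal_sequence[OF _ eventually_card_bad_le primes_at_top_le]) (simp add: bad_def)
  then obtain \<rho> where \<rho>: "\<And>q. real (card (bad (\<rho> q) q (H q))) \<le> real q * exp (- (ln (real q / H q) powr (3 / 4)))"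
      "filterlim \<rho> at_top primes_at_top" by blast
  \<comment> \<open>The index 0, the principal character, is left out because the expansion needs a
    nonprincipal one.\<close>
  define G where "G q = dchar q ` ({1..<q - 1} - bad (\<rho> q) q (H q))" for q
  show ?thesis
  proof (intro exI[of _ G] conjI allI impI)
    fix q :: nat assume "prime q"
    then show "G q \<subseteq> {chi. dirichlet_character q chi}"
      using dirichlet_character_dchar by (auto simp: G_def)
  next
    show "\<exists>C :: real. \<forall>q. prime q \<longrightarrow>
        real (card (G q)) \<ge> real q * (1 - C * exp (- (ln (real q / H q) powr (3 / 4))))"
    \<comment> \<open>The 1 accounts for the bad characters, and \<open>2 * exp 1\<close> for the
      shortfall of 2 in the index range.\<close>
    proof (intro exI[of _ "1 + 2 * exp 1"] allI impI)
      fix q :: nat assume q: "prime q"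
      define E where "E = exp (- (ln (real q / H q) powr (3 / 4)))"
      have q2: "q \<ge> 2" using prime_ge_2_nat[OF q] .
      have "1 \<le> exp 1 * real q * E"
        unfolding E_def
      proof (rule one_le_q_exp)
        show "1 \<le> real q / H q" using H_range[OF q] by simp
        have "real q / H q \<le> real q / 1" using H_range[OF q] by (intro divide_left_mono) auto
        then show "real q / H q \<le> real q" by simp
      qed
      moreover have "card (G q) = card ({1..<q - 1} - bad (\<rho> q) q (H q))"
        unfolding G_def by (rule card_image, rule inj_on_subset[OF inj_on_dchar[OF q]]) auto
      moreover have "card {1..<q - 1} - card (bad (\<rho> q) q (H q)) \<le> card ({1..<q - 1} - bad (\<rho> q) q (H q))"
        by (rule diff_card_le_card_Diff) (simp add: bad_def)
      then have "real (q - 2) \<le> real (card ({1..<q - 1} - bad (\<rho> q) q (H q))) + real (card (bad (\<rho> q) q (H q)))"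
        by simp
      moreover have "real (q - 2) = real q - 2" using q2 by simp
      ultimately show "real (card (G q)) \<ge> real q * (1 - (1 + 2 * exp 1) * exp (- (ln (real q / H q) powr (3 / 4))))"
        using \<rho>(1)[of q] unfolding E_def[symmetric] by (simp add: algebra_simps)
    qed
  next
    fix chi :: "nat \<Rightarrow> int \<Rightarrow> complex"
    assume chi: "\<forall>\<^sub>F q in primes_at_top. chi q \<in> G q"
    define S where "S q x = char_sum (chi q) (H q) x / complex_of_real (sqrt (H q))" for q x
    interpret M: prob_space M by (rule M)
    have meas [measurable]: "Z1 \<in> borel_measurable M" "Z2 \<in> borel_measurable M"
      using distributed_measurable[OF Z1] distributed_measurable[OF Z2] by simp_all
    have "weak_conv_along (\<lambda>q. distr (uniform_count_measure {0..<int q}) borel (S q))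
          (distr M borel (\<lambda>\<omega>. complex_of_real (Z1 \<omega>) + \<i> * complex_of_real (Z2 \<omega>))) primes_at_top"
    proof (rule weak_conv_along_of_char)
      show "\<forall>\<^sub>F q in primes_at_top. prob_space (distr (uniform_count_measure {0..<int q}) borel (S q))"
        using eventually_primes_ge[of 1]
      proof eventually_elim
        case (elim q)
        then have "prob_space (uniform_count_measure {0..<int q})" by (intro prob_space_uniform_count_measure) auto
        then show ?case by (rule prob_space.prob_space_distr) simp
      qed
      show "prob_space (distr M borel (\<lambda>\<omega>. complex_of_real (Z1 \<omega>) + \<i> * complex_of_real (Z2 \<omega>)))"
        by (rule M.prob_space_distr) measurable
      fix e :: real assume e: "e > 0"
      \<comment> \<open>With this radius Chebyshev's bound is
        \<open>1 / R\<^sup>2 = e / 2\<close>.\<close>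
      define R where "R = sqrt (2 / e)"
      have R: "R > 0" "1 / R\<^sup>2 < e" using e by (auto simp: R_def)
      have "\<forall>\<^sub>F q in primes_at_top. measure (distr (uniform_count_measure {0..<int q}) borel (S q)) {z. norm z > R} < e"
        using chi eventually_prime eventually_primes_ge[of 3]
      proof eventually_elim
        case (elim q)
        then obtain j where "chi q = dchar q j" "0 < j" "j < q - 1" by (auto simp: G_def)
        then interpret nonprincipal_character q "chi q"
          using nonprincipal_character_dchar[OF elim(2)] by simp
        have "odd q" using elim prime_odd_nat[of q] by simp
        then have "mean {0..<int q} (\<lambda>x. (norm (S q x))\<^sup>2) \<le> 1"
          unfolding S_def using H_range[OF elim(2)] by (intro mean_char_sum_square_le) auto
        then have "measure (distr (uniform_count_measure {0..<int q}) borel (S q)) {z. norm z > R} \<le> 1 / R\<^sup>2"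
          using q_pos R(1) by (intro measure_distr_uniform_tail_le) auto
        then show ?case using R(2) by linarith
      qed
      then show "\<exists>R>0. \<forall>\<^sub>F q in primes_at_top. measure (distr (uniform_count_measure {0..<int q}) borel (S q)) {z. norm z > R} < e"
        using R(1) by blast
    next
      fix w :: complex
      have "(\<lambda>z. cis (Re (cnj w * z))) \<in> borel_measurable borel"
        by (intro borel_measurable_continuous_onI continuous_intros)
      then have eq: "(\<integral>z. cis (Re (cnj w * z)) \<partial>distr (uniform_count_measure {0..<int q}) borel (S q)) =
          mean {0..<int q} (\<lambda>x. cis (Re (cnj w * S q x)))" for q
        by (intro integral_distr_uniform) auto
      show "((\<lambda>q. \<integral>z. cis (Re (cnj w * z)) \<partial>distr (uniform_count_measure {0..<int q}) borel (S q)) \<longlongrightarrow>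
        (\<integral>z. cis (Re (cnj w * z)) \<partial>distr M borel (\<lambda>\<omega>. complex_of_real (Z1 \<omega>) + \<i> * complex_of_real (Z2 \<omega>)))) primes_at_top"
        unfolding eq complex_gaussian_char[OF M Z1 Z2 indep] S_def
        using chi by (intro char_sum_char_tendsto[OF \<rho>(2)]) (simp add: G_def)
    qed auto
    then show "weak_conv_along
          (\<lambda>q. distr (uniform_count_measure {0..<int q}) borel
                  (\<lambda>x. char_sum (chi q) (H q) x / complex_of_real (sqrt (H q))))
          (distr M borel (\<lambda>\<omega>. complex_of_real (Z1 \<omega>) + \<i> * complex_of_real (Z2 \<omega>)))
          primes_at_top"
      by (simp only: S_def[abs_def])
  qed
qed

end
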